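(* Let $n\ge2$ and $p\in\mathbb{N}$. For any $K\in\mathcal{K}(\mathbb{R}^n)$ and $t\in[0,1]$, one has $$\sum_{j=0}^n c_{n,p,j}(t)\,V\big(-\Delta_pK[j],K^p[np-j]\big)\leq|K|^p,$$ where $$c_{n,p,j}(t)=\sum_{m=0}^{np-j}\binom{np-m}{j}\frac{(np)!\,n!}{m!\,(np+n-m)!}(1-t)^mt^{np-m}.$$ If $\dim(K)=n$ and $\sum_{j=0}^n c_{n,p,j}(t)\,V\big(-\Delta_pK[j],K^p[np-j]\big)=|K|^p$ for some $t\in(0,1)$, then $K$ is a simplex.
   Context: $\mathcal{K}(\mathbb{R}^n)$ denotes the set of convex bodies, i.e. nonempty compact convex subsets of $\mathbb{R}^n$; $|\cdot|$ is Lebesgue measure (in the dimension of the ambient space); $\dim K$ is the dimension of the affine span of $K$; a simplex is the convex hull of affinely independent points. The mixed volume of $K_1,\dots,K_N\in\mathcal{K}(\mathbb{R}^N)$ is $V(K_1,\dots,K_N)=\frac1{N!}\frac{\partial^N}{\partial t_1\cdots\partial t_N}\big|_{t_1=\dots=t_N=0}|t_1K_1+\dots+t_NK_N|$ (Minkowski sums; the volume is a homogeneous polynomial of degree $N$ in $t_1,\dots,t_N\ge0$). $L[k]$ means that $L$ is repeated $k$ times. Identify $\mathbb{R}^{np}=(\mathbb{R}^n)^p$; $\Delta_p:\mathbb{R}^n\to\mathbb{R}^{np}$, $\Delta_p(x)=(x,\dots,x)$; $-\Delta_pK=\{-\Delta_p(x):x\in K\}$; $K^p=K\times\cdots\times K\subset\mathbb{R}^{np}$.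 Convention $0^0=1$. *)

theory Defs
  imports "HOL-Analysis.Analysis" "HOL-Library.Set_Algebras"
begin

definition convex_body :: "'a::euclidean_space set \<Rightarrow> bool" where
  "convex_body K \<longleftrightarrow> K \<noteq> {} \<and> compact K \<and> convex K"

text \<open>
  The sum is the Minkowski sum of sets from \<^theory>\<open>HOL-Library.Set_Algebras\<close>.
\<close>

definition vol_comb :: "'a::euclidean_space set list \<Rightarrow> (nat \<Rightarrow> real) \<Rightarrow> real" where
  "vol_comb Ks t = measure lebesgue (\<Sum>i<length Ks. (\<lambda>x. t i *\<^sub>R x) ` (Ks ! i))"

text \<open>
  The volume of \<open>t\<^sub>1 K\<^sub>1 + \<dots> + t\<^sub>N K\<^sub>N\<close> is a polynomial only on the orthant of
  nonnegative \<open>t\<close>, so the partial derivatives are taken within \<open>{0..}\<close>; at \<open>0\<close> they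
  are right derivatives.
\<close>

definition partial_nonneg :: "nat \<Rightarrow> ((nat \<Rightarrow> real) \<Rightarrow> real) \<Rightarrow> (nat \<Rightarrow> real) \<Rightarrow> real" where
  "partial_nonneg i f t = vector_derivative (\<lambda>s. f (t(i := s))) (at (t i) within {0..})"

text \<open>
  Meaningful for lists of \<open>DIM('a)\<close> convex bodies; the bodies are indexed from \<open>0\<close>.
\<close>

definition mixed_volume :: "'a::euclidean_space set list \<Rightarrow> real" where
  "mixed_volume Ks =
     foldr partial_nonneg [0..<length Ks] (vol_comb Ks) (\<lambda>_. 0) / fact (length Ks)"

text \<open>
  \<open>\<real>\<^sup>n\<^sup>p = (\<real>\<^sup>n)\<^sup>p\<close> is the type \<open>real ^ 'n ^ 'p\<close>, a Euclidean space of dimension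
  \<open>CARD('p) * CARD('n)\<close>: an element has \<open>p\<close> components \<open>x $ i\<close>, each in \<open>real ^ 'n\<close>.
\<close>

definition diag :: "real ^ 'n \<Rightarrow> real ^ 'n ^ 'p" where
  "diag x = (\<chi> i. x)"

definition set_power :: "(real ^ 'n) set \<Rightarrow> (real ^ 'n ^ 'p) set" where
  "set_power K = {x. \<forall>i. x $ i \<in> K}"

definition coeff_c :: "nat \<Rightarrow> nat \<Rightarrow> nat \<Rightarrow> real \<Rightarrow> real" where
  "coeff_c n p j t =
     (\<Sum>m = 0..n * p - j. real ((n * p - m) choose j)
        * (fact (n * p) * fact n / (fact m * fact (n * p + n - m)))
        * (1 - t) ^ m * t ^ (n * p - m))"

end

theory Submission
  imports Defs "HOL-Computational_Algebra.Polynomial"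
begin

text \<open>
  Put \<open>S(x) = {z \<in> K. x\<^sub>i + t z \<in> K for all i}\<close>. By Fubini, the integral of \<open>|S(x)|\<close> over all
  \<open>x\<close> in \<open>\<real>\<^sup>n\<^sup>p\<close> is \<open>|K| |K|\<^sup>p\<close>. If \<open>x = (1 - t + t r) y - t r \<Delta> z\<close> with \<open>y \<in> K\<^sup>p\<close> and
  \<open>z \<in> K\<close>, then \<open>S(x)\<close> contains \<open>(1 - r) K + r z\<close>, so \<open>|S(x)| \<ge> (1 - r)\<^sup>n |K|\<close> on the set
  \<open>M\<^sub>r = (1 - t + t r) K\<^sup>p - t r \<Delta> K\<close>. Hence the integral of \<open>n (1 - r)\<^sup>n\<^sup>-\<^sup>1 |M\<^sub>r|\<close> over
  \<open>r \<in> [0, 1]\<close> is at most \<open>|K|\<^sup>p\<close>. Since \<open>|M\<^sub>r|\<close> is a polynomial whose coefficients are the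
  mixed volumes, beta integrals turn this into the stated inequality.

  That \<open>|s A + r B|\<close> is a polynomial is seen from a triangulation of the cone over the Cayley
  polytope of \<open>A\<close> and \<open>B\<close>: the slice of a simplicial cone has volume \<open>c s\<^sup>a r\<^sup>b\<close>. General bodies
  are limits of polytopes, and the nonnegative coefficients stay bounded.

  In the case of equality, lower semicontinuity of \<open>|S(x)|\<close> shows that every \<open>S(x)\<close> with nonempty
  interior is a homothet of \<open>K\<close>. Homothets of \<open>K\<close> are ordered by inclusion like the points of
  \<open>\<real>\<^sup>n\<^sup>+\<^sup>1\<close> ordered by the cone over \<open>K\<close>, and intersections are then meets. For extreme points \<open>u \<noteq> v\<close> and
  small \<open>\<epsilon> > 0\<close> the meet of \<open>(u, 1)\<close> and \<open>\<epsilon> (v, 1)\<close> exists and is \<open>0\<close>, which excludes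
  linear relations between the extreme rays. So the extreme points are affinely independent.
\<close>

section \<open>Linear maps and Lebesgue measure\<close>

text \<open>The sum stops at \<open>n\<close>, although the ambient dimension is \<open>np\<close>,
  because \<open>-\<Delta> K\<close> lies in an \<open>n\<close>-dimensional subspace: no higher
  power of its factor occurs in the volume polynomial. The coefficients \<open>c\<close> arise by
  expanding \<open>(1 - t + t r)^(np - j)\<close> and integrating each \<open>r^(np - m)\<close>
  against \<open>n (1 - r)^(n - 1)\<close>. That weight is a layer-cake density: its mass beyond
  \<open>\<rho>\<close> is \<open>(1 - \<rho>)^n\<close>, the volume ratio of a homothet of ratio
  \<open>1 - \<rho>\<close>, and for each \<open>x\<close> the least \<open>r\<close> with
  \<open>x\<close> in \<open>M\<^sub>r\<close> gives the largest homothet. Mixed volumes are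
  iterated right derivatives at \<open>0\<close>, so they are accessible only once the volume is a
  polynomial on the closed orthant. Triangulations give this for positive \<open>s\<close> and
  \<open>r\<close>; the limit argument also has to reach the boundary. If \<open>|K| = 0\<close>,
  comparing the two integrals over \<open>x\<close> says nothing, and each
  \<open>|M\<^sub>r|\<close> is shown to vanish instead. In the case of equality the simplex is read
  off from the fibers over diagonal \<open>x\<close>.\<close>

lemma nn_integral_lborel_translation:
  fixes f :: "'a::euclidean_space \<Rightarrow> ennreal"
  assumes [measurable]: "f \<in> borel_measurable borel"
  shows "(\<integral>\<^sup>+y. f (a + y) \<partial>lborel) = (\<integral>\<^sup>+y. f y \<partial>lborel)"
proof -
  have "(\<integral>\<^sup>+y. f y \<partial>lborel) = (\<integral>\<^sup>+y. f y \<partial>distr lborel borel ((+) a))"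
    by (simp add: lborel_distr_plus)
  also have "\<dots> = (\<integral>\<^sup>+y. f (a + y) \<partial>lborel)"
    by (subst nn_integral_distr) auto
  finally show ?thesis by simp
qed

lemma nn_integral_lborel_reflection:
  fixes f :: "'a::euclidean_space \<Rightarrow> ennreal"
  assumes [measurable]: "f \<in> borel_measurable borel"
  shows "(\<integral>\<^sup>+y. f (a - y) \<partial>lborel) = (\<integral>\<^sup>+y. f y \<partial>lborel)"
proof -
  have eq: "lborel = distr lborel borel (\<lambda>x. a - x)"
    using lborel_affine[of "-1" a] by (simp add: density_1)
  have "(\<integral>\<^sup>+y. f y \<partial>lborel) = (\<integral>\<^sup>+y. f y \<partial>distr lborel borel (\<lambda>x. a - x))"
    by (subst eq) (rule refl)
  also have "\<dots> = (\<integral>\<^sup>+y. f (a - y) \<partial>lborel)"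
    by (subst nn_integral_distr) auto
  finally show ?thesis by simp
qed

lemma linear_measurable_borel:
  fixes f :: "'a::euclidean_space \<Rightarrow> 'b::euclidean_space"
  shows "linear f \<Longrightarrow> f \<in> borel_measurable borel"
  by (simp add: borel_measurable_continuous_onI linear_continuous_on linear_conv_bounded_linear)

lemma linear_bij_image_borel:
  fixes f :: "'a::euclidean_space \<Rightarrow> 'a"
  assumes f: "linear f" "bij f" and A: "A \<in> sets borel"
  shows "f ` A \<in> sets borel"
proof -
  have "inv f \<in> borel_measurable borel"
    using f by (simp add: bij_is_inj inj_linear_imp_inv_linear linear_measurable_borel)
  moreover have "f ` A = inv f -` A"
    using f by (metis bij_betw_inv_into bij_vimage_eq_inv_image inv_inv_eq)
  ultimately show ?thesis using A measurable_sets[of "inv f" borel borel A] by simp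
qed

text \<open>Fubini shows \<open>|g A| |C| = |g C| |A|\<close> for all Borel sets \<open>A\<close> and \<open>C\<close>, as in the proof
  that Haar measure is unique.\<close>

lemma linear_bij_measure_scaling:
  fixes g :: "'a::euclidean_space \<Rightarrow> 'a"
  assumes g: "linear g" "bij g"
  obtains \<delta> where "\<delta> > 0"
    "\<And>A. A \<in> sets borel \<Longrightarrow> emeasure lborel (g ` A) = ennreal \<delta> * emeasure lborel A"
proof -
  define g' where "g' = inv g"
  have g': "linear g'"
    unfolding g'_def using g by (simp add: linear_inj_imp_surj bij_is_inj inj_linear_imp_inv_linear)
  have gg'[simp]: "g (g' x) = x" and g'g[simp]: "g' (g x) = x" for x
    using g unfolding g'_def by (simp_all add: bij_is_surj surj_f_inv_f bij_is_inj)
  have [measurable]: "g \<in> borel_measurable borel" "g' \<in> borel_measurable borel"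
    using g g' by (simp_all add: linear_measurable_borel)
  have img: "g ` A = g' -` A" for A
    by (metis bij_vimage_eq_inv_image[of g'] bij_betw_inv_into g(2) g'_def inv_inv_eq)
  have [measurable]: "g ` A \<in> sets borel" if "A \<in> sets borel" for A
    using g that by (rule linear_bij_image_borel)
  have key: "emeasure lborel (g ` A) * emeasure lborel C = emeasure lborel (g ` C) * emeasure lborel A"
    if [measurable]: "A \<in> sets borel" "C \<in> sets borel" for A C
  proof -
    have "emeasure lborel (g ` A) * emeasure lborel C
        = (\<integral>\<^sup>+u. indicator (g ` A) u * (\<integral>\<^sup>+y. indicator C (g' u + y) \<partial>lborel) \<partial>lborel)"
      by (subst nn_integral_lborel_translation) (auto simp: nn_integral_multc)
    also have "\<dots> = (\<integral>\<^sup>+u. (\<integral>\<^sup>+y. indicator A (g' u) * indicator C (g' u + y) \<partial>lborel) \<partial>lborel)"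
      by (subst nn_integral_cmult[symmetric]) (auto simp: img indicator_def)
    also have "\<dots> = (\<integral>\<^sup>+y. (\<integral>\<^sup>+u. indicator A (g' u) * indicator C (g' u + y) \<partial>lborel) \<partial>lborel)"
      by (rule lborel_pair.Fubini') measurable
    \<comment> \<open>Translating \<open>u\<close> by \<open>g y\<close> adds \<open>y\<close> to
      \<open>g' u\<close>, which moves \<open>y\<close> from the argument of \<open>C\<close> to
      that of \<open>A\<close>. The integral over \<open>y\<close> can then be done first and gives
      \<open>|A|\<close>.\<close>
    also have "\<dots> = (\<integral>\<^sup>+y. (\<integral>\<^sup>+u. indicator A (g' u - y) * indicator C (g' u) \<partial>lborel) \<partial>lborel)"
    proof (rule nn_integral_cong)
      fix y :: 'a
      show "(\<integral>\<^sup>+u. indicator A (g' u) * indicator C (g' u + y) \<partial>lborel)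
          = (\<integral>\<^sup>+u. indicator A (g' u - y) * indicator C (g' u) \<partial>lborel)"
        using nn_integral_lborel_translation
          [of "\<lambda>u. indicator A (g' u - y) * indicator C (g' u) :: ennreal" "g y"]
        by (simp add: linear_add[OF g'] add.commute)
    qed
    also have "\<dots> = (\<integral>\<^sup>+u. (\<integral>\<^sup>+y. indicator A (g' u - y) * indicator C (g' u) \<partial>lborel) \<partial>lborel)"
      by (rule lborel_pair.Fubini') measurable
    also have "\<dots> = (\<integral>\<^sup>+u. emeasure lborel A * indicator (g ` C) u \<partial>lborel)"
    proof (rule nn_integral_cong)
      fix u :: 'a
      show "(\<integral>\<^sup>+y. indicator A (g' u - y) * indicator C (g' u) \<partial>lborel)
          = emeasure lborel A * indicator (g ` C) u"
        using nn_integral_lborel_reflection[of "indicator A" "g' u"]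
        by (cases "g' u \<in> C") (simp_all add: img nn_integral_indicator[symmetric] del: nn_integral_indicator)
    qed
    also have "\<dots> = emeasure lborel (g ` C) * emeasure lborel A"
      by (subst nn_integral_cmult) (auto simp: mult.commute)
    finally show ?thesis .
  qed
  \<comment> \<open>The unit cube has volume 1, so \<open>key\<close> makes \<open>|g C|\<close> the
    scaling factor. Applied to the inverse image of the cube, \<open>key\<close> shows a product
    equal to 1, so this factor is not 0.\<close>
  define C :: "'a set" where "C = cbox 0 One"
  have C: "emeasure lborel C = 1" "C \<in> sets borel"
    by (auto simp: C_def emeasure_lborel_cbox_eq inner_Basis)
  have "bounded (g ` C)"
    using g by (simp add: C_def bounded_linear_image linear_conv_bounded_linear)
  then have fin: "emeasure lborel (g ` C) < \<infinity>"
    by (rule emeasure_bounded_finite)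
  have "g ` (g' ` C) = C"
    by (auto simp: image_image)
  moreover have "g' ` C \<in> sets borel"
  proof -
    have "bij g'" using g by (simp add: g'_def bij_imp_bij_inv)
    then show ?thesis using g' C(2) by (simp add: linear_bij_image_borel)
  qed
  ultimately have "emeasure lborel (g ` C) \<noteq> 0"
    using key[of "g' ` C" C] C by auto
  then have pos: "measure lborel (g ` C) > 0" and eq: "emeasure lborel (g ` C) = ennreal (measure lborel (g ` C))"
    using fin emeasure_eq_ennreal_measure[of lborel "g ` C"]
    by (auto simp: zero_less_measure_iff less_top)
  have "emeasure lborel (g ` A) = ennreal (measure lborel (g ` C)) * emeasure lborel A"
    if "A \<in> sets borel" for A
    using key[OF that C(2)] C(1) by (metis eq mult.right_neutral)
  with pos show ?thesis by (rule that)
qed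

text \<open>Conjugation replaces determinants: if \<open>g\<close> carries the standard basis to
  \<open>U\<close>, then \<open>L (g x) = g (D x)\<close> with \<open>D\<close> diagonal, and the
  unknown scaling factor of \<open>g\<close> cancels.\<close>

lemma eigenbasis_measure_scaling:
  fixes L :: "'a::euclidean_space \<Rightarrow> 'a"
  assumes L: "linear L" and U: "independent U" "span U = UNIV"
    and ev: "\<And>u. u \<in> U \<Longrightarrow> L u = c u *\<^sub>R u" and c: "\<And>u. u \<in> U \<Longrightarrow> c u > 0"
    and A: "A \<in> sets borel"
  shows "measure lborel (L ` A) = (\<Prod>u\<in>U. c u) * measure lborel A"
proof -
  have finU: "finite U" using U(1) by (rule independent_imp_finite)
  have cardU: "card U = card (Basis :: 'a set)"
    using U by (metis dim_UNIV dim_eq_card_independent dim_span)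
  obtain \<beta> :: "'a \<Rightarrow> 'a" where \<beta>: "bij_betw \<beta> Basis U"
    using finU cardU by (metis finite_Basis finite_same_card_bij)
  obtain g where g: "linear g" "\<And>b. b \<in> Basis \<Longrightarrow> g b = \<beta> b"
    using linear_independent_extend[OF independent_Basis, of \<beta>] by blast
  have "range g = span (g ` Basis)"
    using linear_span_image[OF g(1), of Basis] by simp
  also have "g ` Basis = U"
    using \<beta> g(2) by (auto simp: bij_betw_def)
  finally have "surj g" using U by simp
  then have "bij g" using g(1) by (simp add: bij_def linear_surj_imp_inj)
  then obtain \<delta> where \<delta>: "\<delta> > 0"
    "\<And>A. A \<in> sets borel \<Longrightarrow> emeasure lborel (g ` A) = ennreal \<delta> * emeasure lborel A"
    using linear_bij_measure_scaling g(1) by blast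
  define D where "D x = (\<Sum>j\<in>Basis. (c (\<beta> j) * (x \<bullet> j)) *\<^sub>R j)" for x :: 'a
  have linD: "linear D" unfolding D_def
    by (auto intro!: linearI simp: inner_add_left distrib_left scaleR_add_left sum.distrib scaleR_sum_right mult_ac)
  have Lg: "L (g x) = g (D x)" for x
  proof -
    have "linear (\<lambda>x. L (g x))" "linear (\<lambda>x. g (D x))"
      using linear_compose[OF g(1) L] linear_compose[OF linD g(1)] by (simp_all add: o_def)
    moreover have "L (g b) = g (D b)" if "b \<in> Basis" for b
    proof -
      have "D b = (\<Sum>j\<in>Basis. if j = b then c (\<beta> b) *\<^sub>R b else 0)"
        unfolding D_def using that by (intro sum.cong) (auto simp: inner_Basis)
      also have "\<dots> = c (\<beta> b) *\<^sub>R b" using that by simp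
      finally show ?thesis
        using that g \<beta> ev[of "\<beta> b"] by (simp add: linear_scale bij_betwE)
    qed
    ultimately show ?thesis by (metis linear_eq_stdbasis)
  qed
  have cpos: "c (\<beta> j) > 0" if "j \<in> Basis" for j
    using that \<beta> c by (auto simp: bij_betwE)
  have [measurable]: "D \<in> borel_measurable borel"
    using linD by (rule linear_measurable_borel)
  have bijD: "bij D"
  proof -
    have "D x = 0 \<Longrightarrow> x = 0" for x
    proof -
      assume "D x = 0"
      then have "c (\<beta> j) * (x \<bullet> j) = 0" if "j \<in> Basis" for j
        using inner_sum_left_Basis[OF that, of "\<lambda>j. c (\<beta> j) * (x \<bullet> j)"]
        by (metis D_def inner_zero_left)
      then have "x \<bullet> j = 0" if "j \<in> Basis" for j
        using cpos[OF that] that by fastforce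
      then show "x = 0" by (auto intro: euclidean_eqI)
    qed
    then have "inj D" using linD by (simp add: linear_injective_0)
    then show ?thesis using linD by (simp add: bij_def linear_inj_imp_surj)
  qed
  have scD: "emeasure lborel (D ` B) = ennreal (\<Prod>u\<in>U. c u) * emeasure lborel B"
    if B: "B \<in> sets borel" for B
  proof -
    have D_eq: "(\<lambda>x. 0 + (\<Sum>j\<in>Basis. (c (\<beta> j) * (x \<bullet> j)) *\<^sub>R j)) = D"
      by (simp add: fun_eq_iff D_def)
    have "c (\<beta> j) \<noteq> 0" if "j \<in> Basis" for j
      using cpos[OF that] by simp
    from lborel_affine_euclidean[of "\<lambda>j. c (\<beta> j)" 0, unfolded D_eq, OF this]
    have eq: "lborel = density (distr lborel borel D) (\<lambda>_. (\<Prod>j\<in>Basis. \<bar>c (\<beta> j)\<bar>))" .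
    have "emeasure lborel (D ` B) = emeasure (density (distr lborel borel D) (\<lambda>_. (\<Prod>j\<in>Basis. \<bar>c (\<beta> j)\<bar>))) (D ` B)"
      by (subst eq) (rule refl)
    also have "\<dots> = ennreal (\<Prod>j\<in>Basis. \<bar>c (\<beta> j)\<bar>) * emeasure lborel (D -` D ` B)"
      using linear_bij_image_borel[OF linD bijD B] by (simp add: emeasure_density_const emeasure_distr)
    also have "D -` D ` B = B" using bijD by (simp add: bij_is_inj inj_vimage_image_eq)
    also have "(\<Prod>j\<in>Basis. \<bar>c (\<beta> j)\<bar>) = (\<Prod>j\<in>Basis. c (\<beta> j))"
      using cpos by (intro prod.cong) (auto simp: less_imp_le)
    also have "\<dots> = (\<Prod>u\<in>U. c u)"
      by (rule prod.reindex_bij_betw[OF \<beta>])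
    finally show ?thesis .
  qed
  define B where "B = g -` A"
  have gm: "g \<in> borel_measurable borel"
    using g(1) by (rule linear_measurable_borel)
  have B: "B \<in> sets borel" unfolding B_def using measurable_sets[OF gm A] by simp
  have gB: "g ` B = A" unfolding B_def using \<open>surj g\<close> by (simp add: surj_image_vimage_eq)
  have "L ` A = g ` (D ` B)"
    unfolding gB[symmetric] by (auto simp: image_image Lg)
  moreover have "D ` B \<in> sets borel"
    by (rule linear_bij_image_borel[OF linD bijD B])
  ultimately have "emeasure lborel (L ` A) = ennreal \<delta> * (ennreal (\<Prod>u\<in>U. c u) * emeasure lborel B)"
    using \<delta>(2) scD B by simp
  also have "\<dots> = ennreal (\<Prod>u\<in>U. c u) * emeasure lborel A"
    using \<delta>(2)[OF B] gB by (simp add: mult_ac)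
  finally show ?thesis
    using c by (simp add: measure_def enn2real_mult prod_nonneg less_imp_le)
qed

section \<open>Regular triangulations of polyhedral cones\<close>

definition pos_span :: "'a::real_vector set \<Rightarrow> 'a set" where
  "pos_span S = {\<Sum>e\<in>S. c e *\<^sub>R e |c. \<forall>e\<in>S. c e \<ge> 0}"

lemma pos_spanI: "y = (\<Sum>e\<in>S. c e *\<^sub>R e) \<Longrightarrow> (\<And>e. e \<in> S \<Longrightarrow> c e \<ge> 0) \<Longrightarrow> y \<in> pos_span S"
  unfolding pos_span_def by blast

lemma pos_span_mono:
  assumes "S \<subseteq> T" "finite T"
  shows "pos_span S \<subseteq> pos_span T"
proof
  fix y assume "y \<in> pos_span S"
  then obtain c where c: "y = (\<Sum>e\<in>S. c e *\<^sub>R e)" "\<And>e. e \<in> S \<Longrightarrow> c e \<ge> 0"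
    unfolding pos_span_def by blast
  have "(\<Sum>e\<in>T. (if e \<in> S then c e else 0) *\<^sub>R e) = (\<Sum>e\<in>S. c e *\<^sub>R e)"
    using assms by (intro sum.mono_neutral_cong_right) auto
  then show "y \<in> pos_span T"
    using c by (intro pos_spanI[where c = "\<lambda>e. if e \<in> S then c e else 0"]) auto
qed

text \<open>The ratio test of the simplex method: subtracting the smallest ratio times
  \<open>\<beta>\<close> empties the entry at \<open>f0\<close> and keeps the others nonnegative. It
  drives both the Caratheodory reduction and the pivot in the triangulation.\<close>

lemma min_ratio:
  fixes c \<beta> :: "'a \<Rightarrow> real"
  assumes "finite S" and c: "\<And>f. f \<in> S \<Longrightarrow> c f \<ge> 0" and "f1 \<in> S" "\<beta> f1 > 0"
  obtains f0 where "f0 \<in> S" "\<beta> f0 > 0" "\<And>f. f \<in> S \<Longrightarrow> c f - c f0 / \<beta> f0 * \<beta> f \<ge> 0"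
proof -
  define P where "P = {f\<in>S. \<beta> f > 0}"
  have "finite P" "P \<noteq> {}" using assms by (auto simp: P_def)
  then obtain f0 where f0: "f0 \<in> P" "\<And>f. f \<in> P \<Longrightarrow> c f0 / \<beta> f0 \<le> c f / \<beta> f"
    using arg_min_if_finite(1)[of P "\<lambda>f. c f / \<beta> f"] arg_min_least[of P _ "\<lambda>f. c f / \<beta> f"] by blast
  have "c f - c f0 / \<beta> f0 * \<beta> f \<ge> 0" if "f \<in> S" for f
  proof (cases "\<beta> f > 0")
    case True
    then show ?thesis using f0(2)[of f] that by (simp add: P_def le_divide_eq)
  next
    case False
    moreover have "c f0 / \<beta> f0 \<ge> 0" using f0 c by (simp add: P_def)
    ultimately have "c f0 / \<beta> f0 * \<beta> f \<le> 0" by (intro mult_nonneg_nonpos) auto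
    then show ?thesis using c[OF that] by linarith
  qed
  then show ?thesis using that f0 by (auto simp: P_def)
qed

lemma conic_caratheodory:
  assumes "finite E" "y \<in> pos_span E"
  obtains S where "S \<subseteq> E" "independent S" "y \<in> pos_span S"
proof -
  define R where "R = {S. S \<subseteq> E \<and> y \<in> pos_span S}"
  have "finite R" "R \<noteq> {}" using assms by (auto simp: R_def)
  then obtain S where S: "S \<in> R" and min: "\<And>S'. S' \<in> R \<Longrightarrow> card S \<le> card S'"
    by (metis arg_min_if_finite(1) arg_min_least)
  have finS: "finite S" using S assms(1) by (auto simp: R_def finite_subset)
  obtain c where c: "y = (\<Sum>e\<in>S. c e *\<^sub>R e)" "\<And>e. e \<in> S \<Longrightarrow> c e \<ge> 0"
    using S unfolding R_def pos_span_def by blast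
  have "independent S"
  proof
    assume "dependent S"
    then obtain u v where u: "(\<Sum>e\<in>S. u e *\<^sub>R e) = 0" "v \<in> S" "u v \<noteq> 0"
      using finS by (auto simp: dependent_finite)
    \<comment> \<open>The dependency gets the sign that makes its coefficient at \<open>v\<close>
      positive, as the ratio test requires.\<close>
    define \<beta> where "\<beta> e = (if u v > 0 then u e else - u e)" for e
    have \<beta>0: "(\<Sum>e\<in>S. \<beta> e *\<^sub>R e) = 0"
      using u(1) by (cases "u v > 0") (simp_all add: \<beta>_def sum_negf)
    have \<beta>v: "\<beta> v > 0" using u(3) by (simp add: \<beta>_def)
    obtain f0 where f0: "f0 \<in> S" "\<beta> f0 > 0" and pos: "\<And>f. f \<in> S \<Longrightarrow> c f - c f0 / \<beta> f0 * \<beta> f \<ge> 0"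
      using min_ratio[of S c v \<beta>] finS c(2) u(2) \<beta>v by metis
    define d where "d f = c f - c f0 / \<beta> f0 * \<beta> f" for f
    have "(\<Sum>e\<in>S. d e *\<^sub>R e) = y - (c f0 / \<beta> f0) *\<^sub>R (\<Sum>e\<in>S. \<beta> e *\<^sub>R e)"
      unfolding d_def c(1) by (simp add: scaleR_sum_right scaleR_diff_left sum_subtractf)
    also have "\<dots> = y" using \<beta>0 by simp
    finally have "y = (\<Sum>e\<in>S - {f0}. d e *\<^sub>R e)"
      using f0 finS by (simp add: sum.remove d_def)
    then have "y \<in> pos_span (S - {f0})"
      using pos by (intro pos_spanI[where c = d]) (auto simp: d_def)
    then have "card S \<le> card (S - {f0})"
      using S by (intro min) (auto simp: R_def)
    then show False using f0 finS by (simp add: card_gt_0_iff card_Diff_singleton)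
      (metis Suc_pred card_gt_0_iff empty_iff not_less_eq_eq order_refl)
  qed
  then show ?thesis using that S by (auto simp: R_def)
qed

lemma representation_unique_sum:
  assumes "independent S" "finite S" "y = (\<Sum>f\<in>S. c f *\<^sub>R f)" "f \<in> S"
  shows "representation S y f = c f"
proof -
  have "y \<in> span S" using assms by (auto intro: span_sum span_scale span_base)
  then have "(\<Sum>f\<in>S. representation S y f *\<^sub>R f) = y"
    using assms by (simp add: real_vector.sum_representation_eq)
  then have "(\<Sum>f\<in>S. (representation S y f - c f) *\<^sub>R f) = 0"
    using assms(3) by (simp add: scaleR_diff_left sum_subtractf)
  then show ?thesis
    using independentD[OF assms(1,2) subset_refl, of "\<lambda>f. representation S y f - c f"] assms(4) by simp
qed

text \<open>The weights \<open>\<delta> ^ k e\<close> are generic as soon as \<open>\<delta>\<close> avoids the roots of finitely many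
  nonzero polynomials.\<close>

lemma generic_weights:
  fixes E :: "'a::real_vector set"
  assumes E: "finite E"
  obtains w :: "'a \<Rightarrow> real" where
    "\<And>T e. T \<subseteq> E \<Longrightarrow> e \<in> E - T \<Longrightarrow> w e \<noteq> (\<Sum>f\<in>T. representation T e f * w f)"
proof -
  obtain k :: "'a \<Rightarrow> nat" where k: "inj_on k E"
    using finite_imp_inj_to_nat_seg[OF E] by blast
  \<comment> \<open>By injectivity of \<open>k\<close> no other summand has the exponent
    \<open>k e\<close>, so its coefficient is 1 whatever \<open>representation\<close> returns,
    including the default 0 for dependent \<open>T\<close> or \<open>e\<close> outside the
    span.\<close>
  define q where "q T e = monom 1 (k e) - (\<Sum>f\<in>T. monom (representation T e f) (k f))"
    for T e
  have q: "q T e \<noteq> 0" if "T \<subseteq> E" "e \<in> E - T" for T e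
  proof -
    have "coeff (q T e) (k e) = 1 - (\<Sum>f\<in>T. if k f = k e then representation T e f else 0)"
      by (simp add: q_def coeff_sum)
    also have "(\<Sum>f\<in>T. if k f = k e then representation T e f else 0) = 0"
      using that k by (intro sum.neutral) (auto simp: inj_on_def)
    finally show ?thesis by auto
  qed
  define B where "B = (\<Union>(T, e)\<in>{(T, e). T \<subseteq> E \<and> e \<in> E - T}. {x. poly (q T e) x = 0})"
  have "finite ({(T, e). T \<subseteq> E \<and> e \<in> E - T})"
    by (rule finite_subset[of _ "Pow E \<times> E"]) (use E in auto)
  then have "finite B"
    unfolding B_def using q by (intro finite_UN_I) (auto intro: poly_roots_finite)
  then obtain \<delta> :: real where \<delta>: "\<delta> \<notin> B"
    using infinite_UNIV_char_0 ex_new_if_finite by blast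
  show ?thesis
  proof (rule that)
    fix T e assume "T \<subseteq> E" "e \<in> E - T"
    then have "poly (q T e) \<delta> \<noteq> 0" using \<delta> by (auto simp: B_def)
    then show "\<delta> ^ k e \<noteq> (\<Sum>f\<in>T. representation T e f * \<delta> ^ k f)"
      by (simp add: q_def poly_sum poly_monom)
  qed
qed

text \<open>A regular triangulation of the cone over a finite set. Its cells are the dual feasible bases
  of the linear programs that minimise a generic weight over the representations of a point, and
  which bases are dual feasible does not depend on the point.\<close>

lemma cone_triangulation:
  fixes E :: "'a::euclidean_space set"
  assumes E: "finite E" and h: "linear h" "\<And>e. e \<in> E \<Longrightarrow> h e > (0::real)"
  obtains \<T> where
    "\<forall>T\<in>\<T>. T \<subseteq> E \<and> independent T \<and> span T = UNIV"
    "\<forall>T\<in>\<T>. \<forall>T'\<in>\<T>. pos_span T \<inter> pos_span T' \<subseteq> pos_span (T \<inter> T')"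
    "pos_span E \<subseteq> (\<Union>T\<in>\<T>. pos_span T) \<union> (\<Union>S\<in>{S. S \<subseteq> E \<and> span S \<noteq> UNIV}. pos_span S)"
proof -
  obtain w :: "'a \<Rightarrow> real" where w:
    "\<And>T e. T \<subseteq> E \<Longrightarrow> e \<in> E - T \<Longrightarrow> w e \<noteq> (\<Sum>f\<in>T. representation T e f * w f)"
    using generic_weights[OF E] by metis
  \<comment> \<open>\<open>\<phi>\<close> is a dual solution: a linear minorant of the weights on
    \<open>E\<close> that is tight exactly on \<open>T\<close>.\<close>
  define \<T> where "\<T> = {T. T \<subseteq> E \<and> independent T \<and> span T = UNIV \<and>
    (\<exists>\<phi>. linear \<phi> \<and> (\<forall>e\<in>T. \<phi> e = w e) \<and> (\<forall>e\<in>E - T. \<phi> e < w e))}"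
  show ?thesis
  proof (rule that[of \<T>])
    show "\<forall>T\<in>\<T>. T \<subseteq> E \<and> independent T \<and> span T = UNIV"
      by (simp add: \<T>_def)
    show "\<forall>T\<in>\<T>. \<forall>T'\<in>\<T>. pos_span T \<inter> pos_span T' \<subseteq> pos_span (T \<inter> T')"
    proof (intro ballI subsetI)
      fix T T' y assume T: "T \<in> \<T>" "T' \<in> \<T>" and y: "y \<in> pos_span T \<inter> pos_span T'"
      \<comment> \<open>Weak duality bounds \<open>\<phi> y\<close> by the cost of \<open>y\<close>
        over \<open>T'\<close>, which is \<open>\<phi>' y\<close>. Used in both directions it gives
        equality, and then complementary slackness leaves \<open>y\<close> no coefficient outside
        \<open>T\<close>.\<close>
      have *: "\<phi> y \<le> \<phi>' y \<and> (\<phi> y = \<phi>' y \<longrightarrow> y \<in> pos_span (T \<inter> T'))"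
        if T: "T \<subseteq> E" "T' \<subseteq> E"
        and \<phi>: "linear \<phi>" "\<forall>e\<in>T. \<phi> e = w e" "\<forall>e\<in>E - T. \<phi> e < w e"
        and \<phi>': "linear \<phi>'" "\<forall>e\<in>T'. \<phi>' e = w e"
        and y: "y \<in> pos_span T'" for T T' \<phi> \<phi>'
      proof -
        obtain c where c: "y = (\<Sum>e\<in>T'. c e *\<^sub>R e)" "\<And>e. e \<in> T' \<Longrightarrow> c e \<ge> 0"
          using y unfolding pos_span_def by blast
        have fin: "finite T'" using T E by (auto simp: finite_subset)
        have 1: "\<phi> y = (\<Sum>e\<in>T'. c e * \<phi> e)" "\<phi>' y = (\<Sum>e\<in>T'. c e * w e)"
          unfolding c(1) using \<phi> \<phi>' by (simp_all add: linear_sum linear_scale)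
        have le: "\<phi> e \<le> w e" if "e \<in> T'" for e
          using that T \<phi>(2,3) by (cases "e \<in> T") (auto simp: less_imp_le)
        have 2: "c e * \<phi> e \<le> c e * w e" if "e \<in> T'" for e
          using le c(2) that by (simp add: mult_left_mono)
        have "y \<in> pos_span (T \<inter> T')" if "\<phi> y = \<phi>' y"
        proof -
          have "(\<Sum>e\<in>T'. c e * w e - c e * \<phi> e) = 0"
            using that 1 by (simp add: sum_subtractf)
          then have "\<forall>e\<in>T'. c e * w e - c e * \<phi> e = 0"
            using 2 fin by (subst (asm) sum_nonneg_eq_0_iff) auto
          then have "c e * (w e - \<phi> e) = 0" if "e \<in> T'" for e
            using that by (simp add: algebra_simps)
          moreover have "w e - \<phi> e \<noteq> 0" if "e \<in> T' - T" for e
            using that \<phi>(3) T by force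
          ultimately have "c e = 0" if "e \<in> T' - T" for e
            using that by (metis DiffD1 mult_eq_0_iff)
          then have "y = (\<Sum>e\<in>T \<inter> T'. c e *\<^sub>R e)"
            unfolding c(1) using fin by (intro sum.mono_neutral_right) auto
          then show ?thesis using c(2) by (intro pos_spanI) auto
        qed
        then show ?thesis using 1 2 by (auto intro: sum_mono)
      qed
      obtain \<phi> \<phi>' where "linear \<phi>" "\<forall>e\<in>T. \<phi> e = w e" "\<forall>e\<in>E - T. \<phi> e < w e"
        "linear \<phi>'" "\<forall>e\<in>T'. \<phi>' e = w e" "\<forall>e\<in>E - T'. \<phi>' e < w e" "T \<subseteq> E" "T' \<subseteq> E"
        using T unfolding \<T>_def by blast
      then show "y \<in> pos_span (T \<inter> T')"
        using *[of T T' \<phi> \<phi>'] *[of T' T \<phi>' \<phi>] y by auto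
    qed
    show "pos_span E \<subseteq> (\<Union>T\<in>\<T>. pos_span T) \<union> (\<Union>S\<in>{S. S \<subseteq> E \<and> span S \<noteq> UNIV}. pos_span S)"
    proof
      fix y assume "y \<in> pos_span E"
      define R where "R = {S. S \<subseteq> E \<and> independent S \<and> y \<in> pos_span S}"
      define cost where "cost S = (\<Sum>f\<in>S. representation S y f * w f)" for S
      have "finite R" "R \<noteq> {}"
        using E conic_caratheodory[OF E \<open>y \<in> pos_span E\<close>] by (auto simp: R_def)
      then obtain S where S: "S \<in> R" and min: "\<And>S'. S' \<in> R \<Longrightarrow> cost S \<le> cost S'"
        by (metis arg_min_if_finite(1) arg_min_least)
      then have SE: "S \<subseteq> E" and ind: "independent S" and finS: "finite S"
        using E by (auto simp: R_def finite_subset)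
      obtain c where c: "y = (\<Sum>e\<in>S. c e *\<^sub>R e)" "\<And>e. e \<in> S \<Longrightarrow> c e \<ge> 0"
        using S unfolding R_def pos_span_def by blast
      have cost_eq: "cost S' = (\<Sum>f\<in>S'. d f * w f)"
        if "independent S'" "finite S'" "y = (\<Sum>e\<in>S'. d e *\<^sub>R e)" for S' d
        unfolding cost_def using representation_unique_sum[OF that] by (intro sum.cong) auto
      \<comment> \<open>A cheapest basis that does not span, or has a zero coefficient, puts
        \<open>y\<close> into the cone over a non-spanning subset. In the remaining case optimality
        has to yield dual feasibility.\<close>
      consider "span S \<noteq> UNIV" | f where "f \<in> S" "c f = 0" "span S = UNIV"
        | "\<And>f. f \<in> S \<Longrightarrow> c f > 0" "span S = UNIV"
        using c(2) by fastforce
      then show "y \<in> (\<Union>T\<in>\<T>. pos_span T) \<union> (\<Union>S\<in>{S. S \<subseteq> E \<and> span S \<noteq> UNIV}. pos_span S)"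
      proof cases
        case 1
        then show ?thesis using S SE by (auto simp: R_def)
      next
        case (2 f)
        have "y = (\<Sum>e\<in>S - {f}. c e *\<^sub>R e)"
          using c(1) 2 finS by (simp add: sum.remove)
        then have "y \<in> pos_span (S - {f})" using c(2) by (intro pos_spanI) auto
        moreover have "f \<notin> span (S - {f})" using ind 2 by (auto simp: dependent_def)
        ultimately show ?thesis using SE by blast
      next
        case 3
        obtain \<phi> where \<phi>: "linear \<phi>" "\<forall>e\<in>S. \<phi> e = w e"
          using linear_independent_extend[OF ind, of w] by blast
        have "\<phi> e < w e" if e: "e \<in> E - S" for e
        proof (rule ccontr)
          assume "\<not> \<phi> e < w e"
          define \<beta> where "\<beta> = representation S e"
          have e_eq: "e = (\<Sum>f\<in>S. \<beta> f *\<^sub>R f)"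
            using ind 3 finS by (simp add: \<beta>_def real_vector.sum_representation_eq)
          have lin_e: "\<psi> e = (\<Sum>f\<in>S. \<beta> f * \<psi> f)" if "linear \<psi>" for \<psi> :: "'a \<Rightarrow> real"
            using arg_cong[OF e_eq, of \<psi>] that by (simp add: linear_sum linear_scale)
          have \<phi>e: "\<phi> e = (\<Sum>f\<in>S. \<beta> f * w f)"
            using lin_e[OF \<phi>(1)] \<phi>(2) by simp
          then have gt: "\<phi> e > w e"
            using w[OF SE e] \<open>\<not> \<phi> e < w e\<close> by (simp add: \<beta>_def)
          \<comment> \<open>\<open>h\<close> is positive on \<open>E\<close>, so \<open>h e\<close>
            is not a combination of the \<open>h f\<close> without a positive coefficient. This
            excludes an unbounded pivot.\<close>
          have "\<exists>f\<in>S. \<beta> f > 0"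
          proof (rule ccontr)
            assume "\<not> (\<exists>f\<in>S. \<beta> f > 0)"
            then have "h e \<le> 0"
              unfolding lin_e[OF h(1)] using h(2) SE
              by (intro sum_nonpos mult_nonpos_nonneg) (auto simp: less_imp_le not_less)
            then show False using h(2)[of e] e by simp
          qed
          then obtain f1 where f1: "f1 \<in> S" "\<beta> f1 > 0" by blast
          obtain f0 where f0: "f0 \<in> S" "\<beta> f0 > 0"
            and pos: "\<And>f. f \<in> S \<Longrightarrow> c f - c f0 / \<beta> f0 * \<beta> f \<ge> 0"
            using min_ratio[of S c f1 \<beta>] finS c(2) f1 by metis
          define \<epsilon> where "\<epsilon> = c f0 / \<beta> f0"
          have \<epsilon>: "\<epsilon> > 0" using f0 3(1) by (simp add: \<epsilon>_def)
          \<comment> \<open>The pivot: \<open>e\<close> enters with coefficient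
            \<open>\<epsilon>\<close> and \<open>f0\<close> leaves. The cost changes by
            \<open>\<epsilon> (w e - \<phi> e) < 0\<close>, against minimality.\<close>
          define d where "d f = (if f = e then \<epsilon> else c f - \<epsilon> * \<beta> f)" for f
          define S' where "S' = insert e (S - {f0})"
          have eS: "e \<notin> S" using e by simp
          have sum_d: "(\<Sum>f\<in>S'. d f *\<^sub>R g f) = (\<Sum>f\<in>S. c f *\<^sub>R g f) + \<epsilon> *\<^sub>R (g e - (\<Sum>f\<in>S. \<beta> f *\<^sub>R g f))"
            for g :: "'a \<Rightarrow> 'b::real_vector"
          proof -
            have "(\<Sum>f\<in>S'. d f *\<^sub>R g f) = \<epsilon> *\<^sub>R g e + (\<Sum>f\<in>S - {f0}. d f *\<^sub>R g f)"
              using finS eS by (simp add: S'_def d_def)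
            also have "(\<Sum>f\<in>S - {f0}. d f *\<^sub>R g f) = (\<Sum>f\<in>S - {f0}. (c f - \<epsilon> * \<beta> f) *\<^sub>R g f)"
              using eS by (intro sum.cong) (auto simp: d_def)
            also have "\<dots> = (\<Sum>f\<in>S. (c f - \<epsilon> * \<beta> f) *\<^sub>R g f)"
              using f0 finS by (simp add: sum.remove[of S f0] \<epsilon>_def)
            also have "\<dots> = (\<Sum>f\<in>S. c f *\<^sub>R g f) - \<epsilon> *\<^sub>R (\<Sum>f\<in>S. \<beta> f *\<^sub>R g f)"
              by (simp add: scaleR_diff_left sum_subtractf scaleR_sum_right)
            finally show ?thesis by (simp add: algebra_simps)
          qed
          have y': "y = (\<Sum>f\<in>S'. d f *\<^sub>R f)"
            using sum_d[of "\<lambda>f. f"] c(1) e_eq by simp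
          have "e \<notin> span (S - {f0})"
          proof
            assume "e \<in> span (S - {f0})"
            then obtain u where "e = (\<Sum>f\<in>S - {f0}. u f *\<^sub>R f)"
              using span_finite[of "S - {f0}"] finS by auto
            then have "e = (\<Sum>f\<in>S. (if f = f0 then 0 else u f) *\<^sub>R f)"
              using f0 finS by (simp add: sum.remove[of S f0])
            then have "\<beta> f0 = 0"
              unfolding \<beta>_def using representation_unique_sum[OF ind finS _ f0(1)] by fastforce
            then show False using f0 by simp
          qed
          then have ind': "independent S'"
            using ind by (simp add: S'_def independent_insert independent_mono[of S])
          have d0: "d f \<ge> 0" if "f \<in> S'" for f
            using that pos \<epsilon> by (auto simp: S'_def d_def \<epsilon>_def)
          have finS': "finite S'" using finS by (simp add: S'_def)
          have "y \<in> pos_span S'"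
            using y' d0 by (rule pos_spanI)
          then have "S' \<in> R"
            using SE e ind' by (auto simp: R_def S'_def)
          then have "cost S \<le> cost S'" by (rule min)
          moreover have "cost S' = cost S + \<epsilon> * (w e - \<phi> e)"
            using sum_d[of w] cost_eq[OF ind' finS' y'] cost_eq[OF ind finS c(1)] by (simp add: \<phi>e)
          ultimately show False using \<epsilon> gt by (simp add: zero_le_mult_iff)
        qed
        then have "S \<in> \<T>" using SE ind 3 \<phi> by (auto simp: \<T>_def)
        then show ?thesis using S by (auto simp: R_def)
      qed
    qed
  qed
qed

section \<open>Minkowski combinations of polytopes\<close>

lemma compact_set_plus:
  fixes A B :: "'a::real_normed_vector set"
  assumes "compact A" "compact B"
  shows "compact (A + B)"
proof -
  have "A + B = (\<Union>x\<in>A. \<Union>y\<in>B. {x + y})" by (auto simp: set_plus_def)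
  then show ?thesis using compact_sums'[OF assms] by simp
qed

lemma convex_combination_scale_down:
  fixes c :: "'a::real_vector \<Rightarrow> real"
  assumes "finite A" "s > 0" "\<And>a. a \<in> A \<Longrightarrow> c a \<ge> 0" "sum c A = s"
  shows "(\<Sum>a\<in>A. c a *\<^sub>R a) \<in> (\<lambda>x. s *\<^sub>R x) ` (convex hull A)"
proof (rule image_eqI)
  show "(\<Sum>a\<in>A. c a *\<^sub>R a) = s *\<^sub>R (\<Sum>a\<in>A. (c a / s) *\<^sub>R a)"
    using assms(2) by (simp add: scaleR_sum_right)
  show "(\<Sum>a\<in>A. (c a / s) *\<^sub>R a) \<in> convex hull A"
    using assms by (auto simp: convex_hull_finite sum_divide_distrib[symmetric]
        intro!: exI[of _ "\<lambda>a. c a / s"])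
qed

text \<open>The vectors of \<open>cayley A B\<close> span the cone over the Cayley polytope of \<open>A\<close> and \<open>B\<close>. Its slice
  at height \<open>(s, r)\<close> is the Minkowski combination \<open>s conv A + r conv B\<close>.\<close>

definition cayley :: "'a::real_vector set \<Rightarrow> 'a set \<Rightarrow> ('a \<times> real \<times> real) set" where
  "cayley A B = (\<lambda>a. (a, 1, 0)) ` A \<union> (\<lambda>b. (b, 0, 1)) ` B"

lemma sum_cayley:
  fixes A B :: "'a::real_vector set"
  assumes "finite A" "finite B"
  shows "(\<Sum>e\<in>cayley A B. f e) = (\<Sum>a\<in>A. f (a, 1, 0)) + (\<Sum>b\<in>B. f (b, 0, 1))"
proof -
  have "(\<Sum>e\<in>cayley A B. f e) = (\<Sum>e\<in>(\<lambda>a. (a, 1, 0)) ` A. f e) + (\<Sum>e\<in>(\<lambda>b. (b, 0, 1)) ` B. f e)"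
    unfolding cayley_def using assms by (intro sum.union_disjoint) auto
  then show ?thesis
    by (simp add: sum.reindex inj_on_def)
qed

lemma sum_cayley_scaleR:
  assumes "finite A" "finite B"
  shows "(\<Sum>e\<in>cayley A B. c e *\<^sub>R e) =
    ((\<Sum>a\<in>A. c (a, 1, 0) *\<^sub>R a) + (\<Sum>b\<in>B. c (b, 0, 1) *\<^sub>R b),
     (\<Sum>a\<in>A. c (a, 1, 0)), (\<Sum>b\<in>B. c (b, 0, 1)))"
  by (simp add: sum_cayley[OF assms] sum_prod)

lemma finite_cayley: "finite A \<Longrightarrow> finite B \<Longrightarrow> finite (cayley A B)"
  by (simp add: cayley_def)

lemma card_cayley: "finite A \<Longrightarrow> finite B \<Longrightarrow> card (cayley A B) = card A + card B"
  using sum_cayley[of A B "\<lambda>_. 1::nat"] by simp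

lemma cayley_slice:
  assumes fin: "finite A" "finite B" and "s > 0" "r > 0"
  shows "{x. (x, s, r) \<in> pos_span (cayley A B)} =
    (\<lambda>x. s *\<^sub>R x) ` (convex hull A) + (\<lambda>x. r *\<^sub>R x) ` (convex hull B)" (is "?L = ?R")
proof (intro equalityI subsetI)
  fix x assume "x \<in> ?L"
  then obtain c where c: "(x, s, r) = (\<Sum>e\<in>cayley A B. c e *\<^sub>R e)"
      "\<And>e. e \<in> cayley A B \<Longrightarrow> c e \<ge> 0"
    unfolding pos_span_def by blast
  then have eq: "x = (\<Sum>a\<in>A. c (a, 1, 0) *\<^sub>R a) + (\<Sum>b\<in>B. c (b, 0, 1) *\<^sub>R b)"
    "(\<Sum>a\<in>A. c (a, 1, 0)) = s" "(\<Sum>b\<in>B. c (b, 0, 1)) = r"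
    by (simp_all add: sum_cayley_scaleR[OF fin])
  have "(\<Sum>a\<in>A. c (a, 1, 0) *\<^sub>R a) \<in> (\<lambda>x. s *\<^sub>R x) ` (convex hull A)"
    using assms c(2) eq(2) by (intro convex_combination_scale_down) (auto simp: cayley_def)
  moreover have "(\<Sum>b\<in>B. c (b, 0, 1) *\<^sub>R b) \<in> (\<lambda>x. r *\<^sub>R x) ` (convex hull B)"
    using assms c(2) eq(3) by (intro convex_combination_scale_down) (auto simp: cayley_def)
  ultimately show "x \<in> ?R" unfolding eq(1) by (rule set_plus_intro)
next
  fix x assume "x \<in> ?R"
  then obtain a b where x: "x = s *\<^sub>R a + r *\<^sub>R b" "a \<in> convex hull A" "b \<in> convex hull B"
    by (auto elim!: set_plus_elim)
  obtain u where u: "\<forall>x\<in>A. 0 \<le> u x" "sum u A = 1" "(\<Sum>x\<in>A. u x *\<^sub>R x) = a"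
    using x(2) fin by (auto simp: convex_hull_finite)
  obtain v where v: "\<forall>x\<in>B. 0 \<le> v x" "sum v B = 1" "(\<Sum>x\<in>B. v x *\<^sub>R x) = b"
    using x(3) fin by (auto simp: convex_hull_finite)
  define c where "c = (\<lambda>(x, i, j::real). if i = (1::real) then s * u x else r * v x)"
  have "(x, s, r) = (\<Sum>e\<in>cayley A B. c e *\<^sub>R e)"
    unfolding sum_cayley_scaleR[OF fin] using u(2,3) v(2,3)
    by (simp add: c_def x(1) scaleR_sum_right[symmetric] sum_distrib_left[symmetric] flip: scaleR_scaleR)
  moreover have "c e \<ge> 0" if "e \<in> cayley A B" for e
    using that u v assms by (auto simp: c_def cayley_def)
  ultimately show "x \<in> ?L" by (auto intro: pos_spanI)
qed

text \<open>A proper subspace with a point at height \<open>(1, 0)\<close> and one at height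
  \<open>(0, 1)\<close> cannot contain all directions of height \<open>(0, 0)\<close>, so the slice
  lies in a translate of a proper subspace.\<close>

lemma negligible_cayley_slice:
  fixes A B :: "'a::euclidean_space set"
  assumes sp: "span (cayley A B) \<noteq> UNIV" and "finite A" "finite B" "s > 0" "r > 0"
  shows "negligible ((\<lambda>x. s *\<^sub>R x) ` (convex hull A) + (\<lambda>x. r *\<^sub>R x) ` (convex hull B))"
    (is "negligible ?C")
proof (cases "?C = {}")
  case True
  then show ?thesis by simp
next
  case False
  then obtain x0 where x0: "x0 \<in> ?C" by blast
  then have "A \<noteq> {}" "B \<noteq> {}" by (auto elim!: set_plus_elim)
  then obtain a b where a: "a \<in> A" and b: "b \<in> B" by blast
  define W where "W = span (cayley A B)"
  have sub: "(x, s, r) \<in> W" if "x \<in> ?C" for x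
  proof -
    have "pos_span (cayley A B) \<subseteq> W"
      unfolding pos_span_def W_def by (auto intro!: span_sum span_scale intro: span_base)
    then show ?thesis using that cayley_slice[OF assms(2-)] by blast
  qed
  have subW: "subspace W" by (simp add: W_def)
  define N where "N = {x. (x, 0, 0) \<in> W}"
  have N: "subspace N"
    unfolding N_def subspace_def
    using subspace_0[OF subW] subspace_add[OF subW] subspace_scale[OF subW]
    by (auto simp: zero_prod_def) (force, force)
  have "N \<noteq> UNIV"
  proof
    assume "N = UNIV"
    then have all: "(x, 0, 0) \<in> W" for x by (auto simp: N_def)
    have "(a, 1, 0) \<in> W" "(b, 0, 1) \<in> W"
      using a b by (auto simp: W_def cayley_def intro: span_base)
    then have "(x, i, j) \<in> W" for x i j
      using subspace_add[OF subW subspace_add[OF subW subspace_scale[OF subW, of "(a, 1, 0)" i]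
            subspace_scale[OF subW, of "(b, 0, 1)" j]] all[of "x - i *\<^sub>R a - j *\<^sub>R b"]]
      by simp
    then show False using sp by (auto simp: W_def)
  qed
  then have "dim N < DIM('a)"
    using N dim_eq_full[of N] dim_subset_UNIV[of N] span_eq_iff[of N] by fastforce
  then have "negligible N" by (rule negligible_lowdim)
  then have "negligible ((+) x0 ` N)" by (rule negligible_translation)
  moreover have "?C \<subseteq> (+) x0 ` N"
  proof
    fix x assume "x \<in> ?C"
    then have "(x, s, r) - (x0, s, r) \<in> W"
      using sub x0 subW by (intro subspace_diff) auto
    then have "x - x0 \<in> N" by (simp add: N_def zero_prod_def)
    then show "x \<in> (+) x0 ` N" by (force intro!: image_eqI[of _ _ "x - x0"])
  qed
  ultimately show ?thesis by (rule negligible_subset)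
qed

text \<open>The edges of the two simplices at \<open>a0\<close> and \<open>b0\<close> together form
  a basis of the space. Up to translations, \<open>cell s r\<close> is the image of
  \<open>cell 1 1\<close> under the linear map that multiplies the first edges by \<open>s\<close>
  and the second by \<open>r\<close>.\<close>

lemma cayley_basis_cell:
  fixes A B :: "'a::euclidean_space set"
  assumes fin: "finite A" "finite B"
    and ind: "independent (cayley A B)" and sp: "span (cayley A B) = UNIV"
    and W: "A \<subseteq> W" "subspace W"
  defines "cell \<equiv> \<lambda>s r. (\<lambda>x. s *\<^sub>R x) ` (convex hull A) + (\<lambda>x. r *\<^sub>R x) ` (convex hull B)"
  shows "(card A - 1) + (card B - 1) = DIM('a)" "card A - 1 \<le> dim W"
    "s > 0 \<Longrightarrow> r > 0 \<Longrightarrow>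
      measure lebesgue (cell s r) = s ^ (card A - 1) * r ^ (card B - 1) * measure lebesgue (cell 1 1)"
proof -
  have rep: "\<exists>c d. x = (\<Sum>a\<in>A. c a *\<^sub>R a) + (\<Sum>b\<in>B. d b *\<^sub>R b) \<and> sum c A = i \<and> sum d B = j"
    for x :: 'a and i j :: real
  proof -
    have "(x, i, j) \<in> span (cayley A B)" using sp by simp
    then obtain c where "(x, i, j) = (\<Sum>e\<in>cayley A B. c e *\<^sub>R e)"
      using span_finite[OF finite_cayley[OF fin]] by auto
    then show ?thesis
      by (intro exI[of _ "\<lambda>a. c (a, 1, 0)"] exI[of _ "\<lambda>b. c (b, 0, 1)"])
         (simp add: sum_cayley_scaleR[OF fin])
  qed
  have "A \<noteq> {}" using rep[of 0 1 1] by auto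
  then obtain a0 where a0: "a0 \<in> A" by blast
  have "B \<noteq> {}" using rep[of 0 1 1] by auto
  then obtain b0 where b0: "b0 \<in> B" by blast
  have cardT: "card A + card B = DIM('a) + 2"
    using ind sp dim_eq_card_independent[OF ind] dim_span[of "cayley A B"]
    by (simp add: card_cayley[OF fin] dim_UNIV)
  have posA: "card A > 0" "card B > 0" using a0 b0 fin by (auto simp: card_gt_0_iff)
  then show card_eq: "(card A - 1) + (card B - 1) = DIM('a)" using cardT by simp
  define UA where "UA = (\<lambda>a. a - a0) ` (A - {a0})"
  define UB where "UB = (\<lambda>b. b - b0) ` (B - {b0})"
  have finU: "finite UA" "finite UB" using fin by (auto simp: UA_def UB_def)
  have cardU: "card UA \<le> card A - 1" "card UB \<le> card B - 1"
    using card_image_le[of "A - {a0}" "\<lambda>a. a - a0"] card_image_le[of "B - {b0}" "\<lambda>b. b - b0"] fin a0 b0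
    by (simp_all add: UA_def UB_def)
  have shift: "(\<Sum>a\<in>S. c a *\<^sub>R a) = sum c S *\<^sub>R z + (\<Sum>a\<in>S. c a *\<^sub>R (a - z))"
    for c and S and z :: 'a
    by (simp add: scaleR_diff_right sum_subtractf scaleR_sum_left)
  \<comment> \<open>At height \<open>(0, 0)\<close> both weight sums vanish, so a representation of
    \<open>x\<close> turns into one by the differences from \<open>a0\<close> and
    \<open>b0\<close>.\<close>
  have spU: "span (UA \<union> UB) = UNIV"
  proof -
    have "x \<in> span (UA \<union> UB)" for x
    proof -
      obtain c d where "x = (\<Sum>a\<in>A. c a *\<^sub>R a) + (\<Sum>b\<in>B. d b *\<^sub>R b)" "sum c A = 0" "sum d B = 0"
        using rep[of x 0 0] by blast
      then have x: "x = (\<Sum>a\<in>A. c a *\<^sub>R (a - a0)) + (\<Sum>b\<in>B. d b *\<^sub>R (b - b0))"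
        using shift[of c A a0] shift[of d B b0] by simp
      have "a - a0 \<in> span (UA \<union> UB)" if "a \<in> A" for a
        using that by (cases "a = a0") (auto simp: UA_def span_zero intro: span_base)
      moreover have "b - b0 \<in> span (UA \<union> UB)" if "b \<in> B" for b
        using that by (cases "b = b0") (auto simp: UB_def span_zero intro: span_base)
      ultimately show ?thesis
        unfolding x by (intro span_add span_sum span_scale) auto
    qed
    then show ?thesis by auto
  qed
  \<comment> \<open>A spanning set has at least \<open>DIM('a)\<close> elements, and
    \<open>card_eq\<close> allows no more. So \<open>UA\<close> and \<open>UB\<close> are disjoint,
    of full size, and together independent.\<close>
  have "DIM('a) \<le> card (UA \<union> UB)"
    using dim_le_card'[of "UA \<union> UB"] finU spU dim_span[of "UA \<union> UB"] by (simp add: dim_UNIV)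
  moreover have "card (UA \<union> UB) + card (UA \<inter> UB) = card UA + card UB"
    using card_Un_Int[OF finU] by simp
  ultimately have cards: "card (UA \<union> UB) = DIM('a)" "card (UA \<inter> UB) = 0"
      "card UA = card A - 1" "card UB = card B - 1"
    using cardU card_eq by linarith+
  then have disj: "UA \<inter> UB = {}" using finU by auto
  have indU: "independent (UA \<union> UB)"
    using spU finU cards(1) by (intro card_le_dim_spanning[of _ UNIV]) (auto simp: dim_UNIV)
  have "UA \<subseteq> W" using W a0 by (auto simp: UA_def intro!: subspace_diff)
  then show "card A - 1 \<le> dim W"
    using independent_mono[OF indU, of UA] independent_card_le_dim[of UA W] cards(3) by simp
  assume sr: "s > 0" "r > 0"
  define ev where "ev u = (if u \<in> UA then s else r)" for u
  obtain L where L: "linear L" "\<And>u. u \<in> UA \<union> UB \<Longrightarrow> L u = ev u *\<^sub>R u"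
    using linear_independent_extend[OF indU, of "\<lambda>u. ev u *\<^sub>R u"] by blast
  have LA: "L (a - a0) = s *\<^sub>R (a - a0)" if "a \<in> A" for a
    using that L by (cases "a = a0") (auto simp: linear_0 ev_def UA_def)
  have LB: "L (b - b0) = r *\<^sub>R (b - b0)" if "b \<in> B" for b
  proof (cases "b = b0")
    case False
    then have "b - b0 \<in> UB" using that by (auto simp: UB_def)
    then show ?thesis using disj L(2)[of "b - b0"] by (auto simp: ev_def)
  qed (simp add: L linear_0)
  have cell_mem: "x \<in> cell s r \<longleftrightarrow> (\<exists>c d. x = s *\<^sub>R (\<Sum>a\<in>A. c a *\<^sub>R a) + r *\<^sub>R (\<Sum>b\<in>B. d b *\<^sub>R b) \<and>
      (\<forall>a\<in>A. c a \<ge> 0) \<and> (\<forall>b\<in>B. d b \<ge> 0) \<and> sum c A = 1 \<and> sum d B = 1)" for x s r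
    unfolding cell_def set_plus_def using fin by (auto simp: convex_hull_finite)
  have L_eq: "s *\<^sub>R (\<Sum>a\<in>A. c a *\<^sub>R a) + r *\<^sub>R (\<Sum>b\<in>B. d b *\<^sub>R b) = (s *\<^sub>R a0 + r *\<^sub>R b0)
      + L ((\<Sum>a\<in>A. c a *\<^sub>R a) + (\<Sum>b\<in>B. d b *\<^sub>R b) + - (a0 + b0))"
    if "sum c A = 1" "sum d B = 1" for c d
  proof -
    have "L ((\<Sum>a\<in>A. c a *\<^sub>R a) + (\<Sum>b\<in>B. d b *\<^sub>R b) + - (a0 + b0))
        = L ((\<Sum>a\<in>A. c a *\<^sub>R (a - a0)) + (\<Sum>b\<in>B. d b *\<^sub>R (b - b0)))"
      using shift[of c A a0] shift[of d B b0] that by (simp add: algebra_simps)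
    also have "\<dots> = (\<Sum>a\<in>A. c a *\<^sub>R s *\<^sub>R (a - a0)) + (\<Sum>b\<in>B. d b *\<^sub>R r *\<^sub>R (b - b0))"
      using L(1) LA LB by (simp add: linear_add linear_sum linear_scale cong: sum.cong)
    also have "\<dots> = s *\<^sub>R (\<Sum>a\<in>A. c a *\<^sub>R (a - a0)) + r *\<^sub>R (\<Sum>b\<in>B. d b *\<^sub>R (b - b0))"
      by (simp add: scaleR_sum_right mult.commute)
    finally show ?thesis
      using shift[of c A a0] shift[of d B b0] that by (simp add: scaleR_add_right)
  qed
  have cell_img: "cell s r = (+) (s *\<^sub>R a0 + r *\<^sub>R b0) ` L ` (+) (- (a0 + b0)) ` cell 1 1"
  proof (intro equalityI subsetI)
    fix x assume "x \<in> cell s r"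
    then obtain c d where *: "x = s *\<^sub>R (\<Sum>a\<in>A. c a *\<^sub>R a) + r *\<^sub>R (\<Sum>b\<in>B. d b *\<^sub>R b)"
      "\<forall>a\<in>A. c a \<ge> 0" "\<forall>b\<in>B. d b \<ge> 0" "sum c A = 1" "sum d B = 1"
      unfolding cell_mem by blast
    have "(\<Sum>a\<in>A. c a *\<^sub>R a) + (\<Sum>b\<in>B. d b *\<^sub>R b) \<in> cell 1 1"
      unfolding cell_mem using * by auto
    then show "x \<in> (+) (s *\<^sub>R a0 + r *\<^sub>R b0) ` L ` (+) (- (a0 + b0)) ` cell 1 1"
      unfolding *(1) L_eq[OF *(4,5)] by (intro imageI) (auto simp: add.commute intro!: imageI)
  next
    fix x assume "x \<in> (+) (s *\<^sub>R a0 + r *\<^sub>R b0) ` L ` (+) (- (a0 + b0)) ` cell 1 1"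
    then obtain y where y: "y \<in> cell 1 1" "x = (s *\<^sub>R a0 + r *\<^sub>R b0) + L (- (a0 + b0) + y)" by blast
    then obtain c d where *: "y = (\<Sum>a\<in>A. c a *\<^sub>R a) + (\<Sum>b\<in>B. d b *\<^sub>R b)"
      "\<forall>a\<in>A. c a \<ge> 0" "\<forall>b\<in>B. d b \<ge> 0" "sum c A = 1" "sum d B = 1"
      unfolding cell_mem by auto
    have "x = s *\<^sub>R (\<Sum>a\<in>A. c a *\<^sub>R a) + r *\<^sub>R (\<Sum>b\<in>B. d b *\<^sub>R b)"
      unfolding L_eq[OF *(4,5)] y(2) *(1) by (simp add: add.commute)
    then show "x \<in> cell s r" unfolding cell_mem using * by blast
  qed
  have comp: "compact (cell s r)" for s r
    unfolding cell_def using fin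
    by (intro compact_set_plus compact_scaling finite_imp_compact_convex_hull)
  have "measure lebesgue (cell s r) = measure lebesgue (L ` (+) (- (a0 + b0)) ` cell 1 1)"
    unfolding cell_img by (rule measure_translation)
  also have "\<dots> = measure lborel (L ` (+) (- (a0 + b0)) ` cell 1 1)"
    using comp L(1)
    by (intro measure_completion)
      (auto intro!: borel_compact compact_continuous_image compact_translation linear_continuous_on
        simp: linear_conv_bounded_linear)
  also have "\<dots> = (\<Prod>u\<in>UA \<union> UB. ev u) * measure lborel ((+) (- (a0 + b0)) ` cell 1 1)"
    using sr comp by (intro eigenbasis_measure_scaling L indU spU)
      (auto simp: ev_def intro!: borel_compact compact_translation)
  also have "measure lborel ((+) (- (a0 + b0)) ` cell 1 1) = measure lebesgue ((+) (- (a0 + b0)) ` cell 1 1)"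
    using comp by (intro measure_completion[symmetric]) (auto simp: compact_translation borel_compact)
  also have "\<dots> = measure lebesgue (cell 1 1)"
    by (rule measure_translation)
  also have "(\<Prod>u\<in>UA \<union> UB. ev u) = (\<Prod>u\<in>UA. ev u) * (\<Prod>u\<in>UB. ev u)"
    using finU disj by (rule prod.union_disjoint)
  also have "(\<Prod>u\<in>UA. ev u) = s ^ (card A - 1)"
    using cards by (simp add: ev_def)
  also have "(\<Prod>u\<in>UB. ev u) = (\<Prod>u\<in>UB. r)"
    using disj by (intro prod.cong) (auto simp: ev_def)
  also have "\<dots> = r ^ (card B - 1)"
    using cards by simp
  finally show "measure lebesgue (cell s r) = s ^ (card A - 1) * r ^ (card B - 1) * measure lebesgue (cell 1 1)"
    by simp
qed

text \<open>Each cell of the triangulation contributes one monomial, with exponent of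
  \<open>s\<close> at most \<open>d\<close> because its edges from \<open>P\<close> are independent
  vectors of \<open>W\<close>. Nonnegativity of the \<open>C j\<close> later bounds the coefficients
  of approximating polytopes.\<close>

lemma polytope_volume_polynomial:
  fixes P Q :: "'a::euclidean_space set"
  assumes fin: "finite P" "finite Q" and W: "P \<subseteq> W" "subspace W" "dim W \<le> d"
  obtains C :: "nat \<Rightarrow> real" where "\<And>j. C j \<ge> 0"
    "\<And>s r. s > 0 \<Longrightarrow> r > 0 \<Longrightarrow>
      measure lebesgue ((\<lambda>x. s *\<^sub>R x) ` (convex hull P) + (\<lambda>x. r *\<^sub>R x) ` (convex hull Q))
        = (\<Sum>j\<le>d. C j * s ^ j * r ^ (DIM('a) - j))"
proof -
  define cell where "cell s r A B = (\<lambda>x. s *\<^sub>R x) ` (convex hull A) + (\<lambda>x. r *\<^sub>R x) ` (convex hull B)"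
    for s r :: real and A B :: "'a set"
  define h where "h = (\<lambda>(x::'a, i::real, j::real). i + j)"
  have "linear h" by (auto simp: h_def linear_iff algebra_simps)
  have "h e > 0" if "e \<in> cayley P Q" for e
    using that by (auto simp: cayley_def h_def)
  with \<open>linear h\<close> obtain \<T> where
    T0: "\<forall>T\<in>\<T>. T \<subseteq> cayley P Q \<and> independent T \<and> span T = UNIV" and
    meet0: "\<forall>T\<in>\<T>. \<forall>T'\<in>\<T>. pos_span T \<inter> pos_span T' \<subseteq> pos_span (T \<inter> T')" and
    cover: "pos_span (cayley P Q) \<subseteq> (\<Union>T\<in>\<T>. pos_span T) \<union>
      (\<Union>S\<in>{S. S \<subseteq> cayley P Q \<and> span S \<noteq> UNIV}. pos_span S)"
    by (rule cone_triangulation[OF finite_cayley[OF fin]])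
  note T = T0[rule_format] and meet = meet0[rule_format]
  have finT: "finite \<T>"
    using T finite_cayley[OF fin] by (intro finite_subset[of \<T> "Pow (cayley P Q)"]) auto
  define A where "A T = {a\<in>P. (a, 1, 0) \<in> T}" for T :: "('a \<times> real \<times> real) set"
  define B where "B T = {b\<in>Q. (b, 0, 1) \<in> T}" for T :: "('a \<times> real \<times> real) set"
  have AB: "T = cayley (A T) (B T)" if "T \<subseteq> cayley P Q" for T
    using that unfolding A_def B_def cayley_def by blast
  have finAB: "finite (A T)" "finite (B T)" for T
    using fin by (auto simp: A_def B_def)
  have slice: "x \<in> cell s r (A T) (B T) \<longleftrightarrow> (x, s, r) \<in> pos_span T"
    if "T \<subseteq> cayley P Q" "s > 0" "r > 0" for x s r T
    using cayley_slice[OF finAB[of T] that(2,3), folded AB[OF that(1)]] by (auto simp: cell_def)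
  have basis: "(card (A T) - 1) + (card (B T) - 1) = DIM('a)" "card (A T) - 1 \<le> d"
    "s > 0 \<Longrightarrow> r > 0 \<Longrightarrow> measure lebesgue (cell s r (A T) (B T)) =
      s ^ (card (A T) - 1) * r ^ (card (B T) - 1) * measure lebesgue (cell 1 1 (A T) (B T))"
    if "T \<in> \<T>" for T s r
  proof -
    have T': "T \<subseteq> cayley P Q" "independent T" "span T = UNIV" "A T \<subseteq> W"
      using T[OF that] W(1) by (auto simp: A_def)
    note * = cayley_basis_cell[OF finAB[of T], folded AB[OF T'(1)], OF T'(2,3,4) W(2)]
    show "(card (A T) - 1) + (card (B T) - 1) = DIM('a)" "card (A T) - 1 \<le> d"
      using *(1,2) W(3) by auto
    show "measure lebesgue (cell s r (A T) (B T)) =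
      s ^ (card (A T) - 1) * r ^ (card (B T) - 1) * measure lebesgue (cell 1 1 (A T) (B T))"
      if "s > 0" "r > 0" using *(3)[OF that] by (simp add: cell_def)
  qed
  have comp: "compact (cell s r (A T) (B T))" for s r T
    unfolding cell_def using finAB
    by (intro compact_set_plus compact_scaling finite_imp_compact_convex_hull)
  define C where "C j = (\<Sum>T | T \<in> \<T> \<and> card (A T) - 1 = j. measure lebesgue (cell 1 1 (A T) (B T)))" for j
  show ?thesis
  proof (rule that[of C])
    show "C j \<ge> 0" for j by (auto simp: C_def intro: sum_nonneg)
    fix s r :: real assume sr: "s > 0" "r > 0"
    let ?cell = "\<lambda>T. cell s r (A T) (B T)"
    have negl: "negligible (?cell S)" if "S \<subseteq> cayley P Q" "span S \<noteq> UNIV" for S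
      using negligible_cayley_slice[OF _ finAB[of S] sr, folded AB[OF that(1)]] that(2)
      by (simp add: cell_def)
    have PQ: "A (cayley P Q) = P" "B (cayley P Q) = Q"
      by (auto simp: A_def B_def cayley_def)
    define Z where "Z = (\<Union>S\<in>{S. S \<subseteq> cayley P Q \<and> span S \<noteq> UNIV}. ?cell S)"
    have Z: "negligible Z"
      unfolding Z_def using negl finite_cayley[OF fin]
      by (intro negligible_Union) (auto intro: finite_subset[of _ "Pow (cayley P Q)"])
    have "?cell (cayley P Q) \<subseteq> (\<Union>T\<in>\<T>. ?cell T) \<union> Z"
    proof
      fix x assume "x \<in> ?cell (cayley P Q)"
      then have "(x, s, r) \<in> pos_span (cayley P Q)" using slice sr by auto
      then consider T' where "T' \<in> \<T>" "(x, s, r) \<in> pos_span T'"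
        | S where "S \<subseteq> cayley P Q" "span S \<noteq> UNIV" "(x, s, r) \<in> pos_span S"
        using cover by blast
      then show "x \<in> (\<Union>T\<in>\<T>. ?cell T) \<union> Z"
      proof cases
        case (1 T')
        then have "x \<in> ?cell T'" using T[OF 1(1)] sr by (simp add: slice)
        then show ?thesis using 1(1) by blast
      next
        case (2 S)
        then have "x \<in> ?cell S" using sr by (simp add: slice)
        then show ?thesis using 2 unfolding Z_def by blast
      qed
    qed
    moreover have "(\<Union>T\<in>\<T>. ?cell T) \<subseteq> ?cell (cayley P Q)"
    proof
      fix x assume "x \<in> (\<Union>T\<in>\<T>. ?cell T)"
      then obtain T' where T': "T' \<in> \<T>" "x \<in> ?cell T'" by blast
      then have "(x, s, r) \<in> pos_span T'" using T[OF T'(1)] sr by (simp add: slice)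
      then have "(x, s, r) \<in> pos_span (cayley P Q)"
        using pos_span_mono[of T' "cayley P Q"] T[OF T'(1)] finite_cayley[OF fin] by auto
      then show "x \<in> ?cell (cayley P Q)" using slice sr by auto
    qed
    ultimately have "measure lebesgue (?cell (cayley P Q)) = measure lebesgue (\<Union>T\<in>\<T>. ?cell T)"
      using comp finT
      by (intro measure_negligible_symdiff[symmetric] lmeasurable_compact compact_UN negligible_subset[OF Z]) auto
    also have "\<dots> = (\<Sum>T\<in>\<T>. measure lebesgue (?cell T))"
    proof (rule measure_negligible_finite_Union_image[OF finT])
      show "?cell T \<in> lmeasurable" for T using comp by (rule lmeasurable_compact)
      show "pairwise (\<lambda>T T'. negligible (?cell T \<inter> ?cell T')) \<T>"
      proof (rule pairwiseI)
        fix T T' assume TT: "T \<in> \<T>" "T' \<in> \<T>" "T \<noteq> T'"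
        \<comment> \<open>One of two distinct bases has an element outside the other, so the
          intersection cannot span, and the overlap of the cells is a slice over a non-spanning
          set.\<close>
        have "span (T \<inter> T') \<noteq> UNIV"
        proof -
          have *: False if "T1 \<in> \<T>" "span (T1 - {e}) = UNIV" "e \<in> T1" for T1 e
            using that T[OF that(1)] by (auto simp: dependent_def)
          obtain e where "e \<in> T - T' \<or> e \<in> T' - T" using TT by blast
          then show ?thesis
          proof
            assume e: "e \<in> T - T'"
            then have "span (T \<inter> T') \<subseteq> span (T - {e})" by (intro span_mono) auto
            then show ?thesis using *[of T e] TT e by auto
          next
            assume e: "e \<in> T' - T"
            then have "span (T \<inter> T') \<subseteq> span (T' - {e})" by (intro span_mono) auto
            then show ?thesis using *[of T' e] TT e by auto
          qed
        qed
        moreover have sub: "T \<inter> T' \<subseteq> cayley P Q" using T TT by auto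
        ultimately have "negligible (?cell (T \<inter> T'))" by (intro negl)
        moreover have "?cell T \<inter> ?cell T' \<subseteq> ?cell (T \<inter> T')"
          using meet[OF TT(1,2)] T[OF TT(1)] T[OF TT(2)] sub sr by (auto simp: slice)
        ultimately show "negligible (?cell T \<inter> ?cell T')" by (rule negligible_subset)
      qed
    qed
    also have "\<dots> = (\<Sum>j\<le>d. \<Sum>T | T \<in> \<T> \<and> card (A T) - 1 = j. measure lebesgue (?cell T))"
      using finT basis(2) by (intro sum.group[symmetric]) auto
    also have "\<dots> = (\<Sum>j\<le>d. C j * s ^ j * r ^ (DIM('a) - j))"
    proof (intro sum.cong refl)
      fix j
      have "measure lebesgue (?cell T) = measure lebesgue (cell 1 1 (A T) (B T)) * (s ^ j * r ^ (DIM('a) - j))"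
        if "T \<in> \<T>" "card (A T) - 1 = j" for T
      proof -
        have "card (B T) - 1 = DIM('a) - j" using basis(1)[OF that(1)] that(2) by simp
        then show ?thesis using basis(3)[OF that(1) sr] that(2) by simp
      qed
      then show "(\<Sum>T | T \<in> \<T> \<and> card (A T) - 1 = j. measure lebesgue (?cell T)) = C j * s ^ j * r ^ (DIM('a) - j)"
        by (simp add: C_def sum_distrib_right mult.assoc)
    qed
    finally show "measure lebesgue ((\<lambda>x. s *\<^sub>R x) ` (convex hull P) + (\<lambda>x. r *\<^sub>R x) ` (convex hull Q))
        = (\<Sum>j\<le>d. C j * s ^ j * r ^ (DIM('a) - j))"
      by (simp add: cell_def PQ)
  qed
qed

section \<open>Minkowski combinations of convex bodies\<close>

text \<open>Finitely many small cubes centred in \<open>K\<close> cover it, and the polytope is the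
  hull of all their vertices. By the \<open>l1\<close> bound of the norm, the half side
  \<open>\<epsilon> / DIM('a)\<close> makes each cube fit into a ball of radius
  \<open>\<epsilon>\<close>.\<close>

lemma outer_polytope:
  fixes K :: "'a::euclidean_space set"
  assumes "compact K" "convex K" "\<epsilon> > 0"
  obtains P where "finite P" "K \<subseteq> convex hull P" "convex hull P \<subseteq> K + cball 0 \<epsilon>"
proof -
  define d where "d = \<epsilon> / DIM('a)"
  have d: "d > 0" using assms by (simp add: d_def)
  define D :: 'a where "D = (\<Sum>i\<in>Basis. d *\<^sub>R i)"
  have "\<exists>S. finite S \<and> cbox (x - D) (x + D) = convex hull S" for x
    using cube_convex_hull[OF d] unfolding D_def by metis
  then obtain S where S: "\<And>x. finite (S x)" "\<And>x. cbox (x - D) (x + D) = convex hull (S x)"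
    by metis
  have Db: "D \<bullet> b = d" if "b \<in> Basis" for b
    using that by (simp add: D_def)
  have small: "cbox (x - D) (x + D) \<subseteq> cball x \<epsilon>" for x
  proof
    fix y assume y: "y \<in> cbox (x - D) (x + D)"
    have "norm (y - x) \<le> (\<Sum>b\<in>Basis. \<bar>(y - x) \<bullet> b\<bar>)" by (rule norm_le_l1)
    also have "\<dots> \<le> (\<Sum>b\<in>(Basis::'a set). d)"
    proof (rule sum_mono)
      fix b :: 'a assume b: "b \<in> Basis"
      then have "x \<bullet> b - d \<le> y \<bullet> b" "y \<bullet> b \<le> x \<bullet> b + d"
        using y Db[OF b] by (auto simp: mem_box inner_diff_left inner_add_left)
      then show "\<bar>(y - x) \<bullet> b\<bar> \<le> d" by (simp add: inner_diff_left abs_le_iff)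
    qed
    also have "\<dots> = \<epsilon>" by (simp add: d_def)
    finally show "y \<in> cball x \<epsilon>" by (simp add: dist_norm norm_minus_commute)
  qed
  have "K \<subseteq> (\<Union>x\<in>K. box (x - D) (x + D))"
    using d Db by (auto simp: mem_box inner_diff_left inner_add_left)
  then obtain F where F: "F \<subseteq> K" "finite F" "K \<subseteq> (\<Union>x\<in>F. box (x - D) (x + D))"
    using compactE_image[OF assms(1), of K "\<lambda>x. box (x - D) (x + D)"] by blast
  show ?thesis
  proof (rule that[of "\<Union>x\<in>F. S x"])
    show "finite (\<Union>x\<in>F. S x)" using F S by auto
    show "K \<subseteq> convex hull (\<Union>x\<in>F. S x)"
    proof
      fix y assume "y \<in> K"
      then obtain x where x: "x \<in> F" "y \<in> box (x - D) (x + D)" using F by blast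
      then have "y \<in> convex hull (S x)" using S(2) box_subset_cbox by blast
      then show "y \<in> convex hull (\<Union>x\<in>F. S x)"
        using hull_mono[of "S x" "\<Union>x\<in>F. S x"] x by blast
    qed
    show "convex hull (\<Union>x\<in>F. S x) \<subseteq> K + cball 0 \<epsilon>"
    proof (rule hull_minimal)
      show "convex (K + cball 0 \<epsilon>)" using assms by (simp add: convex_set_plus)
      show "(\<Union>x\<in>F. S x) \<subseteq> K + cball 0 \<epsilon>"
      proof
        fix y assume "y \<in> (\<Union>x\<in>F. S x)"
        then obtain x where x: "x \<in> F" "y \<in> S x" by blast
        then have "y \<in> cball x \<epsilon>" using hull_inc[of y "S x" convex] S(2)[of x] small[of x] by auto
        then have "x + (y - x) \<in> K + cball 0 \<epsilon>"
          using x F by (intro set_plus_intro) (auto simp: dist_norm norm_minus_commute)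
        then show "y \<in> K + cball 0 \<epsilon>" by simp
      qed
    qed
  qed
qed

lemma measure_thickening_tendsto:
  fixes X :: "'a::euclidean_space set"
  assumes X: "compact X" and M: "M \<ge> 0"
  shows "(\<lambda>k. measure lebesgue (X + cball 0 (M * inverse (real (Suc k))))) \<longlonglongrightarrow> measure lebesgue X"
proof -
  define Y where "Y k = X + cball 0 (M * inverse (real (Suc k)))" for k
  have comp: "compact (Y k)" for k
    unfolding Y_def using X by (intro compact_set_plus) auto
  have "X = (\<Inter>k. Y k)"
  proof (intro equalityI subsetI)
    fix x assume "x \<in> X"
    then have "x + 0 \<in> Y k" for k
      unfolding Y_def using M by (intro set_plus_intro) auto
    then show "x \<in> (\<Inter>k. Y k)" by simp
  next
    fix x assume x: "x \<in> (\<Inter>k. Y k)"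
    have "\<exists>y\<in>X. dist y x < e" if "e > 0" for e
    proof -
      have "(\<lambda>k. M * inverse (real (Suc k))) \<longlonglongrightarrow> M * 0"
        by (intro tendsto_intros LIMSEQ_inverse_real_of_nat)
      then have "eventually (\<lambda>k. M * inverse (real (Suc k)) < e) sequentially"
        using that by (auto dest: order_tendstoD(2))
      then obtain k where k: "M * inverse (real (Suc k)) < e"
        by (auto simp: eventually_sequentially)
      have "x \<in> Y k" using x by blast
      then obtain y z where "x = y + z" "y \<in> X" "norm z \<le> M * inverse (real (Suc k))"
        unfolding Y_def by (auto elim!: set_plus_elim)
      then show ?thesis using k by (intro bexI[of _ y]) (auto simp: dist_norm)
    qed
    then show "x \<in> X" using X compact_imp_closed closed_approachable by blast
  qed
  moreover have "(\<lambda>k. measure lebesgue (Y k)) \<longlonglongrightarrow> measure lebesgue (\<Inter>k. Y k)"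
  proof (rule Lim_measure_decseq)
    show "range Y \<subseteq> sets lebesgue" using lmeasurable_compact[OF comp] by (auto simp: fmeasurable_def)
    show "emeasure lebesgue (Y i) \<noteq> \<infinity>" for i
      using lmeasurable_compact[OF comp[of i]] by (auto simp: fmeasurable_def)
    show "decseq Y"
    proof (rule decseq_SucI)
      fix n
      have "M * inverse (real (Suc (Suc n))) \<le> M * inverse (real (Suc n))"
        using M by (intro mult_left_mono) (auto simp: field_simps)
      then show "Y (Suc n) \<subseteq> Y n"
        unfolding Y_def by (intro set_plus_mono2 order_refl subset_cball)
    qed
  qed
  ultimately show ?thesis by (simp add: Y_def)
qed

lemma bounded_family_convergent_subsequence:
  fixes c :: "nat \<Rightarrow> 'j \<Rightarrow> real"
  assumes "finite J" "\<And>j k. j \<in> J \<Longrightarrow> \<bar>c k j\<bar> \<le> M"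
  shows "\<exists>\<phi> l. strict_mono (\<phi> :: nat \<Rightarrow> nat) \<and> (\<forall>j\<in>J. (\<lambda>k. c (\<phi> k) j) \<longlonglongrightarrow> l j)"
  using assms
proof (induction J rule: finite_induct)
  case empty
  show ?case by (intro exI[of _ id]) (auto simp: strict_mono_def)
next
  case (insert i J)
  then obtain \<phi> :: "nat \<Rightarrow> nat" and l where \<phi>: "strict_mono \<phi>" "\<forall>j\<in>J. (\<lambda>k. c (\<phi> k) j) \<longlonglongrightarrow> l j"
    by auto
  have "bounded (range (\<lambda>k. c (\<phi> k) i))"
    using insert.prems by (auto simp: bounded_iff)
  then obtain a \<psi> where \<psi>: "strict_mono \<psi>" "((\<lambda>k. c (\<phi> k) i) \<circ> \<psi>) \<longlonglongrightarrow> a"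
    using bounded_imp_convergent_subsequence by blast
  have "(\<lambda>k. c ((\<phi> \<circ> \<psi>) k) j) \<longlonglongrightarrow> (l(i := a)) j" if "j \<in> insert i J" for j
  proof (cases "j = i")
    case False
    then have "(\<lambda>k. c (\<phi> k) j) \<longlonglongrightarrow> l j" using \<phi>(2) that by blast
    from LIMSEQ_subseq_LIMSEQ[OF this \<psi>(1)] show ?thesis using False by (simp add: o_def)
  qed (use \<psi> in \<open>simp add: o_def\<close>)
  moreover have "strict_mono (\<phi> \<circ> \<psi>)" using \<phi>(1) \<psi>(1) by (rule strict_mono_o)
  ultimately show ?case by blast
qed

text \<open>By convexity, adding \<open>\<epsilon> p\<close> raises the factor from \<open>s\<close>
  to \<open>s + \<epsilon>\<close>. Since translations preserve volume, a body with factor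
  \<open>s\<close>, possibly \<open>0\<close>, can be compared with polytopes at a positive
  factor.\<close>

lemma minkowski_combination_inner:
  assumes K: "convex K" "p \<in> K" "K \<subseteq> K'" and "(s::real) \<ge> 0" "\<epsilon> \<ge> 0" "x \<in> (\<lambda>x. s *\<^sub>R x) ` K"
  shows "\<epsilon> *\<^sub>R p + x \<in> (\<lambda>x. (s + \<epsilon>) *\<^sub>R x) ` K'"
proof (cases "s + \<epsilon> = 0")
  case True
  then have "s = 0" "\<epsilon> = 0" using assms by linarith+
  then show ?thesis using assms by (auto simp: image_iff)
next
  case False
  then have pos: "s + \<epsilon> > 0" using assms by linarith
  obtain k where k: "k \<in> K" "x = s *\<^sub>R k" using assms by blast
  have "(\<epsilon> / (s + \<epsilon>)) *\<^sub>R p + (s / (s + \<epsilon>)) *\<^sub>R k \<in> K"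
    using K k pos assms by (intro convexD) (auto simp: add_divide_distrib[symmetric])
  moreover have "\<epsilon> *\<^sub>R p + x = (s + \<epsilon>) *\<^sub>R ((\<epsilon> / (s + \<epsilon>)) *\<^sub>R p + (s / (s + \<epsilon>)) *\<^sub>R k)"
    using pos by (simp add: k scaleR_add_right)
  ultimately show ?thesis using K by blast
qed

text \<open>The bound from above: changing both the factor and the body by \<open>\<epsilon>\<close>
  moves points by \<open>O(\<epsilon>)\<close>, with a constant independent of the approximating
  body.\<close>

lemma minkowski_combination_outer:
  fixes f :: "'a::euclidean_space \<Rightarrow> 'b::euclidean_space"
  assumes f: "linear f" "\<And>x. norm (f x) \<le> c * norm x" and K: "\<And>x. x \<in> K \<Longrightarrow> norm x \<le> R"
    and "0 \<le> s" "0 \<le> \<epsilon>" "\<epsilon> \<le> 1" "0 \<le> c" and K': "K' \<subseteq> K + cball 0 \<epsilon>"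
    and x: "x \<in> (\<lambda>x. (s + \<epsilon>) *\<^sub>R x) ` f ` K'"
  shows "x \<in> (\<lambda>x. s *\<^sub>R x) ` f ` K + cball 0 (c * (R + s + 1) * \<epsilon>)"
proof -
  obtain y where y: "y \<in> K'" "x = (s + \<epsilon>) *\<^sub>R f y" using x by blast
  then have "y \<in> K + cball 0 \<epsilon>" using K' by blast
  then obtain k e where ke: "y = k + e" "k \<in> K" "norm e \<le> \<epsilon>"
    by (auto elim!: set_plus_elim)
  have "x = s *\<^sub>R f k + f (\<epsilon> *\<^sub>R k + (s + \<epsilon>) *\<^sub>R e)"
    using f(1) by (simp add: y ke linear_add linear_scale algebra_simps)
  moreover have "f (\<epsilon> *\<^sub>R k + (s + \<epsilon>) *\<^sub>R e) \<in> cball 0 (c * (R + s + 1) * \<epsilon>)"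
  proof -
    have "norm (\<epsilon> *\<^sub>R k + (s + \<epsilon>) *\<^sub>R e) \<le> \<epsilon> * norm k + (s + \<epsilon>) * norm e"
      using assms by (intro order_trans[OF norm_triangle_ineq]) simp
    also have "\<dots> \<le> \<epsilon> * R + (s + 1) * \<epsilon>"
      using assms ke K[OF ke(2)] by (intro add_mono mult_mono) auto
    finally have "norm (\<epsilon> *\<^sub>R k + (s + \<epsilon>) *\<^sub>R e) \<le> (R + s + 1) * \<epsilon>"
      by (simp add: algebra_simps)
    then have "c * norm (\<epsilon> *\<^sub>R k + (s + \<epsilon>) *\<^sub>R e) \<le> c * ((R + s + 1) * \<epsilon>)"
      using assms by (intro mult_left_mono) auto
    then show ?thesis using f(2)[of "\<epsilon> *\<^sub>R k + (s + \<epsilon>) *\<^sub>R e"] by (simp add: mult.assoc)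
  qed
  ultimately show ?thesis using ke(2) by (auto intro!: set_plus_intro)
qed

text \<open>The values \<open>s = 0\<close> and \<open>r = 0\<close> are included because mixed
  volumes differentiate at \<open>0\<close>. Hence the polytopes are evaluated at
  \<open>(s + \<epsilon> k, r + \<epsilon> k)\<close>, which is strictly positive and tends to
  \<open>(s, r)\<close>.\<close>

theorem minkowski_volume_polynomial:
  fixes K :: "'a::euclidean_space set" and B :: "'b::euclidean_space set" and f :: "'a \<Rightarrow> 'b"
  assumes K: "convex_body K" and B: "convex_body B" and f: "linear f"
  obtains C :: "nat \<Rightarrow> real" where
    "\<And>s r. s \<ge> 0 \<Longrightarrow> r \<ge> 0 \<Longrightarrow>
      measure lebesgue ((\<lambda>x. s *\<^sub>R x) ` f ` K + (\<lambda>x. r *\<^sub>R x) ` B)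
        = (\<Sum>j\<le>DIM('a). C j * s ^ j * r ^ (DIM('b) - j))"
proof -
  have cK: "compact K" "convex K" and cB: "compact B" "convex B"
    using K B by (auto simp: convex_body_def)
  obtain p where p: "p \<in> K" using K by (auto simp: convex_body_def)
  obtain q where q: "q \<in> B" using B by (auto simp: convex_body_def)
  obtain c where c: "c > 0" "\<And>x. norm (f x) \<le> c * norm x"
    using linear_bounded_pos[OF f] by (metis mult.commute)
  obtain R where R: "R > 0" "\<And>x. x \<in> K \<Longrightarrow> norm x \<le> R"
    using compact_imp_bounded[OF cK(1)] by (auto simp: bounded_pos)
  obtain R' where R': "R' > 0" "\<And>x. x \<in> B \<Longrightarrow> norm x \<le> R'"
    using compact_imp_bounded[OF cB(1)] by (auto simp: bounded_pos)
  define \<epsilon> where "\<epsilon> k = inverse (real (Suc k))" for k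
  have \<epsilon>: "\<epsilon> k > 0" "\<epsilon> k \<le> 1" for k by (auto simp: \<epsilon>_def field_simps)
  have \<epsilon>0: "\<epsilon> \<longlonglongrightarrow> 0" unfolding \<epsilon>_def by (rule LIMSEQ_inverse_real_of_nat)
  have "\<forall>k. \<exists>P. finite P \<and> K \<subseteq> convex hull P \<and> convex hull P \<subseteq> K + cball 0 (\<epsilon> k)"
    using outer_polytope[OF cK] \<epsilon>(1) by metis
  then obtain P where P: "\<And>k. finite (P k)" "\<And>k. K \<subseteq> convex hull (P k)"
      "\<And>k. convex hull (P k) \<subseteq> K + cball 0 (\<epsilon> k)" by metis
  have "\<forall>k. \<exists>P. finite P \<and> B \<subseteq> convex hull P \<and> convex hull P \<subseteq> B + cball 0 (\<epsilon> k)"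
    using outer_polytope[OF cB] \<epsilon>(1) by metis
  then obtain Q where Q: "\<And>k. finite (Q k)" "\<And>k. B \<subseteq> convex hull (Q k)"
      "\<And>k. convex hull (Q k) \<subseteq> B + cball 0 (\<epsilon> k)" by metis
  define X where "X s r = (\<lambda>x. s *\<^sub>R x) ` f ` K + (\<lambda>x. r *\<^sub>R x) ` B" for s r :: real
  define Y where "Y k s r = (\<lambda>x. s *\<^sub>R x) ` f ` (convex hull P k) + (\<lambda>x. r *\<^sub>R x) ` (convex hull Q k)"
    for k and s r :: real
  have comp_f: "compact (f ` S)" if "compact S" for S
    using that f by (intro compact_continuous_image linear_continuous_on)
      (auto simp: linear_conv_bounded_linear)
  have compX: "compact (X s r)" for s r
    unfolding X_def using cK cB by (intro compact_set_plus compact_scaling comp_f) auto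
  have compY: "compact (Y k s r)" for k s r
    unfolding Y_def using P Q
    by (intro compact_set_plus compact_scaling comp_f finite_imp_compact_convex_hull) auto
  have "\<forall>k. \<exists>C. (\<forall>j. C j \<ge> 0) \<and> (\<forall>s r. s > 0 \<longrightarrow> r > 0 \<longrightarrow>
      measure lebesgue (Y k s r) = (\<Sum>j\<le>DIM('a). C j * s ^ j * r ^ (DIM('b) - j)))"
  proof
    fix k
    \<comment> \<open>This limits the power of \<open>s\<close> to \<open>DIM('a)\<close> rather
      than \<open>DIM('b)\<close>, and so ends the sum of the theorem at \<open>n\<close>.\<close>
    have "dim (range f) \<le> DIM('a)"
      using dim_image_le[OF f, of UNIV] by simp
    show "\<exists>C. (\<forall>j. C j \<ge> 0) \<and> (\<forall>s r. s > 0 \<longrightarrow> r > 0 \<longrightarrow>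
      measure lebesgue (Y k s r) = (\<Sum>j\<le>DIM('a). C j * s ^ j * r ^ (DIM('b) - j)))"
    proof (rule polytope_volume_polynomial[of "f ` P k" "Q k" "range f" "DIM('a)"])
      show "finite (f ` P k)" "finite (Q k)" using P Q by auto
      show "f ` P k \<subseteq> range f" "subspace (range f)"
        using f by (auto intro: linear_subspace_image)
      show "dim (range f) \<le> DIM('a)" by fact
      fix C :: "nat \<Rightarrow> real" assume C: "\<And>j. C j \<ge> 0"
        "\<And>s r. s > 0 \<Longrightarrow> r > 0 \<Longrightarrow>
          measure lebesgue ((\<lambda>x. s *\<^sub>R x) ` (convex hull (f ` P k)) + (\<lambda>x. r *\<^sub>R x) ` (convex hull (Q k)))
            = (\<Sum>j\<le>DIM('a). C j * s ^ j * r ^ (DIM('b) - j))"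
      show "\<exists>C. (\<forall>j. C j \<ge> 0) \<and> (\<forall>s r. s > 0 \<longrightarrow> r > 0 \<longrightarrow>
        measure lebesgue (Y k s r) = (\<Sum>j\<le>DIM('a). C j * s ^ j * r ^ (DIM('b) - j)))"
        unfolding Y_def using C by (intro exI[of _ C]) (simp add: convex_hull_linear_image[OF f])
    qed
  qed
  then obtain Ck where Ck: "\<And>k j. Ck k j \<ge> 0" "\<And>k s r. s > 0 \<Longrightarrow> r > 0 \<Longrightarrow>
      measure lebesgue (Y k s r) = (\<Sum>j\<le>DIM('a). Ck k j * s ^ j * r ^ (DIM('b) - j))"
    by metis
  have lim: "(\<lambda>k. measure lebesgue (Y k (s + \<epsilon> k) (r + \<epsilon> k))) \<longlonglongrightarrow> measure lebesgue (X s r)"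
    if sr: "s \<ge> 0" "r \<ge> 0" for s r
  proof -
    define M where "M = c * (R + s + 1) + (R' + r + 1)"
    have M: "M \<ge> 0" unfolding M_def using c R R' sr by auto
    have lower: "measure lebesgue (X s r) \<le> measure lebesgue (Y k (s + \<epsilon> k) (r + \<epsilon> k))" for k
    proof -
      have "(+) (\<epsilon> k *\<^sub>R f p + \<epsilon> k *\<^sub>R q) ` X s r \<subseteq> Y k (s + \<epsilon> k) (r + \<epsilon> k)"
      proof
        fix z assume "z \<in> (+) (\<epsilon> k *\<^sub>R f p + \<epsilon> k *\<^sub>R q) ` X s r"
        then obtain w where w: "z = \<epsilon> k *\<^sub>R f p + \<epsilon> k *\<^sub>R q + w" "w \<in> X s r" by blast
        from w(2) obtain x y where xy: "w = x + y" "x \<in> (\<lambda>x. s *\<^sub>R x) ` f ` K" "y \<in> (\<lambda>x. r *\<^sub>R x) ` B"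
          unfolding X_def by (rule set_plus_elim)
        then have z: "z = (\<epsilon> k *\<^sub>R f p + x) + (\<epsilon> k *\<^sub>R q + y)"
          "x \<in> (\<lambda>x. s *\<^sub>R x) ` f ` K" "y \<in> (\<lambda>x. r *\<^sub>R x) ` B"
          by (simp_all add: w(1))
        show "z \<in> Y k (s + \<epsilon> k) (r + \<epsilon> k)"
          unfolding Y_def z(1) using \<epsilon>[of k] sr z(2,3) p q cK cB P(2)[of k] Q(2)[of k] f
          by (intro set_plus_intro minkowski_combination_inner[of "f ` K"] minkowski_combination_inner[of B])
            (auto intro: convex_linear_image)
      qed
      then have "measure lebesgue ((+) (\<epsilon> k *\<^sub>R f p + \<epsilon> k *\<^sub>R q) ` X s r)
          \<le> measure lebesgue (Y k (s + \<epsilon> k) (r + \<epsilon> k))"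
        using compX compY by (intro measure_mono_fmeasurable fmeasurableD lmeasurable_compact compact_translation)
      then show ?thesis by (simp only: measure_translation)
    qed
    have upper: "measure lebesgue (Y k (s + \<epsilon> k) (r + \<epsilon> k)) \<le> measure lebesgue (X s r + cball 0 (M * \<epsilon> k))" for k
    proof -
      have "Y k (s + \<epsilon> k) (r + \<epsilon> k) \<subseteq> X s r + cball 0 (M * \<epsilon> k)"
      proof
        fix z assume "z \<in> Y k (s + \<epsilon> k) (r + \<epsilon> k)"
        then obtain x y where z: "z = x + y" "x \<in> (\<lambda>x. (s + \<epsilon> k) *\<^sub>R x) ` f ` (convex hull P k)"
          "y \<in> (\<lambda>x. (r + \<epsilon> k) *\<^sub>R x) ` (\<lambda>x. x) ` (convex hull Q k)"
          unfolding Y_def image_ident by (rule set_plus_elim)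
        have "x \<in> (\<lambda>x. s *\<^sub>R x) ` f ` K + cball 0 (c * (R + s + 1) * \<epsilon> k)"
          using c \<epsilon>[of k] sr by (intro minkowski_combination_outer[OF f c(2) R(2) _ _ _ _ P(3) z(2)]) auto
        then obtain x1 x2 where x: "x = x1 + x2" "x1 \<in> (\<lambda>x. s *\<^sub>R x) ` f ` K" "norm x2 \<le> c * (R + s + 1) * \<epsilon> k"
          unfolding mem_cball_0[symmetric] by (rule set_plus_elim)
        have "y \<in> (\<lambda>x. r *\<^sub>R x) ` (\<lambda>x. x) ` B + cball 0 (1 * (R' + r + 1) * \<epsilon> k)"
          using \<epsilon>[of k] sr by (intro minkowski_combination_outer[OF linear_ident _ R'(2) _ _ _ _ Q(3) z(3)]) auto
        then obtain y1 y2 where y: "y = y1 + y2" "y1 \<in> (\<lambda>x. r *\<^sub>R x) ` B" "norm y2 \<le> (R' + r + 1) * \<epsilon> k"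
          unfolding mem_cball_0[symmetric] image_ident mult_1 by (rule set_plus_elim)
        have "norm (x2 + y2) \<le> M * \<epsilon> k"
          using norm_triangle_ineq[of x2 y2] x(3) y(3) by (simp add: M_def algebra_simps)
        moreover have "z = (x1 + y1) + (x2 + y2)" by (simp add: z x y)
        ultimately show "z \<in> X s r + cball 0 (M * \<epsilon> k)"
          using x(2) y(2) unfolding X_def by (metis mem_cball_0 set_plus_intro)
      qed
      then show ?thesis
        using compX compY by (intro measure_mono_fmeasurable fmeasurableD lmeasurable_compact compact_set_plus) auto
    qed
    show ?thesis
      by (rule tendsto_sandwich[OF _ _ tendsto_const measure_thickening_tendsto[OF compX M]])
        (use lower upper in \<open>auto simp: \<epsilon>_def\<close>)
  qed
  obtain M where M: "\<And>k. norm (measure lebesgue (Y k (1 + \<epsilon> k) (1 + \<epsilon> k))) \<le> M"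
    using convergent_imp_Bseq[OF convergentI[OF lim[of 1 1]]] by (auto simp: Bseq_def)
  \<comment> \<open>At \<open>(1 + \<epsilon> k, 1 + \<epsilon> k)\<close> every monomial is at
    least 1, so a nonnegative coefficient is at most the volume there, and these volumes
    converge.\<close>
  have bound: "\<bar>Ck k j\<bar> \<le> M" if "j \<in> {..DIM('a)}" for k j
  proof -
    have "Ck k j * 1 \<le> Ck k j * ((1 + \<epsilon> k) ^ j * (1 + \<epsilon> k) ^ (DIM('b) - j))"
      using Ck(1) \<epsilon>[of k] by (intro mult_left_mono) (auto simp: power_add[symmetric] one_le_power)
    also have "\<dots> = Ck k j * (1 + \<epsilon> k) ^ j * (1 + \<epsilon> k) ^ (DIM('b) - j)" by simp
    also have "\<dots> \<le> (\<Sum>j\<le>DIM('a). Ck k j * (1 + \<epsilon> k) ^ j * (1 + \<epsilon> k) ^ (DIM('b) - j))"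
      using that Ck(1) \<epsilon>[of k] by (intro member_le_sum) auto
    also have "\<dots> = measure lebesgue (Y k (1 + \<epsilon> k) (1 + \<epsilon> k))"
      using Ck(2)[of "1 + \<epsilon> k" "1 + \<epsilon> k" k] \<epsilon>[of k] by simp
    also have "\<dots> \<le> M" using M[of k] by simp
    finally show ?thesis using Ck(1) by simp
  qed
  obtain \<phi> :: "nat \<Rightarrow> nat" and C where \<phi>: "strict_mono \<phi>" "\<forall>j\<in>{..DIM('a)}. (\<lambda>k. Ck (\<phi> k) j) \<longlonglongrightarrow> C j"
    using bounded_family_convergent_subsequence[of "{..DIM('a)}" Ck M] bound by blast
  show ?thesis
  proof (rule that[of C])
    fix s r :: real assume sr: "s \<ge> 0" "r \<ge> 0"
    have \<epsilon>\<phi>: "(\<lambda>k. \<epsilon> (\<phi> k)) \<longlonglongrightarrow> 0"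
      using LIMSEQ_subseq_LIMSEQ[OF \<epsilon>0 \<phi>(1)] by (simp add: o_def)
    have "(\<lambda>k. \<Sum>j\<le>DIM('a). Ck (\<phi> k) j * (s + \<epsilon> (\<phi> k)) ^ j * (r + \<epsilon> (\<phi> k)) ^ (DIM('b) - j))
        \<longlonglongrightarrow> (\<Sum>j\<le>DIM('a). C j * (s + 0) ^ j * (r + 0) ^ (DIM('b) - j))"
      using \<phi>(2) by (intro tendsto_sum tendsto_mult tendsto_power tendsto_add tendsto_const \<epsilon>\<phi>) auto
    moreover have "(\<Sum>j\<le>DIM('a). Ck (\<phi> k) j * (s + \<epsilon> (\<phi> k)) ^ j * (r + \<epsilon> (\<phi> k)) ^ (DIM('b) - j))
        = measure lebesgue (Y (\<phi> k) (s + \<epsilon> (\<phi> k)) (r + \<epsilon> (\<phi> k)))" for k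
      using Ck(2)[of "s + \<epsilon> (\<phi> k)" "r + \<epsilon> (\<phi> k)" "\<phi> k"] \<epsilon>[of "\<phi> k"] sr by simp
    moreover have "(\<lambda>k. measure lebesgue (Y (\<phi> k) (s + \<epsilon> (\<phi> k)) (r + \<epsilon> (\<phi> k)))) \<longlonglongrightarrow> measure lebesgue (X s r)"
      using LIMSEQ_subseq_LIMSEQ[OF lim[OF sr] \<phi>(1)] by (simp add: o_def)
    ultimately show "measure lebesgue ((\<lambda>x. s *\<^sub>R x) ` f ` K + (\<lambda>x. r *\<^sub>R x) ` B)
        = (\<Sum>j\<le>DIM('a). C j * s ^ j * r ^ (DIM('b) - j))"
      unfolding X_def using LIMSEQ_unique by (metis (no_types, lifting) add_0_right ext)
  qed
qed

section \<open>Mixed volumes of two bodies\<close>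

lemma scaled_sum_convex:
  fixes K :: "'a::real_vector set"
  assumes K: "convex K" "K \<noteq> {}" and "finite I" "\<And>i. i \<in> I \<Longrightarrow> t i \<ge> 0"
  shows "(\<Sum>i\<in>I. (\<lambda>x. t i *\<^sub>R x) ` K) = (\<lambda>x. sum t I *\<^sub>R x) ` K"
  using assms(3,4)
proof (induction I rule: finite_induct)
  case empty
  show ?case using K(2) by (auto simp: image_constant_conv)
next
  case (insert i I)
  define s where "s = sum t I"
  have pos: "t i \<ge> 0" "s \<ge> 0" using insert by (auto simp: s_def intro: sum_nonneg)
  have "(\<lambda>x. t i *\<^sub>R x) ` K + (\<lambda>x. s *\<^sub>R x) ` K = (\<lambda>x. (t i + s) *\<^sub>R x) ` K"
  proof (intro equalityI subsetI)
    fix z assume "z \<in> (\<lambda>x. t i *\<^sub>R x) ` K + (\<lambda>x. s *\<^sub>R x) ` K"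
    then obtain x y where z: "x \<in> K" "y \<in> K" "z = t i *\<^sub>R x + s *\<^sub>R y"
      by (auto elim!: set_plus_elim)
    show "z \<in> (\<lambda>x. (t i + s) *\<^sub>R x) ` K"
    proof (cases "t i + s = 0")
      case True
      then have "t i = 0" "s = 0" using pos by linarith+
      then show ?thesis using z by auto
    next
      case False
      then have "(t i / (t i + s)) *\<^sub>R x + (s / (t i + s)) *\<^sub>R y \<in> K"
        using z pos K by (intro convexD) (auto simp: add_divide_distrib[symmetric])
      moreover have "z = (t i + s) *\<^sub>R ((t i / (t i + s)) *\<^sub>R x + (s / (t i + s)) *\<^sub>R y)"
        using False by (simp add: z scaleR_add_right)
      ultimately show ?thesis by blast
    qed
  next
    fix z assume "z \<in> (\<lambda>x. (t i + s) *\<^sub>R x) ` K"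
    then obtain x where "x \<in> K" "z = t i *\<^sub>R x + s *\<^sub>R x" by (auto simp: scaleR_add_left)
    then show "z \<in> (\<lambda>x. t i *\<^sub>R x) ` K + (\<lambda>x. s *\<^sub>R x) ` K" by blast
  qed
  then show ?case using insert by (simp add: s_def)
qed

lemma vol_comb_two_bodies:
  assumes A: "convex A" "A \<noteq> {}" and B: "convex B" "B \<noteq> {}" and t: "\<And>i. t i \<ge> 0"
  shows "vol_comb (replicate j A @ replicate m B) t =
    measure lebesgue ((\<lambda>x. sum t {..<j} *\<^sub>R x) ` A + (\<lambda>x. sum t {j..<j+m} *\<^sub>R x) ` B)"
proof -
  let ?Ks = "replicate j A @ replicate m B"
  have "(\<Sum>i<j + m. (\<lambda>x. t i *\<^sub>R x) ` (?Ks ! i)) =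
    (\<Sum>i<j. (\<lambda>x. t i *\<^sub>R x) ` (?Ks ! i)) + (\<Sum>i=j..<j + m. (\<lambda>x. t i *\<^sub>R x) ` (?Ks ! i))"
  proof -
    have "{..<j + m} = {..<j} \<union> {j..<j + m}" by auto
    moreover have "{..<j} \<inter> {j..<j + m} = {}" by auto
    ultimately show ?thesis using sum.union_disjoint[of "{..<j}" "{j..<j + m}"] by simp
  qed
  also have "(\<Sum>i<j. (\<lambda>x. t i *\<^sub>R x) ` (?Ks ! i)) = (\<Sum>i<j. (\<lambda>x. t i *\<^sub>R x) ` A)"
    by (intro sum.cong) (auto simp: nth_append)
  also have "(\<Sum>i=j..<j + m. (\<lambda>x. t i *\<^sub>R x) ` (?Ks ! i)) = (\<Sum>i=j..<j + m. (\<lambda>x. t i *\<^sub>R x) ` B)"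
    by (intro sum.cong) (auto simp: nth_append)
  finally show ?thesis
    using assms by (simp add: vol_comb_def scaled_sum_convex)
qed

text \<open>Sums of products of polynomials in two block sums are closed under differentiation in a
  variable of one block, which permits iteration. The formula for \<open>f\<close> is assumed on the
  orthant only, to match the one-sided derivatives.\<close>

lemma partial_nonneg_poly:
  fixes p g :: "nat \<Rightarrow> real poly"
  assumes f: "\<And>t. (\<And>i. t i \<ge> 0) \<Longrightarrow> f t = (\<Sum>q\<in>I. c q * poly (p q) (sum t S) * poly (g q) (sum t S'))"
    and S: "finite S" "finite S'" "i \<in> S" "i \<notin> S'" and t: "\<And>i. t i \<ge> 0"
  shows "partial_nonneg i f t = (\<Sum>q\<in>I. c q * poly (pderiv (p q)) (sum t S) * poly (g q) (sum t S'))"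
proof -
  define a where "a = sum t S - t i"
  have S_upd: "sum (t(i := s)) S = a + s" "sum (t(i := s)) S' = sum t S'" for s
  proof -
    have "sum (t(i := s)) S = s + sum t (S - {i})"
      using S by (simp add: sum.remove)
    then show "sum (t(i := s)) S = a + s"
      using S by (simp add: a_def sum.remove)
    show "sum (t(i := s)) S' = sum t S'"
      using S by (intro sum.cong) auto
  qed
  have "((\<lambda>s. \<Sum>q\<in>I. c q * poly (p q) (a + s) * poly (g q) (sum t S')) has_real_derivative
      (\<Sum>q\<in>I. c q * poly (pderiv (p q)) (sum t S) * poly (g q) (sum t S'))) (at (t i) within {0..})"
    unfolding a_def by (auto intro!: derivative_eq_intros DERIV_sum)
  then have "((\<lambda>s. f (t(i := s))) has_vector_derivative
      (\<Sum>q\<in>I. c q * poly (pderiv (p q)) (sum t S) * poly (g q) (sum t S'))) (at (t i) within {0..})"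
    unfolding has_real_derivative_iff_has_vector_derivative
  proof (rule has_vector_derivative_transform[rotated 2])
    show "t i \<in> {0..}" using t by simp
    fix s :: real assume "s \<in> {0..}"
    then show "f (t(i := s)) = (\<Sum>q\<in>I. c q * poly (p q) (a + s) * poly (g q) (sum t S'))"
    proof -
      have "(t(i := s)) k \<ge> 0" for k using t \<open>s \<in> {0..}\<close> by simp
      then have "f (t(i := s)) = (\<Sum>q\<in>I. c q * poly (p q) (sum (t(i := s)) S) * poly (g q) (sum (t(i := s)) S'))"
        by (rule f)
      then show ?thesis unfolding S_upd .
    qed
  qed
  \<comment> \<open>Even for \<open>t i = 0\<close> the point is a limit point of the half line, so
    the one-sided derivative is unique.\<close>
  moreover have "at (t i) within {0..} \<noteq> bot"
  proof -
    have "\<exists>x'\<in>{0..}. x' \<noteq> t i \<and> dist x' (t i) < e" if "e > 0" for e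
      using that t[of i] by (intro bexI[of _ "t i + e / 2"]) (auto simp: dist_real_def)
    then have "t i islimpt {0..}" by (auto simp: islimpt_approachable)
    then show ?thesis by (simp add: trivial_limit_within)
  qed
  ultimately show ?thesis
    unfolding partial_nonneg_def by (intro vector_derivative_within)
qed

lemma poly_higher_pderiv_monom_0:
  "poly ((pderiv ^^ j) (monom 1 q)) (0::real) = (if q = j then fact j else 0)"
  by (simp add: poly_0_coeff_0 coeff_higher_pderiv pochhammer_fact)

text \<open>At \<open>0\<close> only the term \<open>q = j\<close> survives all derivatives: lower
  powers are differentiated away and higher ones vanish there. What remains is
  \<open>C j * j! * (N - j)!\<close>.\<close>

lemma mixed_volume_two_bodies:
  fixes A B :: "'a::euclidean_space set"
  assumes A: "convex_body A" and B: "convex_body B"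
    and F: "\<And>s r. s \<ge> 0 \<Longrightarrow> r \<ge> 0 \<Longrightarrow>
      measure lebesgue ((\<lambda>x. s *\<^sub>R x) ` A + (\<lambda>x. r *\<^sub>R x) ` B) = (\<Sum>q\<le>d. C q * s ^ q * r ^ (N - q))"
    and j: "j \<le> d" "d \<le> N"
  shows "C j = real (N choose j) * mixed_volume (replicate j A @ replicate (N - j) B)"
proof -
  define m where "m = N - j"
  have N: "N = j + m" using j by (simp add: m_def)
  define R where "R = vol_comb (replicate j A @ replicate m B)"
  define p where "p a q = (pderiv ^^ a) (monom (1::real) q)" for a q
  have R: "R t = (\<Sum>q\<le>d. C q * poly (p 0 q) (sum t {..<j}) * poly (p 0 (N - q)) (sum t {j..<N}))"
    if t: "\<And>i. t i \<ge> 0" for t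
  proof -
    have "convex A" "A \<noteq> {}" "convex B" "B \<noteq> {}"
      using A B by (auto simp: convex_body_def)
    then show ?thesis
      using t by (simp add: R_def vol_comb_two_bodies F sum_nonneg p_def poly_monom N)
  qed
  \<comment> \<open>\<open>foldr\<close> takes the derivative with the last index first, so the
    block of \<open>B\<close> is exhausted before the block of \<open>A\<close>.\<close>
  have 1: "foldr partial_nonneg [N - k..<N] R t =
      (\<Sum>q\<le>d. C q * poly (p 0 q) (sum t {..<j}) * poly (p k (N - q)) (sum t {j..<N}))"
    if "k \<le> m" "\<And>i. t i \<ge> 0" for k t
    using that
  proof (induction k arbitrary: t)
    case 0
    then show ?case by (simp add: R)
  next
    case (Suc k)
    have eq: "[N - Suc k..<N] = (N - Suc k) # [N - k..<N]"
      using Suc.prems(1) N by (simp add: upt_conv_Cons Suc_diff_Suc)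
    have "partial_nonneg (N - Suc k) (foldr partial_nonneg [N - k..<N] R) t
      = (\<Sum>q\<le>d. C q * poly (pderiv (p k (N - q))) (sum t {j..<N}) * poly (p 0 q) (sum t {..<j}))"
    proof (rule partial_nonneg_poly)
      fix t :: "nat \<Rightarrow> real" assume t: "\<And>i. t i \<ge> 0"
      show "foldr partial_nonneg [N - k..<N] R t =
        (\<Sum>q\<le>d. C q * poly (p k (N - q)) (sum t {j..<N}) * poly (p 0 q) (sum t {..<j}))"
        using Suc.IH[OF _ t] Suc.prems(1) by (simp add: mult_ac)
    qed (use Suc.prems N in auto)
    then show ?case unfolding eq by (simp add: p_def mult_ac)
  qed
  have 2: "foldr partial_nonneg [j - k..<N] R t =
      (\<Sum>q\<le>d. C q * poly (p k q) (sum t {..<j}) * poly (p m (N - q)) (sum t {j..<N}))"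
    if "k \<le> j" "\<And>i. t i \<ge> 0" for k t
    using that
  proof (induction k arbitrary: t)
    case 0
    then show ?case using 1[of m t] N by simp
  next
    case (Suc k)
    have eq: "[j - Suc k..<N] = (j - Suc k) # [j - k..<N]"
      using Suc.prems(1) N by (simp add: upt_conv_Cons Suc_diff_Suc)
    have "partial_nonneg (j - Suc k) (foldr partial_nonneg [j - k..<N] R) t
      = (\<Sum>q\<le>d. C q * poly (pderiv (p k q)) (sum t {..<j}) * poly (p m (N - q)) (sum t {j..<N}))"
    proof (rule partial_nonneg_poly)
      fix t :: "nat \<Rightarrow> real" assume t: "\<And>i. t i \<ge> 0"
      show "foldr partial_nonneg [j - k..<N] R t =
        (\<Sum>q\<le>d. C q * poly (p k q) (sum t {..<j}) * poly (p m (N - q)) (sum t {j..<N}))"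
        using Suc.IH[OF _ t] Suc.prems(1) by simp
    qed (use Suc.prems N in auto)
    then show ?case unfolding eq by (simp add: p_def)
  qed
  have "foldr partial_nonneg [0..<N] R (\<lambda>_. 0) =
      (\<Sum>q\<le>d. C q * (if q = j then fact j else 0) * (if N - q = m then fact m else 0))"
    using 2[of j "\<lambda>_. 0"] by (simp add: p_def poly_higher_pderiv_monom_0)
  also have "\<dots> = (\<Sum>q\<le>d. if q = j then C j * fact j * fact m else 0)"
    by (intro sum.cong) (auto simp: N)
  also have "\<dots> = C j * fact j * fact m" using j by simp
  finally have "mixed_volume (replicate j A @ replicate m B) = C j * (fact j * fact m) / fact N"
    by (simp add: mixed_volume_def R_def N)
  then have "real (N choose j) * mixed_volume (replicate j A @ replicate m B)
      = C j * (real (N choose j) * (fact j * fact m)) / fact N"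
    by simp
  also have "real (N choose j) * (fact j * fact m) = fact N"
  proof -
    have "fact j * fact m * (N choose j) = fact N"
      using binomial_fact_lemma[of j N] j by (simp add: m_def)
    then have "real (fact j * fact m * (N choose j)) = real (fact N)" by (rule arg_cong)
    then show ?thesis by (simp add: mult_ac)
  qed
  finally show ?thesis by (simp add: m_def)
qed

section \<open>The coefficients and the cartesian power\<close>

text \<open>The value is \<open>n B(n, q + 1)\<close>. The induction step trades a power of
  \<open>r\<close> for one of \<open>1 - r\<close>, hence \<open>n\<close> is generalised.\<close>

lemma has_integral_beta_nat:
  assumes "n \<ge> 1"
  shows "((\<lambda>r::real. real n * (1 - r) ^ (n - 1) * r ^ q) has_integral fact n * fact q / fact (n + q)) {0..1}"
  using assms
proof (induction q arbitrary: n)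
  case 0
  have "((\<lambda>r::real. real n * (1 - r) ^ (n - 1)) has_integral (- ((1 - 1) ^ n) - (- ((1 - 0) ^ n)))) {0..1}"
    by (rule fundamental_theorem_of_calculus)
      (auto intro!: derivative_eq_intros simp: has_real_derivative_iff_has_vector_derivative[symmetric])
  then show ?case using 0 by (simp add: power_0_left)
next
  case (Suc q)
  \<comment> \<open>Integration by parts: the integrand is the derivative of
    \<open>- (1 - r)^n r^(q + 1)\<close>, which vanishes at both ends.\<close>
  have "((\<lambda>r::real. real n * (1 - r) ^ (n - 1) * r ^ Suc q - real (Suc q) * ((1 - r) ^ n * r ^ q))
      has_integral (- ((1 - 1) ^ n * 1 ^ Suc q) - (- ((1 - 0) ^ n * 0 ^ Suc q)))) {0..1}"
    by (rule fundamental_theorem_of_calculus)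
      (auto intro!: derivative_eq_intros simp del: power_Suc
        simp: has_real_derivative_iff_has_vector_derivative[symmetric] algebra_simps)
  then have 1: "((\<lambda>r::real. real n * (1 - r) ^ (n - 1) * r ^ Suc q - real (Suc q) * ((1 - r) ^ n * r ^ q))
      has_integral 0) {0..1}"
    using Suc.prems by (simp add: power_0_left)
  have "((\<lambda>r::real. real (n + 1) * (1 - r) ^ (n + 1 - 1) * r ^ q) has_integral
      fact (n + 1) * fact q / fact (n + 1 + q)) {0..1}"
    by (rule Suc.IH) simp
  from has_integral_mult_right[OF this, of "real (Suc q) / real (n + 1)"]
  have "((\<lambda>r::real. real (Suc q) / real (n + 1) * (real (n + 1) * (1 - r) ^ (n + 1 - 1) * r ^ q)) has_integral
      real (Suc q) / real (n + 1) * (fact (n + 1) * fact q / fact (n + 1 + q))) {0..1}" .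
  also have "(\<lambda>r::real. real (Suc q) / real (n + 1) * (real (n + 1) * (1 - r) ^ (n + 1 - 1) * r ^ q))
      = (\<lambda>r. real (Suc q) * ((1 - r) ^ n * r ^ q))"
    by (simp add: fun_eq_iff del: of_nat_Suc of_nat_add)
  also have "real (Suc q) / real (n + 1) * (fact (n + 1) * fact q / fact (n + 1 + q)) =
      fact n * fact (Suc q) / fact (n + Suc q)"
    by (simp del: of_nat_Suc of_nat_add)
  finally have 2: "((\<lambda>r::real. real (Suc q) * ((1 - r) ^ n * r ^ q)) has_integral
      fact n * fact (Suc q) / fact (n + Suc q)) {0..1}" .
  show ?case using has_integral_add[OF 1 2] by simp
qed

lemma binomial_fact_identity:
  assumes "m \<le> N - j" "j \<le> N"
  shows "real (N choose j) * (real ((N - j) choose m) * (fact n * fact (N - m) / fact (n + (N - m)))) =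
    real ((N - m) choose j) * (fact N * fact n / (fact m * fact (N + n - m)))"
proof -
  have eq: "n + (N - m) = N + n - m" "N - j - m = N - m - j" using assms by auto
  have b: "real (N choose j) = fact N / (fact j * fact (N - j))"
    "real ((N - j) choose m) = fact (N - j) / (fact m * fact (N - j - m))"
    "real ((N - m) choose j) = fact (N - m) / (fact j * fact (N - m - j))"
    using binomial_fact[of j N, where 'a = real] binomial_fact[of m "N - j", where 'a = real]
      binomial_fact[of j "N - m", where 'a = real] assms by simp_all
  show ?thesis unfolding b eq by (simp add: mult_ac)
qed

text \<open>\<open>binomial_ring\<close> splits off the powers of \<open>1 - t\<close>, and each
  remaining \<open>r ^ (N - m)\<close> becomes a beta integral.\<close>

lemma coeff_c_has_integral:
  assumes "n \<ge> 1" "j \<le> n * p"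
  shows "((\<lambda>r. real n * (1 - r) ^ (n - 1) *
      (real ((n * p) choose j) * (t * r) ^ j * (1 - t + t * r) ^ (n * p - j)))
    has_integral coeff_c n p j t) {0..1}"
proof -
  define N where "N = n * p"
  have j: "j \<le> N" using assms by (simp add: N_def)
  have "((\<lambda>r. \<Sum>m\<le>N - j. real (N choose j) * (real ((N - j) choose m) * (1 - t) ^ m * t ^ (N - m)) *
      (real n * (1 - r) ^ (n - 1) * r ^ (N - m)))
    has_integral (\<Sum>m\<le>N - j. real (N choose j) * (real ((N - j) choose m) * (1 - t) ^ m * t ^ (N - m)) *
      (fact n * fact (N - m) / fact (n + (N - m))))) {0..1}"
    by (intro has_integral_sum has_integral_mult_right has_integral_beta_nat assms) auto
  also have "(\<lambda>r. \<Sum>m\<le>N - j. real (N choose j) * (real ((N - j) choose m) * (1 - t) ^ m * t ^ (N - m)) *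
      (real n * (1 - r) ^ (n - 1) * r ^ (N - m)))
    = (\<lambda>r. real n * (1 - r) ^ (n - 1) * (real (N choose j) * (t * r) ^ j * (1 - t + t * r) ^ (N - j)))"
  proof
    fix r
    have "(t * r) ^ j * (1 - t + t * r) ^ (N - j)
        = (\<Sum>m\<le>N - j. real ((N - j) choose m) * (1 - t) ^ m * t ^ (N - m) * r ^ (N - m))"
      unfolding binomial_ring sum_distrib_left
    proof (rule sum.cong)
      fix m assume "m \<in> {..N - j}"
      then have "N - m = j + (N - j - m)" using j by auto
      then show "(t * r) ^ j * (real ((N - j) choose m) * (1 - t) ^ m * (t * r) ^ (N - j - m))
        = real ((N - j) choose m) * (1 - t) ^ m * t ^ (N - m) * r ^ (N - m)"
        by (simp add: power_mult_distrib power_add)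
    qed simp
    then show "(\<Sum>m\<le>N - j. real (N choose j) * (real ((N - j) choose m) * (1 - t) ^ m * t ^ (N - m)) *
        (real n * (1 - r) ^ (n - 1) * r ^ (N - m)))
      = real n * (1 - r) ^ (n - 1) * (real (N choose j) * (t * r) ^ j * (1 - t + t * r) ^ (N - j))"
      by (simp add: mult.assoc sum_distrib_left mult_ac)
  qed
  also have "(\<Sum>m\<le>N - j. real (N choose j) * (real ((N - j) choose m) * (1 - t) ^ m * t ^ (N - m)) *
      (fact n * fact (N - m) / fact (n + (N - m)))) = coeff_c n p j t"
    unfolding coeff_c_def N_def[symmetric] atLeast0AtMost
  proof (rule sum.cong)
    fix m assume "m \<in> {..N - j}"
    then have "m \<le> N - j" by simp
    from arg_cong[OF binomial_fact_identity[OF this j, of n], of "\<lambda>z. z * ((1 - t) ^ m * t ^ (N - m))"]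
    show "real (N choose j) * (real ((N - j) choose m) * (1 - t) ^ m * t ^ (N - m)) *
      (fact n * fact (N - m) / fact (n + (N - m))) =
      real ((N - m) choose j) * (fact N * fact n / (fact m * fact (N + n - m))) * (1 - t) ^ m * t ^ (N - m)"
      by (simp add: mult_ac)
  qed simp
  finally show ?thesis by (simp add: N_def)
qed

section \<open>Lebesgue measure and convex bodies in the p-fold product\<close>

lemma Basis_vec_bij: "bij_betw (\<lambda>(i, b). axis i b) (UNIV \<times> Basis) (Basis :: ('a::euclidean_space ^ 'p) set)"
  unfolding bij_betw_def
proof
  show "inj_on (\<lambda>(i, b). axis i b) (UNIV \<times> (Basis :: 'a set))"
    by (auto simp: inj_on_def axis_eq_axis nonzero_Basis)
  show "(\<lambda>(i, b). axis i b) ` (UNIV \<times> Basis) = (Basis :: ('a ^ 'p) set)"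
    by (auto simp: Basis_vec_def)
qed

lemma measurable_vec_lambda_PiM:
  "vec_lambda \<in> (\<Pi>\<^sub>M i\<in>(UNIV :: 'p::finite set). (lborel :: 'a::euclidean_space measure)) \<rightarrow>\<^sub>M borel"
proof (subst borel_measurable_euclidean_space, rule ballI)
  fix b :: "'a ^ 'p" assume "b \<in> Basis"
  then obtain i c where "b = axis i c" by (auto simp: Basis_vec_def)
  then show "(\<lambda>x. vec_lambda x \<bullet> b) \<in> borel_measurable (\<Pi>\<^sub>M i\<in>(UNIV :: 'p set). (lborel :: 'a measure))"
    by (simp add: inner_axis)
qed

text \<open>Lebesgue measure is determined by its values on boxes, and a box in
  \<open>'a ^ 'p\<close> is a product of boxes in \<open>'a\<close>; \<open>Basis_vec_bij\<close>
  groups the side lengths accordingly.\<close>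

lemma lborel_vec_eq:
  "(lborel :: ('a::euclidean_space ^ 'p) measure) = distr (\<Pi>\<^sub>M i\<in>UNIV. lborel) borel vec_lambda"
proof (rule lborel_eqI)
  interpret product_sigma_finite "\<lambda>_::'p. lborel :: 'a measure" ..
  fix l u :: "'a ^ 'p" assume le: "\<And>b. b \<in> Basis \<Longrightarrow> l \<bullet> b \<le> u \<bullet> b"
  have le': "l $ i \<bullet> b \<le> u $ i \<bullet> b" if "b \<in> Basis" for i b
    using le[of "axis i b"] that by (simp add: inner_axis Basis_vec_def) blast
  have "vec_lambda -` box l u \<inter> space (\<Pi>\<^sub>M i\<in>UNIV. lborel) = (\<Pi>\<^sub>E i\<in>UNIV. box (l $ i) (u $ i))"
    by (auto simp: space_PiM mem_box Basis_vec_def inner_axis PiE_iff)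
  then have "emeasure (distr (\<Pi>\<^sub>M i\<in>UNIV. lborel) borel vec_lambda) (box l u)
      = emeasure (\<Pi>\<^sub>M i\<in>UNIV. lborel) (\<Pi>\<^sub>E i\<in>UNIV. box (l $ i) (u $ i))"
    by (subst emeasure_distr) (auto simp: measurable_vec_lambda_PiM)
  also have "\<dots> = (\<Prod>i\<in>UNIV. emeasure lborel (box (l $ i) (u $ i)))"
    by (rule emeasure_PiM) auto
  also have "\<dots> = (\<Prod>i\<in>UNIV. ennreal (\<Prod>b\<in>Basis. (u $ i - l $ i) \<bullet> b))"
    using le' by (intro prod.cong) (auto simp: emeasure_lborel_box)
  also have "\<dots> = ennreal (\<Prod>i\<in>UNIV. \<Prod>b\<in>Basis. (u $ i - l $ i) \<bullet> b)"
    using le' by (intro prod_ennreal prod_nonneg) (auto simp: inner_diff_left)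
  also have "(\<Prod>i\<in>UNIV. \<Prod>b\<in>Basis. (u $ i - l $ i) \<bullet> b) = (\<Prod>b\<in>Basis. (u - l) \<bullet> b)"
    by (simp add: prod.cartesian_product prod.reindex_bij_betw[OF Basis_vec_bij, symmetric]
        inner_axis case_prod_unfold)
  finally show "emeasure (distr (\<Pi>\<^sub>M i\<in>UNIV. lborel) borel vec_lambda) (box l u)
      = ennreal (\<Prod>b\<in>Basis. (u - l) \<bullet> b)" .
qed simp

lemma compact_set_power:
  assumes "compact K"
  shows "compact (set_power K :: (real ^ 'n ^ 'p) set)"
  unfolding compact_eq_bounded_closed
proof
  obtain R where R: "\<And>x. x \<in> K \<Longrightarrow> norm x \<le> R"
    using compact_imp_bounded[OF assms] by (auto simp: bounded_iff)
  show "bounded (set_power K :: (real ^ 'n ^ 'p) set)"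
    unfolding bounded_iff
  proof (intro exI ballI)
    fix x :: "real ^ 'n ^ 'p" assume "x \<in> set_power K"
    then have "norm (x $ i) \<le> R" for i using R by (auto simp: set_power_def)
    then have "(\<Sum>i\<in>UNIV. norm (x $ i)) \<le> (\<Sum>i\<in>(UNIV::'p set). R)" by (intro sum_mono)
    moreover have "norm x \<le> (\<Sum>i\<in>UNIV. norm (x $ i))"
      unfolding norm_vec_def by (rule L2_set_le_sum) simp
    ultimately show "norm x \<le> (\<Sum>i\<in>(UNIV::'p set). R)" by linarith
  qed
  have "set_power K = (\<Inter>i. (\<lambda>x::real ^ 'n ^ 'p. x $ i) -` K)"
    by (auto simp: set_power_def)
  also have "closed \<dots>"
    using assms by (intro closed_INT ballI closed_vimage compact_imp_closed continuous_intros)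
  finally show "closed (set_power K :: (real ^ 'n ^ 'p) set)" .
qed

lemma convex_body_set_power:
  assumes "convex_body K"
  shows "convex_body (set_power K :: (real ^ 'n ^ 'p) set)"
proof -
  obtain k where "k \<in> K" using assms by (auto simp: convex_body_def)
  then have "(\<chi> i. k) \<in> (set_power K :: (real ^ 'n ^ 'p) set)" by (simp add: set_power_def)
  moreover have "convex (set_power K :: (real ^ 'n ^ 'p) set)"
    using assms by (auto simp: convex_def convex_body_def set_power_def)
  ultimately show ?thesis using assms compact_set_power by (auto simp: convex_body_def)
qed

lemma emeasure_set_power:
  fixes K :: "(real ^ 'n) set"
  assumes "compact K"
  shows "emeasure lborel (set_power K :: (real ^ 'n ^ 'p) set) = emeasure lborel K ^ CARD('p)"
proof -
  interpret product_sigma_finite "\<lambda>_::'p. lborel :: (real ^ 'n) measure" ..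
  have K: "K \<in> sets borel" using assms by (rule borel_compact)
  have "vec_lambda -` set_power K \<inter> space (\<Pi>\<^sub>M i\<in>UNIV. lborel) = (\<Pi>\<^sub>E i\<in>(UNIV :: 'p set). K)"
    by (auto simp: set_power_def space_PiM)
  then have "emeasure lborel (set_power K :: (real ^ 'n ^ 'p) set)
      = emeasure (\<Pi>\<^sub>M i\<in>UNIV. lborel) (\<Pi>\<^sub>E i\<in>(UNIV :: 'p set). K)"
    using borel_compact[OF compact_set_power[OF assms]]
    by (subst lborel_vec_eq, subst emeasure_distr) (auto simp: measurable_vec_lambda_PiM)
  also have "\<dots> = (\<Prod>i\<in>(UNIV::'p set). emeasure lborel K)"
    using K by (intro emeasure_PiM) auto
  finally show ?thesis by simp
qed

section \<open>A characterization of simplices\<close>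

text \<open>The pair \<open>(a, \<mu>)\<close> stands for the homothet \<open>\<mu> K - a\<close>. Inclusion of homothets is then the
  order of the vector space of pairs whose positive cone is \<open>homothety_cone K\<close>.\<close>

definition homothety_cone :: "'a::real_vector set \<Rightarrow> ('a \<times> real) set" where
  "homothety_cone K = {(d, \<nu>). \<nu> \<ge> 0 \<and> d \<in> (\<lambda>x. \<nu> *\<^sub>R x) ` K}"

definition homothet :: "'a::real_vector set \<Rightarrow> 'a \<times> real \<Rightarrow> 'a set" where
  "homothet K p = (\<lambda>x. snd p *\<^sub>R x - fst p) ` K"

lemma measure_pos_of_interior:
  fixes K :: "'a::euclidean_space set"
  assumes K: "compact K" "interior K \<noteq> {}"
  shows "measure lebesgue K > 0"
proof -
  have "\<not> negligible K"
    using K(2) by (meson interior_subset negligible_subset open_interior open_not_negligible)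
  then show ?thesis
    using lmeasurable_compact[OF K(1)]
    by (metis negligible_iff_measure zero_less_measure_iff measure_le_0_iff not_le)
qed

section \<open>The order of homothets given by the cone over K\<close>

lemma homothety_cone_scale:
  assumes "p \<in> homothety_cone K" "c \<ge> 0"
  shows "c *\<^sub>R p \<in> homothety_cone K"
  using assms by (cases p) (auto simp: homothety_cone_def image_iff)

lemma homothety_cone_add:
  assumes K: "convex K" and p: "p \<in> homothety_cone K" and q: "q \<in> homothety_cone K"
  shows "p + q \<in> homothety_cone K"
proof -
  obtain \<nu> x where p': "p = (\<nu> *\<^sub>R x, \<nu>)" "\<nu> \<ge> 0" "x \<in> K"
    using p by (auto simp: homothety_cone_def)
  obtain \<mu> y where q': "q = (\<mu> *\<^sub>R y, \<mu>)" "\<mu> \<ge> 0" "y \<in> K"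
    using q by (auto simp: homothety_cone_def)
  show ?thesis
  proof (cases "\<nu> + \<mu> = 0")
    case True
    then have "\<nu> = 0" "\<mu> = 0" using p' q' by linarith+
    then show ?thesis using p' q' p by simp
  next
    case False
    then have "(\<nu> / (\<nu> + \<mu>)) *\<^sub>R x + (\<mu> / (\<nu> + \<mu>)) *\<^sub>R y \<in> K"
      using p' q' K by (intro convexD) (auto simp: add_divide_distrib[symmetric])
    moreover have "\<nu> *\<^sub>R x + \<mu> *\<^sub>R y = (\<nu> + \<mu>) *\<^sub>R ((\<nu> / (\<nu> + \<mu>)) *\<^sub>R x + (\<mu> / (\<nu> + \<mu>)) *\<^sub>R y)"
      using False by (simp add: scaleR_add_right)
    ultimately show ?thesis using p' q' by (auto simp: homothety_cone_def)
  qed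
qed

lemma homothety_cone_sum:
  assumes "convex K" "K \<noteq> {}" "\<And>i. i \<in> I \<Longrightarrow> f i \<in> homothety_cone K"
  shows "sum f I \<in> homothety_cone K"
  using assms(3)
proof (induction I rule: infinite_finite_induct)
  case (insert i I)
  then show ?case using homothety_cone_add[OF assms(1)] by simp
qed (use assms(2) in \<open>auto simp: homothety_cone_def zero_prod_def image_iff\<close>)

lemma homothety_cone_point: "k \<in> K \<Longrightarrow> (k, 1) \<in> homothety_cone K"
  by (force simp: homothety_cone_def)

lemma homothet_mono:
  assumes K: "convex K" and "snd p \<ge> 0" "q - p \<in> homothety_cone K"
  shows "homothet K p \<subseteq> homothet K q"
proof
  fix z assume "z \<in> homothet K p"
  then obtain x where x: "x \<in> K" "z = snd p *\<^sub>R x - fst p" by (auto simp: homothet_def)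
  have "(snd p *\<^sub>R x, snd p) \<in> homothety_cone K"
    using x assms(2) by (auto simp: homothety_cone_def)
  from homothety_cone_add[OF K this assms(3)]
  have "(snd p *\<^sub>R x + (fst q - fst p), snd q) \<in> homothety_cone K"
    by (cases p, cases q) simp
  then obtain y where y: "y \<in> K" "snd q *\<^sub>R y = snd p *\<^sub>R x + (fst q - fst p)"
    by (auto simp: homothety_cone_def)
  then have "z = snd q *\<^sub>R y - fst q" using x(2) by simp
  with y(1) show "z \<in> homothet K q" by (auto simp: homothet_def)
qed

text \<open>The cancellation law for Minkowski sums: for \<open>\<mu> \<le> \<nu>\<close>, the inclusion
  \<open>d + \<mu> K \<subseteq> \<nu> K\<close> forces \<open>d \<in> (\<nu> - \<mu>) K\<close>.\<close>

lemma homothet_subset_imp: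
  fixes K :: "'a::euclidean_space set"
  assumes K: "compact K" "convex K" "interior K \<noteq> {}"
    and pq: "snd p > 0" "snd q > 0" and sub: "homothet K p \<subseteq> homothet K q"
  shows "q - p \<in> homothety_cone K"
proof -
  define \<mu> \<nu> d where "\<mu> = snd p" "\<nu> = snd q" "d = fst q - fst p"
  have pos: "\<mu> > 0" "\<nu> > 0" using pq by (auto simp: \<mu>_\<nu>_d_def)
  have in_K: "\<exists>y\<in>K. d + \<mu> *\<^sub>R x = \<nu> *\<^sub>R y" if "x \<in> K" for x
  proof -
    have "snd p *\<^sub>R x - fst p \<in> homothet K q" using that sub by (auto simp: homothet_def)
    then obtain y where "y \<in> K" "snd p *\<^sub>R x - fst p = snd q *\<^sub>R y - fst q"
      by (auto simp: homothet_def)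
    then show ?thesis by (intro bexI[of _ y]) (auto simp: \<mu>_\<nu>_d_def algebra_simps)
  qed
  have Kne: "K \<noteq> {}" using K(3) by auto
  have vol: "measure lebesgue K > 0"
    using K(1,3) by (rule measure_pos_of_interior)
  \<comment> \<open>Volumes settle the order of the ratios, since \<open>K\<close> has positive
    volume.\<close>
  have "\<mu> \<le> \<nu>"
  proof -
    have "(\<lambda>x. \<mu> *\<^sub>R x + d) ` K \<subseteq> (\<lambda>x. \<nu> *\<^sub>R x + 0) ` K"
      using in_K by (force simp: add.commute)
    then have "measure lebesgue ((\<lambda>x. \<mu> *\<^sub>R x + d) ` K) \<le> measure lebesgue ((\<lambda>x. \<nu> *\<^sub>R x + 0) ` K)"
      using K(1) by (intro measure_mono_fmeasurable fmeasurableD lmeasurable_compact compact_continuous_image)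
        (auto intro!: continuous_intros)
    then have "\<mu> ^ DIM('a) \<le> \<nu> ^ DIM('a)"
      using pos vol measure_lebesgue_affine[of \<mu> d K] measure_lebesgue_affine[of \<nu> 0 K]
      by (simp add: add.commute)
    then show ?thesis using pos by (simp add: power_mono_iff)
  qed
  moreover have "d \<in> (\<lambda>x. (\<nu> - \<mu>) *\<^sub>R x) ` K"
  proof (rule ccontr)
    assume nin: "d \<notin> (\<lambda>x. (\<nu> - \<mu>) *\<^sub>R x) ` K"
    have "convex ((\<lambda>x. (\<nu> - \<mu>) *\<^sub>R x) ` K)" "closed ((\<lambda>x. (\<nu> - \<mu>) *\<^sub>R x) ` K)"
      using K by (auto intro: convex_scaling compact_imp_closed compact_scaling)
    then obtain a b where ab: "a \<bullet> d < b" "\<forall>x\<in>(\<lambda>x. (\<nu> - \<mu>) *\<^sub>R x) ` K. b < a \<bullet> x"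
      using separating_hyperplane_closed_point[OF _ _ nin] by blast
    \<comment> \<open>\<open>k\<close> minimises the separating functional on \<open>K\<close>.
      Testing the inclusion at \<open>k\<close> gives
      \<open>a \<bullet> d \<ge> (\<nu> - \<mu>) * (a \<bullet> k)\<close>, against the separation
      of \<open>d\<close> from \<open>(\<nu> - \<mu>) k\<close>.\<close>
    obtain k where k: "k \<in> K" "\<And>x. x \<in> K \<Longrightarrow> a \<bullet> k \<le> a \<bullet> x"
      using continuous_attains_inf[OF K(1) Kne, of "\<lambda>x. a \<bullet> x"]
      by (force intro: continuous_on_inner continuous_on_const continuous_on_id)
    obtain y where y: "y \<in> K" "d + \<mu> *\<^sub>R k = \<nu> *\<^sub>R y" using in_K[OF k(1)] by blast
    have "a \<bullet> d + \<mu> * (a \<bullet> k) = \<nu> * (a \<bullet> y)"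
      using arg_cong[OF y(2), of "\<lambda>z. a \<bullet> z"] by (simp add: inner_add_right)
    moreover have "\<nu> * (a \<bullet> k) \<le> \<nu> * (a \<bullet> y)" using k y pos by simp
    moreover have "b < (\<nu> - \<mu>) * (a \<bullet> k)" using ab(2) k(1) by auto
    ultimately show False using ab(1) by (simp add: left_diff_distrib)
  qed
  ultimately show ?thesis
    by (cases p, cases q) (auto simp: homothety_cone_def \<mu>_\<nu>_d_def)
qed

text \<open>Disjointness as in vector lattices: for \<open>x\<close> and \<open>y\<close> in a
  convex cone \<open>C\<close> it says that their meet in the order of \<open>C\<close> is
  \<open>0\<close>. The form with lower bounds does not presuppose that meets exist.\<close>

definition cone_disjoint :: "('a::real_vector) set \<Rightarrow> 'a \<Rightarrow> 'a \<Rightarrow> bool" where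
  "cone_disjoint C x y \<longleftrightarrow> (\<forall>u. x - u \<in> C \<and> y - u \<in> C \<longrightarrow> - u \<in> C)"

text \<open>The vector lattice argument: a lower bound \<open>u\<close> of \<open>x + x'\<close> and
  \<open>y\<close> makes \<open>u - x'\<close> a lower bound of \<open>x\<close> and
  \<open>y\<close>. So \<open>u\<close> lies below \<open>x'\<close>, and disjointness of
  \<open>x'\<close> and \<open>y\<close> finishes.\<close>

lemma cone_disjoint_add:
  assumes C: "\<And>p q. p \<in> C \<Longrightarrow> q \<in> C \<Longrightarrow> p + q \<in> C"
    and "cone_disjoint C x y" "cone_disjoint C x' y" "x' \<in> C"
  shows "cone_disjoint C (x + x') y"
  unfolding cone_disjoint_def
proof (intro allI impI)
  fix u assume u: "x + x' - u \<in> C \<and> y - u \<in> C"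
  have "x - (u - x') \<in> C" using u by (simp add: algebra_simps)
  moreover have "y - (u - x') \<in> C" using C[of "y - u" x'] u assms(4) by (simp add: algebra_simps)
  ultimately have "x' - u \<in> C" using assms(2) by (fastforce simp: cone_disjoint_def)
  then show "- u \<in> C" using assms(3) u by (simp add: cone_disjoint_def)
qed

lemma cone_disjoint_sum:
  assumes C: "\<And>p q. p \<in> C \<Longrightarrow> q \<in> C \<Longrightarrow> p + q \<in> C" "0 \<in> C"
    and "finite I" "\<And>i. i \<in> I \<Longrightarrow> cone_disjoint C (f i) y" "\<And>i. i \<in> I \<Longrightarrow> f i \<in> C"
  shows "cone_disjoint C (sum f I) y"
  using assms(3-)
proof (induction I rule: finite_induct)
  case empty
  show ?case by (simp add: cone_disjoint_def)
next
  case (insert i I)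
  then show ?case
    using cone_disjoint_add[of C "sum f I" y "f i"] C(1) by (simp add: add.commute)
qed

lemma cone_disjoint_scale:
  assumes C: "\<And>p c. p \<in> C \<Longrightarrow> c \<ge> (0::real) \<Longrightarrow> c *\<^sub>R p \<in> C" and "c > 0" "cone_disjoint C x y"
  shows "cone_disjoint C (c *\<^sub>R x) (c *\<^sub>R y)"
  unfolding cone_disjoint_def
proof (intro allI impI)
  fix u assume u: "c *\<^sub>R x - u \<in> C \<and> c *\<^sub>R y - u \<in> C"
  have "(1 / c) *\<^sub>R (c *\<^sub>R x - u) \<in> C" "(1 / c) *\<^sub>R (c *\<^sub>R y - u) \<in> C"
    using u assms(2) by (auto intro: C)
  then have "x - (1 / c) *\<^sub>R u \<in> C" "y - (1 / c) *\<^sub>R u \<in> C"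
    using assms(2) by (simp_all add: scaleR_diff_right)
  then have "- ((1 / c) *\<^sub>R u) \<in> C" using assms(3) by (simp add: cone_disjoint_def)
  then have "c *\<^sub>R - ((1 / c) *\<^sub>R u) \<in> C" using assms(2) by (intro C) auto
  then show "- u \<in> C" using assms(2) by simp
qed

lemma cone_disjoint_mono:
  assumes C: "\<And>p q. p \<in> C \<Longrightarrow> q \<in> C \<Longrightarrow> p + q \<in> C"
    and "cone_disjoint C x y" "y - y' \<in> C"
  shows "cone_disjoint C x y'"
  unfolding cone_disjoint_def
proof (intro allI impI)
  fix u assume u: "x - u \<in> C \<and> y' - u \<in> C"
  have "y - u \<in> C" using C[of "y - y'" "y' - u"] u assms(3) by simp
  then show "- u \<in> C" using u assms(2) by (simp add: cone_disjoint_def)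
qed

text \<open>Extreme points of \<open>K\<close> span extreme rays of the cone: splitting
  \<open>c (k, 1)\<close> into two cone elements writes \<open>k\<close> as a convex combination of
  two points of \<open>K\<close>, weighted by their heights.\<close>

lemma extreme_ray:
  assumes k: "k extreme_point_of K" and "c > 0"
    and M: "M \<in> homothety_cone K" "c *\<^sub>R (k, 1) - M \<in> homothety_cone K"
  shows "M = snd M *\<^sub>R (k, 1)"
proof -
  obtain \<nu> y where M': "M = (\<nu> *\<^sub>R y, \<nu>)" "\<nu> \<ge> 0" "y \<in> K"
    using M(1) by (auto simp: homothety_cone_def)
  obtain y' where y': "c *\<^sub>R k - \<nu> *\<^sub>R y = (c - \<nu>) *\<^sub>R y'" "\<nu> \<le> c" "y' \<in> K"
    using M(2) by (auto simp: homothety_cone_def M'(1))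
  have "c *\<^sub>R k = \<nu> *\<^sub>R y + (c - \<nu>) *\<^sub>R y'" using y'(1) by (simp add: algebra_simps)
  then have "(1 / c) *\<^sub>R (c *\<^sub>R k) = (1 / c) *\<^sub>R (\<nu> *\<^sub>R y + (c - \<nu>) *\<^sub>R y')" by simp
  then have keq: "k = (1 - \<nu> / c) *\<^sub>R y' + (\<nu> / c) *\<^sub>R y"
    using assms(2) by (simp add: scaleR_add_right diff_divide_distrib add.commute)
  show ?thesis
  proof (cases "\<nu> = 0 \<or> \<nu> = c")
    case True
    then show ?thesis using keq M'(1) assms(2) by auto
  next
    case False
    then have u: "0 < \<nu> / c" "\<nu> / c < 1" using M'(2) y'(2) assms(2) by auto
    have "y' = y"
    proof (rule ccontr)
      assume "y' \<noteq> y"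
      then have "k \<in> open_segment y' y"
        unfolding in_segment using keq u by blast
      then show False using k M'(3) y'(3) by (auto simp: extreme_point_of_def)
    qed
    then have "k = y" using keq by (simp add: algebra_simps)
    then show ?thesis using M'(1) by simp
  qed
qed

text \<open>If \<open>K \<inter> (K - y) / t\<close> is a homothet, it is the meet of two elements whose difference is a
  positive multiple of \<open>(k2, 1) - \<epsilon> (k1, 1)\<close>. Both \<open>(k1, 1)\<close> and \<open>(k2, 1)\<close> span extreme rays,
  so this meet must be trivial.\<close>

lemma extreme_points_cone_disjoint:
  fixes K :: "'a::euclidean_space set"
  assumes K: "compact K" "convex K" "interior K \<noteq> {}" and t: "0 < t" "t < 1"
    and H: "\<And>y. interior {z\<in>K. y + t *\<^sub>R z \<in> K} \<noteq> {} \<Longrightarrow>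
        \<exists>w \<mu>. \<mu> > 0 \<and> {z\<in>K. y + t *\<^sub>R z \<in> K} = (\<lambda>x. w + \<mu> *\<^sub>R x) ` K"
    and k: "k1 extreme_point_of K" "k2 extreme_point_of K" "k1 \<noteq> k2"
  shows "\<exists>\<epsilon>>0. cone_disjoint (homothety_cone K) (k2, 1) (\<epsilon> *\<^sub>R (k1, 1))"
proof -
  let ?C = "homothety_cone K"
  have kK: "k1 \<in> K" "k2 \<in> K" using k by (auto simp: extreme_point_of_def)
  \<comment> \<open>The homothets \<open>(K - y) / t\<close> and \<open>K\<close> have heights
    \<open>1 / t\<close> and \<open>1\<close>. If their difference is to be
    \<open>c ((k2, 1) - \<epsilon> (k1, 1))\<close>, the heights force
    \<open>c (1 - \<epsilon>) = 1 / t - 1\<close>, and the points then determine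
    \<open>y\<close>.\<close>
  define c where "c \<epsilon> = (1 - t) / (t * (1 - \<epsilon>))" for \<epsilon> :: real
  define y where "y \<epsilon> = (t * c \<epsilon>) *\<^sub>R (k2 - \<epsilon> *\<^sub>R k1)" for \<epsilon>
  obtain z0 where z0: "z0 \<in> interior K" using K(3) by blast
  have lim_c: "(c \<longlongrightarrow> (1 - t) / (t * (1 - 0))) (at_right 0)"
    unfolding c_def using t by (intro tendsto_intros) auto
  have "((\<lambda>\<epsilon>. y \<epsilon> + t *\<^sub>R z0) \<longlongrightarrow> (t * ((1 - t) / (t * (1 - 0)))) *\<^sub>R (k2 - 0 *\<^sub>R k1) + t *\<^sub>R z0) (at_right 0)"
    unfolding y_def by (intro tendsto_intros lim_c)
  also have "(t * ((1 - t) / (t * (1 - 0)))) *\<^sub>R (k2 - 0 *\<^sub>R k1) + t *\<^sub>R z0 = k2 - t *\<^sub>R (k2 - z0)"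
  proof -
    have "t * ((1 - t) / (t * (1 - 0))) = 1 - t" using t by simp
    then show ?thesis by (simp add: scaleR_diff_left scaleR_diff_right)
  qed
  finally have lim_y: "((\<lambda>\<epsilon>. y \<epsilon> + t *\<^sub>R z0) \<longlongrightarrow> k2 - t *\<^sub>R (k2 - z0)) (at_right 0)" .
  \<comment> \<open>The limit is \<open>(1 - t) k2 + t z0\<close>, an interior point. So for small
    \<open>\<epsilon>\<close> the intersection has nonempty interior and \<open>H\<close>
    applies.\<close>
  have "k2 - t *\<^sub>R (k2 - z0) \<in> interior K"
    using mem_interior_convex_shrink[OF K(2) z0 kK(2)] t by simp
  then have "eventually (\<lambda>\<epsilon>. y \<epsilon> + t *\<^sub>R z0 \<in> interior K) (at_right 0)"
    by (rule topological_tendstoD[OF lim_y open_interior])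
  moreover have "((\<lambda>\<epsilon>. c \<epsilon> * \<epsilon>) \<longlongrightarrow> (1 - t) / (t * (1 - 0)) * 0) (at_right 0)"
    by (intro tendsto_intros lim_c)
  then have "eventually (\<lambda>\<epsilon>. c \<epsilon> * \<epsilon> < 1) (at_right 0)"
    by (rule order_tendstoD(2)) simp
  moreover have "eventually (\<lambda>\<epsilon>. \<epsilon> \<in> {0<..<1::real}) (at_right 0)"
    by (rule eventually_at_right_real) simp
  ultimately have "eventually (\<lambda>\<epsilon>. y \<epsilon> + t *\<^sub>R z0 \<in> interior K \<and> c \<epsilon> * \<epsilon> < 1 \<and> \<epsilon> \<in> {0<..<1}) (at_right 0)"
    by (intro eventually_conj)
  then obtain \<epsilon> where \<epsilon>: "y \<epsilon> + t *\<^sub>R z0 \<in> interior K" "c \<epsilon> * \<epsilon> < 1" "0 < \<epsilon>" "\<epsilon> < 1"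
    using eventually_happens'[OF trivial_limit_at_right_real] by force
  define c' where "c' = c \<epsilon>"
  have c': "c' > 0" "c' * \<epsilon> < 1" using \<epsilon> t by (auto simp: c'_def c_def)
  define S where "S = {z\<in>K. y \<epsilon> + t *\<^sub>R z \<in> K}"
  have "z0 \<in> interior S"
  proof (rule interiorI)
    show "open (interior K \<inter> (\<lambda>z. y \<epsilon> + t *\<^sub>R z) -` interior K)"
      by (intro open_Int open_vimage continuous_intros) auto
    show "z0 \<in> interior K \<inter> (\<lambda>z. y \<epsilon> + t *\<^sub>R z) -` interior K" using z0 \<epsilon> by simp
    show "interior K \<inter> (\<lambda>z. y \<epsilon> + t *\<^sub>R z) -` interior K \<subseteq> S"
      unfolding S_def using interior_subset by blast
  qed
  then obtain w \<mu> where w: "\<mu> > 0" "S = (\<lambda>x. w + \<mu> *\<^sub>R x) ` K"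
    using H[of "y \<epsilon>"] unfolding S_def by blast
  \<comment> \<open>These stand for the intersection \<open>S\<close>, for
    \<open>(K - y \<epsilon>) / t\<close> and for \<open>K\<close>.\<close>
  define M P Q where "M = (- w, \<mu>)" "P = ((1 / t) *\<^sub>R y \<epsilon>, 1 / t)" "Q = (0::'a, 1::real)"
  define e1 e2 where "e1 = (k1, 1::real)" "e2 = (k2, 1::real)"
  have snd: "snd M > 0" "snd P > 0" "snd Q > 0" using w t by (auto simp: M_P_Q_def)
  have PQ: "P = Q + c' *\<^sub>R (e2 - \<epsilon> *\<^sub>R e1)"
    using t \<epsilon> by (simp add: M_P_Q_def e1_e2_def y_def c'_def) (simp add: c_def field_simps)
  have hM: "homothet K M = homothet K P \<inter> homothet K Q"
  proof -
    have "homothet K M = S" unfolding w(2) by (auto simp: homothet_def M_P_Q_def add.commute)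
    moreover have "z \<in> homothet K P \<longleftrightarrow> y \<epsilon> + t *\<^sub>R z \<in> K" for z
    proof
      assume "z \<in> homothet K P"
      then obtain x where "x \<in> K" "z = (1 / t) *\<^sub>R x - (1 / t) *\<^sub>R y \<epsilon>"
        by (auto simp: homothet_def M_P_Q_def)
      then show "y \<epsilon> + t *\<^sub>R z \<in> K" using t by (simp add: scaleR_diff_right)
    next
      assume *: "y \<epsilon> + t *\<^sub>R z \<in> K"
      have "z = (1 / t) *\<^sub>R (y \<epsilon> + t *\<^sub>R z) - (1 / t) *\<^sub>R y \<epsilon>" using t by (simp add: scaleR_add_right)
      then show "z \<in> homothet K P" using * by (auto simp: homothet_def M_P_Q_def intro: image_eqI)
    qed
    moreover have "homothet K Q = K" by (auto simp: homothet_def M_P_Q_def)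
    ultimately show ?thesis by (auto simp: S_def)
  qed
  have add: "p \<in> ?C \<Longrightarrow> q \<in> ?C \<Longrightarrow> p + q \<in> ?C" for p q
    using K(2) by (rule homothety_cone_add)
  have zero: "0 \<in> ?C" using kK homothety_cone_scale[OF homothety_cone_point, of k1 K 0] by (simp add: zero_prod_def)
  have e: "e1 \<in> ?C" "e2 \<in> ?C" using kK by (auto simp: e1_e2_def homothety_cone_point)
  have MP: "P - M \<in> ?C" and MQ: "Q - M \<in> ?C"
    using homothet_subset_imp[OF K snd(1)] snd hM by auto
  \<comment> \<open>A lower bound \<open>N\<close> may have height at most \<open>0\<close> and then
    represents no proper homothet. Mixing a small share \<open>s\<close> of \<open>N\<close> into
    \<open>M\<close> keeps the height positive; the factor \<open>s\<close> is divided out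
    afterwards.\<close>
  have greatest: "M - N \<in> ?C" if N: "P - N \<in> ?C" "Q - N \<in> ?C" for N
  proof -
    define s where "s = snd M / (snd M + \<bar>snd N\<bar> + 1)"
    have s: "0 < s" "s < 1" using snd(1) by (auto simp: s_def field_simps)
    have pos: "snd ((1 - s) *\<^sub>R M + s *\<^sub>R N) > 0"
    proof -
      have "(1 - s) * snd M + s * snd N = snd M * (1 + \<bar>snd N\<bar> + snd N) / (snd M + \<bar>snd N\<bar> + 1)"
      proof -
        have "1 - s = (1 + \<bar>snd N\<bar>) / (snd M + \<bar>snd N\<bar> + 1)"
          using snd(1) by (simp add: s_def field_simps)
        then have "(1 - s) * snd M + s * snd N =
            ((1 + \<bar>snd N\<bar>) * snd M + snd M * snd N) / (snd M + \<bar>snd N\<bar> + 1)"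
          unfolding \<open>1 - s = _\<close> by (simp add: s_def add_divide_distrib distrib_right)
        then show ?thesis by (simp add: distrib_left distrib_right mult.commute)
      qed
      also have "\<dots> > 0"
        using snd(1) by (intro divide_pos_pos mult_pos_pos) auto
      finally show ?thesis by simp
    qed
    have le: "X - ((1 - s) *\<^sub>R M + s *\<^sub>R N) \<in> ?C" if "X - M \<in> ?C" "X - N \<in> ?C" for X
    proof -
      have "(1 - s) *\<^sub>R (X - M) + s *\<^sub>R (X - N) \<in> ?C"
        using s that by (intro add homothety_cone_scale) auto
      then show ?thesis by (simp add: algebra_simps)
    qed
    have "homothet K ((1 - s) *\<^sub>R M + s *\<^sub>R N) \<subseteq> homothet K M"
      unfolding hM using homothet_mono[OF K(2) less_imp_le[OF pos]] le MP MQ N by blast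
    then have "M - ((1 - s) *\<^sub>R M + s *\<^sub>R N) \<in> ?C"
      by (rule homothet_subset_imp[OF K pos snd(1)])
    moreover have "M - ((1 - s) *\<^sub>R M + s *\<^sub>R N) = s *\<^sub>R (M - N)" by (simp add: algebra_simps)
    ultimately have "(1 / s) *\<^sub>R (s *\<^sub>R (M - N)) \<in> ?C"
      using s by (metis divide_nonneg_pos homothety_cone_scale zero_le_one)
    then show ?thesis using s by simp
  qed
  \<comment> \<open>Shifting by \<open>(c' * \<epsilon>) e1 - Q\<close> turns the meet
    \<open>M\<close> of \<open>P\<close> and \<open>Q\<close> into the meet \<open>M'\<close> of
    \<open>c' e2\<close> and \<open>(c' * \<epsilon>) e1\<close>. It lies on two different extreme
    rays, hence is \<open>0\<close>.\<close>
  define M' where "M' = M - Q + (c' * \<epsilon>) *\<^sub>R e1"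
  have "M - (Q - (c' * \<epsilon>) *\<^sub>R e1) \<in> ?C"
  proof (rule greatest)
    show "P - (Q - (c' * \<epsilon>) *\<^sub>R e1) \<in> ?C"
      using homothety_cone_scale[OF e(2), of c'] c' by (simp add: PQ algebra_simps)
    show "Q - (Q - (c' * \<epsilon>) *\<^sub>R e1) \<in> ?C"
      using homothety_cone_scale[OF e(1), of "c' * \<epsilon>"] c' \<epsilon> by simp
  qed
  then have M'0: "M' \<in> ?C" by (simp add: M'_def algebra_simps)
  have "M' = snd M' *\<^sub>R (k2, 1)"
  proof (rule extreme_ray[OF k(2) c'(1) M'0])
    have "c' *\<^sub>R e2 - M' = P - M" by (simp add: M'_def PQ algebra_simps)
    then show "c' *\<^sub>R (k2, 1) - M' \<in> ?C" using MP by (simp only: e1_e2_def)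
  qed
  moreover have "M' = snd M' *\<^sub>R (k1, 1)"
  proof (rule extreme_ray[OF k(1) _ M'0])
    show "c' * \<epsilon> > 0" using c'(1) \<epsilon> by simp
    have "(c' * \<epsilon>) *\<^sub>R e1 - M' = Q - M" by (simp add: M'_def algebra_simps)
    then show "(c' * \<epsilon>) *\<^sub>R (k1, 1) - M' \<in> ?C" using MQ by (simp only: e1_e2_def)
  qed
  ultimately have "snd M' *\<^sub>R k2 = snd M' *\<^sub>R k1" "M' = (snd M' *\<^sub>R k1, snd M')"
    by (metis fst_conv fst_scaleR, simp)
  then have "M' = 0" using k(3) by (auto simp: zero_prod_def)
  then have M_eq: "M = Q - (c' * \<epsilon>) *\<^sub>R e1" by (simp add: M'_def algebra_simps)
  have "cone_disjoint ?C (c' *\<^sub>R e2) ((c' * \<epsilon>) *\<^sub>R e1)"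
    unfolding cone_disjoint_def
  proof (intro allI impI)
    fix u assume u: "c' *\<^sub>R e2 - u \<in> ?C \<and> (c' * \<epsilon>) *\<^sub>R e1 - u \<in> ?C"
    have "M - (M + u) \<in> ?C"
    proof (rule greatest)
      show "P - (M + u) \<in> ?C" using u by (simp add: PQ M_eq algebra_simps)
      show "Q - (M + u) \<in> ?C" using u by (simp add: M_eq algebra_simps)
    qed
    then show "- u \<in> ?C" by simp
  qed
  then have "cone_disjoint ?C ((1 / c') *\<^sub>R c' *\<^sub>R e2) ((1 / c') *\<^sub>R (c' * \<epsilon>) *\<^sub>R e1)"
    using c' by (intro cone_disjoint_scale homothety_cone_scale) auto
  then show ?thesis using c' \<epsilon> by (auto simp: e1_e2_def)
qed

text \<open>An affine dependence of extreme points balances two positive combinations of rays. A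
  small multiple of a ray \<open>e k\<close> from one side is disjoint from each term of the other
  side, hence from their sum, yet it lies below that sum: a contradiction.\<close>

theorem simplex_of_homothetic_intersections:
  fixes K :: "'a::euclidean_space set"
  assumes K: "compact K" "convex K" "interior K \<noteq> {}" and t: "0 < t" "t < 1"
    and H: "\<And>y. interior {z\<in>K. y + t *\<^sub>R z \<in> K} \<noteq> {} \<Longrightarrow>
        \<exists>w \<mu>. \<mu> > 0 \<and> {z\<in>K. y + t *\<^sub>R z \<in> K} = (\<lambda>x. w + \<mu> *\<^sub>R x) ` K"
  shows "\<exists>d. d simplex K"
proof -
  let ?C = "homothety_cone K"
  define X where "X = {x. x extreme_point_of K}"
  have Kne: "K \<noteq> {}" using K(3) by auto
  have XK: "X \<subseteq> K" by (auto simp: X_def extreme_point_of_def)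
  have add: "p \<in> ?C \<Longrightarrow> q \<in> ?C \<Longrightarrow> p + q \<in> ?C" for p q
    using K(2) by (rule homothety_cone_add)
  have zero: "0 \<in> ?C" using homothety_cone_sum[OF K(2) Kne, of "{}" "\<lambda>_. 0"] by simp
  define e where "e x = (x, 1::real)" for x :: 'a
  have e: "e x \<in> ?C" if "x \<in> X" for x
    using that XK by (auto simp: e_def homothety_cone_point)
  have "\<not> affine_dependent X"
  proof
    assume "affine_dependent X"
    then obtain S u where S: "finite S" "S \<subseteq> X" "sum u S = 0" "\<exists>v\<in>S. u v \<noteq> 0" "(\<Sum>v\<in>S. u v *\<^sub>R v) = 0"
      unfolding affine_dependent_explicit by blast
    have "\<exists>v\<in>S. u v > 0"
    proof (rule ccontr)
      assume "\<not> (\<exists>v\<in>S. u v > 0)"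
      then have "sum (\<lambda>v. - u v) S = 0 \<longleftrightarrow> (\<forall>v\<in>S. - u v = 0)"
        using S(1) by (intro sum_nonneg_eq_0_iff) auto
      then show False using S(3,4) by (simp add: sum_negf)
    qed
    then obtain k where k: "k \<in> S" "u k > 0" by blast
    define Pos Neg where "Pos = {v\<in>S. u v > 0}" "Neg = {v\<in>S. u v < 0}"
    have fin: "finite Pos" "finite Neg" using S(1) by (auto simp: Pos_Neg_def)
    have bal: "(\<Sum>v\<in>Pos. u v *\<^sub>R e v) = (\<Sum>v\<in>Neg. (- u v) *\<^sub>R e v)"
    proof -
      have "0 = (\<Sum>v\<in>S. u v *\<^sub>R e v)"
        using S(3,5) by (simp add: e_def sum_prod zero_prod_def)
      also have "\<dots> = (\<Sum>v\<in>Pos \<union> Neg. u v *\<^sub>R e v)"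
        using S(1) by (intro sum.mono_neutral_right) (auto simp: Pos_Neg_def)
      also have "\<dots> = (\<Sum>v\<in>Pos. u v *\<^sub>R e v) + (\<Sum>v\<in>Neg. u v *\<^sub>R e v)"
        using fin by (intro sum.union_disjoint) (auto simp: Pos_Neg_def)
      finally show ?thesis by (simp add: sum_negf eq_neg_iff_add_eq_0)
    qed
    have "\<exists>\<epsilon>>0. cone_disjoint ?C (e v) (\<epsilon> *\<^sub>R e k)" if "v \<in> Neg" for v
      unfolding e_def using that k S(2)
      by (intro extreme_points_cone_disjoint[OF K t H]) (auto simp: Pos_Neg_def X_def)
    then obtain \<epsilon> where \<epsilon>: "\<And>v. v \<in> Neg \<Longrightarrow> \<epsilon> v > 0 \<and> cone_disjoint ?C (e v) (\<epsilon> v *\<^sub>R e k)"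
      by metis
    \<comment> \<open>At most \<open>u k\<close>, so that \<open>\<eta> e k\<close> lies below the
      positive side; at most \<open>(- u v) * \<epsilon> v\<close>, so that it inherits disjointness
      from the scaled statement for each \<open>v\<close>.\<close>
    define \<eta> where "\<eta> = Min (insert (u k) ((\<lambda>v. (- u v) * \<epsilon> v) ` Neg))"
    have \<eta>: "\<eta> > 0" "\<eta> \<le> u k" "\<And>v. v \<in> Neg \<Longrightarrow> \<eta> \<le> (- u v) * \<epsilon> v"
      unfolding \<eta>_def using fin k \<epsilon> by (auto simp: Pos_Neg_def mult_neg_pos)
    have "cone_disjoint ?C (\<Sum>v\<in>Neg. (- u v) *\<^sub>R e v) (\<eta> *\<^sub>R e k)"
    proof (rule cone_disjoint_sum[OF add zero fin(2)])
      fix v assume v: "v \<in> Neg"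
      then have uv: "- u v > 0" "v \<in> X" using S(2) by (auto simp: Pos_Neg_def)
      show "(- u v) *\<^sub>R e v \<in> ?C" using uv e by (intro homothety_cone_scale) auto
      have "cone_disjoint ?C ((- u v) *\<^sub>R e v) ((- u v) *\<^sub>R \<epsilon> v *\<^sub>R e k)"
        using uv \<epsilon>[OF v] by (intro cone_disjoint_scale homothety_cone_scale) auto
      moreover have "(- u v) *\<^sub>R \<epsilon> v *\<^sub>R e k - \<eta> *\<^sub>R e k = ((- u v) * \<epsilon> v - \<eta>) *\<^sub>R e k"
        by (simp add: scaleR_diff_left)
      moreover have "((- u v) * \<epsilon> v - \<eta>) *\<^sub>R e k \<in> ?C"
        using \<eta>(3)[OF v] k S(2) by (intro homothety_cone_scale e) auto
      ultimately show "cone_disjoint ?C ((- u v) *\<^sub>R e v) (\<eta> *\<^sub>R e k)"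
        using cone_disjoint_mono[OF add] by metis
    qed
    moreover have "(\<Sum>v\<in>Pos. u v *\<^sub>R e v) - \<eta> *\<^sub>R e k \<in> ?C"
    proof -
      have "(\<Sum>v\<in>Pos. u v *\<^sub>R e v) - \<eta> *\<^sub>R e k = (u k - \<eta>) *\<^sub>R e k + (\<Sum>v\<in>Pos - {k}. u v *\<^sub>R e v)"
        using sum.remove[of Pos k "\<lambda>v. u v *\<^sub>R e v"] fin(1) k
        by (simp add: Pos_Neg_def scaleR_diff_left)
      moreover have "(u k - \<eta>) *\<^sub>R e k \<in> ?C"
        using \<eta>(2) k S(2) by (intro homothety_cone_scale e) auto
      moreover have "(\<Sum>v\<in>Pos - {k}. u v *\<^sub>R e v) \<in> ?C"
        using S(2) by (intro homothety_cone_sum[OF K(2) Kne] homothety_cone_scale e) (auto simp: Pos_Neg_def)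
      ultimately show ?thesis using add by simp
    qed
    ultimately have "- (\<eta> *\<^sub>R e k) \<in> ?C"
      using zero unfolding cone_disjoint_def bal by (metis diff_self)
    then show False using \<eta>(1) by (auto simp: homothety_cone_def e_def)
  qed
  moreover have "K = convex hull X"
    unfolding X_def by (rule Krein_Milman_Minkowski[OF K(1,2)])
  ultimately show ?thesis
    unfolding simplex_def by (intro exI[of _ "int (card X) - 1"] exI[of _ X]) auto
qed

section \<open>Fibers and slabs\<close>

lemma emeasure_compact_eq_measure:
  fixes S :: "'a::euclidean_space set"
  assumes "compact S"
  shows "emeasure lborel S = ennreal (measure lebesgue S)"
  using emeasure_compact_finite[OF assms] borel_compact[OF assms]
  by (simp add: emeasure_eq_ennreal_measure less_top)

lemma linear_diag: "linear (diag :: real ^ 'n \<Rightarrow> real ^ 'n ^ 'p)"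
  by (rule linearI) (simp_all add: diag_def vec_eq_iff)

lemma diag_nth [simp]: "diag x $ i = x"
  by (simp add: diag_def)

text \<open>\<open>fiber K t x\<close> is the intersection of \<open>K\<close> with the bodies \<open>(K - x i) / t\<close>, and \<open>slab K t r\<close>
  is \<open>(1 - t + t r) K^p - t r \<Delta> K\<close>.\<close>

definition fiber :: "(real ^ 'n) set \<Rightarrow> real \<Rightarrow> real ^ 'n ^ 'p \<Rightarrow> (real ^ 'n) set" where
  "fiber K t x = {z\<in>K. x + t *\<^sub>R diag z \<in> set_power K}"

definition slab :: "(real ^ 'n) set \<Rightarrow> real \<Rightarrow> real \<Rightarrow> (real ^ 'n ^ 'p) set" where
  "slab K t r = (\<lambda>x. (t * r) *\<^sub>R x) ` (\<lambda>x. - diag x) ` K + (\<lambda>x. (1 - t + t * r) *\<^sub>R x) ` set_power K"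

lemma slab_iff:
  "x \<in> slab K t r \<longleftrightarrow> (\<exists>y\<in>set_power K. \<exists>z\<in>K. x = (1 - t + t * r) *\<^sub>R y - (t * r) *\<^sub>R diag z)"
proof
  assume "x \<in> slab K t r"
  then obtain y z where "y \<in> set_power K" "z \<in> K" "x = (t * r) *\<^sub>R (- diag z) + (1 - t + t * r) *\<^sub>R y"
    unfolding slab_def by (auto elim!: set_plus_elim)
  then show "\<exists>y\<in>set_power K. \<exists>z\<in>K. x = (1 - t + t * r) *\<^sub>R y - (t * r) *\<^sub>R diag z" by force
next
  assume "\<exists>y\<in>set_power K. \<exists>z\<in>K. x = (1 - t + t * r) *\<^sub>R y - (t * r) *\<^sub>R diag z"
  then obtain y z where *: "y \<in> set_power K" "z \<in> K" "x = (t * r) *\<^sub>R (- diag z) + (1 - t + t * r) *\<^sub>R y"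
    by auto
  then show "x \<in> slab K t r"
    unfolding slab_def *(3) by (intro set_plus_intro imageI)
qed

lemma continuous_on_diag [continuous_intros]:
  "continuous_on S f \<Longrightarrow> continuous_on S (\<lambda>x. diag (f x) :: real ^ 'n ^ 'p)"
  unfolding diag_def by (intro continuous_intros)

lemma compact_slab_graph:
  fixes K :: "(real ^ 'n) set"
  assumes "compact K"
  shows "compact {(r, x :: real ^ 'n ^ 'p). r \<in> {0..1} \<and> x \<in> slab K t r}"
proof -
  have "{(r, x :: real ^ 'n ^ 'p). r \<in> {0..1} \<and> x \<in> slab K t r} =
    (\<lambda>(r, y, z). (r, (1 - t + t * r) *\<^sub>R y - (t * r) *\<^sub>R diag z)) ` ({0..1} \<times> set_power K \<times> K)"
    by (force simp: slab_iff image_iff)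
  also have "compact \<dots>"
    using assms compact_set_power[OF assms, where 'p = 'p]
    by (intro compact_continuous_image compact_Times)
      (auto intro!: continuous_intros simp: case_prod_unfold)
  finally show ?thesis .
qed

lemma compact_fiber:
  fixes K :: "(real ^ 'n) set"
  assumes "compact K"
  shows "compact (fiber K t (x :: real ^ 'n ^ 'p))"
proof -
  have "fiber K t x = K \<inter> (\<lambda>z. x + t *\<^sub>R diag z) -` set_power K"
    by (auto simp: fiber_def)
  also have "compact \<dots>"
    using assms compact_set_power[OF assms, where 'p = 'p]
    by (intro compact_Int_closed closed_vimage compact_imp_closed) (auto intro!: continuous_intros)
  finally show ?thesis .
qed

lemma convex_fiber:
  assumes "convex K"
  shows "convex (fiber K t x)"
proof (rule convexI)
  fix z w and u v :: real assume zw: "z \<in> fiber K t x" "w \<in> fiber K t x" and uv: "0 \<le> u" "0 \<le> v" "u + v = 1"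
  have "x $ i + t *\<^sub>R (u *\<^sub>R z + v *\<^sub>R w) = u *\<^sub>R (x $ i + t *\<^sub>R z) + v *\<^sub>R (x $ i + t *\<^sub>R w)" for i
  proof -
    have "x $ i = u *\<^sub>R x $ i + v *\<^sub>R x $ i" using uv(3) by (metis scaleR_add_left scaleR_one)
    then show ?thesis by (simp add: scaleR_add_right algebra_simps)
  qed
  then show "u *\<^sub>R z + v *\<^sub>R w \<in> fiber K t x"
    using zw uv assms by (auto simp: fiber_def set_power_def intro!: convexD)
qed

text \<open>The term \<open>- t r \<Delta> z0\<close> in \<open>x\<close> cancels
  \<open>t r z0\<close>. What is left in each coordinate is a convex combination of
  \<open>y $ i\<close> and \<open>w\<close>, with weight \<open>t (1 - r)\<close> on
  \<open>w\<close>.\<close>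

lemma homothet_subset_fiber:
  fixes x :: "real ^ 'n ^ 'p"
  assumes K: "convex K" and t: "0 \<le> t" "t \<le> 1" and r: "0 \<le> r" "r \<le> 1"
    and y: "y \<in> set_power K" and z0: "z0 \<in> K" and x: "x = (1 - t + t * r) *\<^sub>R y - (t * r) *\<^sub>R diag z0"
  shows "(\<lambda>w. (1 - r) *\<^sub>R w + r *\<^sub>R z0) ` K \<subseteq> fiber K t x"
proof (intro image_subsetI)
  fix w assume w: "w \<in> K"
  have "x $ i + t *\<^sub>R ((1 - r) *\<^sub>R w + r *\<^sub>R z0) = (1 - t * (1 - r)) *\<^sub>R (y $ i) + (t * (1 - r)) *\<^sub>R w" for i
    by (simp add: x algebra_simps)
  moreover have "0 \<le> t * (1 - r)" "t * (1 - r) \<le> 1"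
    using t r by (auto intro: mult_le_one)
  then have "(1 - t * (1 - r)) *\<^sub>R (y $ i) + (t * (1 - r)) *\<^sub>R w \<in> K" for i
    using K y w by (intro convexD) (auto simp: set_power_def)
  moreover have "(1 - r) *\<^sub>R w + r *\<^sub>R z0 \<in> K"
    using K w z0 r by (intro convexD) auto
  ultimately show "(1 - r) *\<^sub>R w + r *\<^sub>R z0 \<in> fiber K t x"
    by (simp add: fiber_def set_power_def)
qed

section \<open>Integrals of fiber volumes and slab volumes\<close>

lemma emeasure_fiber_eq:
  fixes K :: "(real ^ 'n) set"
  assumes "compact K"
  shows "emeasure lborel (fiber K t (x :: real ^ 'n ^ 'p)) =
    (\<integral>\<^sup>+z. indicator K z * indicator (set_power K) (x + t *\<^sub>R diag z) \<partial>lborel)"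
proof -
  have "emeasure lborel (fiber K t x) = (\<integral>\<^sup>+z. indicator (fiber K t x) z \<partial>lborel)"
    using borel_compact[OF compact_fiber[OF assms, of t x]] by simp
  also have "\<dots> = (\<integral>\<^sup>+z. indicator K z * indicator (set_power K) (x + t *\<^sub>R diag z) \<partial>lborel)"
    by (intro nn_integral_cong) (auto simp: fiber_def indicator_def)
  finally show ?thesis .
qed

text \<open>For fixed \<open>z\<close> in \<open>K\<close>, the points \<open>x\<close> whose fiber
  contains \<open>z\<close> form a translate of \<open>set_power K\<close>; therefore the value is
  the same for all \<open>t\<close>.\<close>

lemma
  fixes K :: "(real ^ 'n) set"
  assumes K: "compact K"
  shows borel_measurable_emeasure_fiber:
      "(\<lambda>x :: real ^ 'n ^ 'p. emeasure lborel (fiber K t x)) \<in> borel_measurable lborel"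
    and nn_integral_emeasure_fiber:
      "(\<integral>\<^sup>+x. emeasure lborel (fiber K t (x :: real ^ 'n ^ 'p)) \<partial>lborel) =
        emeasure lborel K * emeasure lborel K ^ CARD('p)"
proof -
  let ?P = "set_power K :: (real ^ 'n ^ 'p) set"
  have [measurable]: "K \<in> sets borel" "?P \<in> sets borel"
    using K compact_set_power[OF K] by (auto intro: borel_compact)
  have [measurable]: "(diag :: real ^ 'n \<Rightarrow> real ^ 'n ^ 'p) \<in> borel_measurable borel"
    by (rule linear_measurable_borel[OF linear_diag])
  show "(\<lambda>x :: real ^ 'n ^ 'p. emeasure lborel (fiber K t x)) \<in> borel_measurable lborel"
    unfolding emeasure_fiber_eq[OF K] by measurable
  have "(\<integral>\<^sup>+x. emeasure lborel (fiber K t (x :: real ^ 'n ^ 'p)) \<partial>lborel) =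
      (\<integral>\<^sup>+z. (\<integral>\<^sup>+x. indicator K z * indicator ?P (x + t *\<^sub>R diag z) \<partial>lborel) \<partial>lborel)"
    unfolding emeasure_fiber_eq[OF K] by (rule lborel_pair.Fubini') measurable
  also have "\<dots> = (\<integral>\<^sup>+z. indicator K z * emeasure lborel ?P \<partial>lborel)"
  proof (rule nn_integral_cong)
    fix z
    have "(\<integral>\<^sup>+x. indicator ?P (t *\<^sub>R diag z + x) \<partial>lborel) = (\<integral>\<^sup>+x. indicator ?P x \<partial>lborel)"
      by (rule nn_integral_lborel_translation) measurable
    then show "(\<integral>\<^sup>+x. indicator K z * indicator ?P (x + t *\<^sub>R diag z) \<partial>lborel) = indicator K z * emeasure lborel ?P"
      by (subst nn_integral_cmult) (auto simp: add.commute)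
  qed
  also have "\<dots> = emeasure lborel K * emeasure lborel ?P"
    by (simp add: nn_integral_multc)
  finally show "(\<integral>\<^sup>+x. emeasure lborel (fiber K t (x :: real ^ 'n ^ 'p)) \<partial>lborel) =
        emeasure lborel K * emeasure lborel K ^ CARD('p)"
    by (simp add: emeasure_set_power[OF K])
qed

lemma has_integral_mixed_volumes:
  fixes K :: "(real ^ 'n) set"
  assumes K: "convex_body K" and t: "0 \<le> t" "t \<le> 1"
  shows "((\<lambda>r. real CARD('n) * (1 - r) ^ (CARD('n) - 1) * measure lebesgue (slab K t r :: (real ^ 'n ^ 'p) set))
    has_integral (\<Sum>j = 0..CARD('n). coeff_c CARD('n) CARD('p) j t
             * mixed_volume
                 (replicate j ((\<lambda>x. - diag x) ` K :: (real ^ 'n ^ 'p) set)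
                  @ replicate (CARD('n) * CARD('p) - j) (set_power K)))) {0..1}"
proof -
  let ?n = "CARD('n)" and ?p = "CARD('p)"
  define mv where "mv j = mixed_volume (replicate j ((\<lambda>x. - diag x) ` K :: (real ^ 'n ^ 'p) set)
                  @ replicate (?n * ?p - j) (set_power K))" for j
  have dim: "DIM(real ^ 'n ^ 'p) = ?n * ?p" by simp
  have lin: "linear (\<lambda>x :: real ^ 'n. - diag x :: real ^ 'n ^ 'p)"
    using linear_compose_neg[OF linear_diag] by simp
  have nK: "convex_body ((\<lambda>x. - diag x) ` K :: (real ^ 'n ^ 'p) set)"
    using K lin by (auto simp: convex_body_def linear_conv_bounded_linear
        intro!: convex_linear_image compact_continuous_image linear_continuous_on)
  have pK: "convex_body (set_power K :: (real ^ 'n ^ 'p) set)"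
    using K by (rule convex_body_set_power)
  obtain C where C: "\<And>s r. s \<ge> 0 \<Longrightarrow> r \<ge> 0 \<Longrightarrow>
      measure lebesgue ((\<lambda>x. s *\<^sub>R x) ` (\<lambda>x. - diag x) ` K + (\<lambda>x. r *\<^sub>R x) ` (set_power K :: (real ^ 'n ^ 'p) set))
        = (\<Sum>j\<le>?n. C j * s ^ j * r ^ (?n * ?p - j))"
    using minkowski_volume_polynomial[OF K pK lin] unfolding dim by auto
  have le: "?n \<le> ?n * ?p" by simp
  have Cj: "C j = real ((?n * ?p) choose j) * mv j" if "j \<le> ?n" for j
    unfolding mv_def by (rule mixed_volume_two_bodies[OF nK pK C that le])
  have "((\<lambda>r. \<Sum>j = 0..?n. (real ?n * (1 - r) ^ (?n - 1) *
      (real ((?n * ?p) choose j) * (t * r) ^ j * (1 - t + t * r) ^ (?n * ?p - j))) * mv j)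
    has_integral (\<Sum>j = 0..?n. coeff_c ?n ?p j t * mv j)) {0..1}"
    by (intro has_integral_sum has_integral_mult_left coeff_c_has_integral order_trans[OF _ le])
      (auto simp: Suc_le_eq)
  moreover have "(\<Sum>j = 0..?n. (real ?n * (1 - r) ^ (?n - 1) *
      (real ((?n * ?p) choose j) * (t * r) ^ j * (1 - t + t * r) ^ (?n * ?p - j))) * mv j)
      = real ?n * (1 - r) ^ (?n - 1) * measure lebesgue (slab K t r :: (real ^ 'n ^ 'p) set)"
    if "r \<in> {0..1}" for r
  proof -
    have "measure lebesgue (slab K t r :: (real ^ 'n ^ 'p) set) =
        (\<Sum>j\<le>?n. C j * (t * r) ^ j * (1 - t + t * r) ^ (?n * ?p - j))"
      unfolding slab_def using that t by (intro C) auto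
    also have "\<dots> = (\<Sum>j = 0..?n. real ((?n * ?p) choose j) * mv j * (t * r) ^ j * (1 - t + t * r) ^ (?n * ?p - j))"
      using Cj by (intro sum.cong) auto
    finally show ?thesis by (simp add: sum_distrib_left mult_ac)
  qed
  ultimately show ?thesis
    unfolding mv_def by (rule has_integral_eq[rotated])
qed

lemma nn_integral_beta_tail:
  assumes "n \<ge> 1" "0 \<le> \<rho>" "\<rho> \<le> 1"
  shows "(\<integral>\<^sup>+r. indicator {\<rho>..1} r * ennreal (real n * (1 - r) ^ (n - 1)) \<partial>lborel) = ennreal ((1 - \<rho>) ^ n)"
proof -
  have "((\<lambda>r::real. real n * (1 - r) ^ (n - 1)) has_integral (- ((1 - 1) ^ n) - (- ((1 - \<rho>) ^ n)))) {\<rho>..1}"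
    using assms by (intro fundamental_theorem_of_calculus)
      (auto intro!: derivative_eq_intros simp: has_real_derivative_iff_has_vector_derivative[symmetric])
  then have "((\<lambda>r::real. real n * (1 - r) ^ (n - 1)) has_integral (1 - \<rho>) ^ n) {\<rho>..1}"
    using assms by (simp add: power_0_left)
  from nn_integral_has_integral_lebesgue[OF _ this]
  have "(\<integral>\<^sup>+r. ennreal (indicator {\<rho>..1} r * (real n * (1 - r) ^ (n - 1))) \<partial>lborel) = ennreal ((1 - \<rho>) ^ n)"
    using assms by simp
  moreover have "ennreal (indicator {\<rho>..1} r * (real n * (1 - r) ^ (n - 1))) =
      indicator {\<rho>..1} r * ennreal (real n * (1 - r) ^ (n - 1))" for r
    by (cases "r \<in> {\<rho>..1}") simp_all
  ultimately show ?thesis by (simp only:)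
qed

text \<open>Exchanging integrals turns the weighted integral of the slab volumes into the integral
  of this function of \<open>x\<close>, to be compared pointwise with the fiber volume. The
  indicator is that of the graph in \<open>(r, x)\<close>, whose compactness gives joint
  measurability.\<close>

definition slab_weight :: "(real ^ 'n) set \<Rightarrow> real \<Rightarrow> real ^ 'n ^ 'p \<Rightarrow> ennreal" where
  "slab_weight K t x = (\<integral>\<^sup>+r. ennreal (real CARD('n) * (1 - r) ^ (CARD('n) - 1)) *
    indicator {(r, x). r \<in> {0..1} \<and> x \<in> slab K t r} (r, x) \<partial>lborel)"

lemma
  fixes K :: "(real ^ 'n) set"
  assumes K: "convex_body K" and t: "0 \<le> t" "t \<le> 1"
  shows borel_measurable_slab_weight:
      "(\<lambda>x :: real ^ 'n ^ 'p. slab_weight K t x) \<in> borel_measurable lborel"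
    and nn_integral_slab_weight:
      "(\<integral>\<^sup>+x. slab_weight K t (x :: real ^ 'n ^ 'p) \<partial>lborel) =
        ennreal (\<Sum>j = 0..CARD('n). coeff_c CARD('n) CARD('p) j t
             * mixed_volume
                 (replicate j ((\<lambda>x. - diag x) ` K :: (real ^ 'n ^ 'p) set)
                  @ replicate (CARD('n) * CARD('p) - j) (set_power K)))" (is "_ = ennreal ?I")
proof -
  let ?n = "CARD('n)"
  have cK: "compact K" using K by (simp add: convex_body_def)
  define \<Gamma> where "\<Gamma> = {(r, x :: real ^ 'n ^ 'p). r \<in> {0..1} \<and> x \<in> slab K t r}"
  have [measurable]: "\<Gamma> \<in> sets borel"
    unfolding \<Gamma>_def by (rule borel_compact[OF compact_slab_graph[OF cK]])
  show "(\<lambda>x :: real ^ 'n ^ 'p. slab_weight K t x) \<in> borel_measurable lborel"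
    unfolding slab_weight_def \<Gamma>_def[symmetric] by measurable
  have comp: "compact (slab K t r :: (real ^ 'n ^ 'p) set)" for r
  proof -
    have "compact ((\<lambda>x. - diag x) ` K :: (real ^ 'n ^ 'p) set)"
      using cK by (intro compact_continuous_image continuous_intros)
    then show ?thesis
      unfolding slab_def using compact_set_power[OF cK]
      by (intro compact_set_plus compact_scaling) auto
  qed
  have "(\<integral>\<^sup>+x. slab_weight K t (x :: real ^ 'n ^ 'p) \<partial>lborel) =
      (\<integral>\<^sup>+r. (\<integral>\<^sup>+x. ennreal (real ?n * (1 - r) ^ (?n - 1)) * indicator \<Gamma> (r, x) \<partial>lborel) \<partial>lborel)"
    unfolding slab_weight_def \<Gamma>_def[symmetric] by (rule lborel_pair.Fubini') measurable
  also have "\<dots> = (\<integral>\<^sup>+r. ennreal (indicator {0..1} r *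
      (real ?n * (1 - r) ^ (?n - 1) * measure lebesgue (slab K t r :: (real ^ 'n ^ 'p) set))) \<partial>lborel)"
  proof (rule nn_integral_cong)
    fix r :: real
    show "(\<integral>\<^sup>+x. ennreal (real ?n * (1 - r) ^ (?n - 1)) * indicator \<Gamma> (r, x) \<partial>lborel) =
      ennreal (indicator {0..1} r *
      (real ?n * (1 - r) ^ (?n - 1) * measure lebesgue (slab K t r :: (real ^ 'n ^ 'p) set)))"
    proof (cases "r \<in> {0..1}")
      case True
      then have "(\<integral>\<^sup>+x. ennreal (real ?n * (1 - r) ^ (?n - 1)) * indicator \<Gamma> (r, x) \<partial>lborel)
          = (\<integral>\<^sup>+x. ennreal (real ?n * (1 - r) ^ (?n - 1)) * indicator (slab K t r :: (real ^ 'n ^ 'p) set) x \<partial>lborel)"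
        by (intro nn_integral_cong) (auto simp: \<Gamma>_def indicator_def)
      also have "\<dots> = ennreal (real ?n * (1 - r) ^ (?n - 1)) * emeasure lborel (slab K t r :: (real ^ 'n ^ 'p) set)"
        by (rule nn_integral_cmult_indicator) (simp add: borel_compact[OF comp])
      also have "emeasure lborel (slab K t r :: (real ^ 'n ^ 'p) set) = ennreal (measure lebesgue (slab K t r :: (real ^ 'n ^ 'p) set))"
        using comp by (rule emeasure_compact_eq_measure)
      finally show ?thesis using True by (simp add: ennreal_mult)
    next
      case False
      then have "indicator \<Gamma> (r, x) = (0::ennreal)" for x by (auto simp: \<Gamma>_def)
      then show ?thesis using False by simp
    qed
  qed
  also have "\<dots> = ennreal ?I"
    using has_integral_mixed_volumes[OF K t, where 'p = 'p]
    by (intro nn_integral_has_integral_lebesgue) auto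
  finally show "(\<integral>\<^sup>+x. slab_weight K t (x :: real ^ 'n ^ 'p) \<partial>lborel) = ennreal ?I" .
qed

text \<open>\<open>\<rho>\<close> is the least \<open>r\<close> whose slab contains
  \<open>x\<close>, attained by compactness, and the bound is the mass of the weight beyond it. The
  same \<open>\<rho>\<close> provides the homothet that bounds the fiber from below.\<close>

lemma slab_weight_bounds:
  fixes K :: "(real ^ 'n) set" and x :: "real ^ 'n ^ 'p"
  assumes K: "convex_body K" and t: "0 \<le> t" "t \<le> 1"
  shows "slab_weight K t x = 0 \<or> (\<exists>\<rho>\<in>{0..1}. x \<in> slab K t \<rho> \<and> slab_weight K t x \<le> ennreal ((1 - \<rho>) ^ CARD('n)))"
proof -
  have cK: "compact K" using K by (simp add: convex_body_def)
  define \<Gamma> where "\<Gamma> = {(r, x :: real ^ 'n ^ 'p). r \<in> {0..1} \<and> x \<in> slab K t r}"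
  define R where "R = {r\<in>{0..1}. x \<in> slab K t r}"
  have "R = {0..1} \<inter> (\<lambda>r. (r, x)) -` \<Gamma>" by (auto simp: R_def \<Gamma>_def)
  also have "compact \<dots>"
    using compact_slab_graph[OF cK, of t, where 'p = 'p] unfolding \<Gamma>_def
    by (intro compact_Int_closed closed_vimage compact_imp_closed) (auto intro!: continuous_intros)
  finally have R: "compact R" .
  have w: "slab_weight K t x = (\<integral>\<^sup>+r. ennreal (real CARD('n) * (1 - r) ^ (CARD('n) - 1)) * indicator R r \<partial>lborel)"
    unfolding slab_weight_def by (intro nn_integral_cong) (auto simp: R_def indicator_def)
  show ?thesis
  proof (cases "R = {}")
    case True
    then show ?thesis by (simp add: w)
  next
    case False
    then obtain \<rho> where \<rho>: "\<rho> \<in> R" "\<And>r. r \<in> R \<Longrightarrow> \<rho> \<le> r"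
      using compact_attains_inf[OF R] by blast
    have "slab_weight K t x \<le> (\<integral>\<^sup>+r. indicator {\<rho>..1} r * ennreal (real CARD('n) * (1 - r) ^ (CARD('n) - 1)) \<partial>lborel)"
      unfolding w using \<rho>(2) by (intro nn_integral_mono) (auto simp: indicator_def R_def)
    also have "\<dots> = ennreal ((1 - \<rho>) ^ CARD('n))"
      using \<rho>(1) by (intro nn_integral_beta_tail) (auto simp: R_def Suc_le_eq)
    finally show ?thesis using \<rho>(1) by (auto simp: R_def)
  qed
qed

lemma fiber_contains_homothet:
  fixes K :: "(real ^ 'n) set" and x :: "real ^ 'n ^ 'p"
  assumes K: "convex_body K" and t: "0 \<le> t" "t \<le> 1" and r: "r \<in> {0..1}" and x: "x \<in> slab K t r"
  obtains z0 where "z0 \<in> K" "(\<lambda>w. (1 - r) *\<^sub>R w + r *\<^sub>R z0) ` K \<subseteq> fiber K t x"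
    "measure lebesgue ((\<lambda>w. (1 - r) *\<^sub>R w + r *\<^sub>R z0) ` K) = (1 - r) ^ CARD('n) * measure lebesgue K"
    "(1 - r) ^ CARD('n) * measure lebesgue K \<le> measure lebesgue (fiber K t x)"
proof -
  have cK: "compact K" "convex K" using K by (simp_all add: convex_body_def)
  obtain y z0 where yz: "y \<in> set_power K" "z0 \<in> K" "x = (1 - t + t * r) *\<^sub>R y - (t * r) *\<^sub>R diag z0"
    using x by (auto simp: slab_iff)
  have sub: "(\<lambda>w. (1 - r) *\<^sub>R w + r *\<^sub>R z0) ` K \<subseteq> fiber K t x"
    using r yz by (intro homothet_subset_fiber[OF cK(2) t]) auto
  have meas: "measure lebesgue ((\<lambda>w. (1 - r) *\<^sub>R w + r *\<^sub>R z0) ` K) = (1 - r) ^ CARD('n) * measure lebesgue K"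
    using measure_lebesgue_affine[of "1 - r" "r *\<^sub>R z0" K] r by (simp add: add.commute)
  have "compact ((\<lambda>w. (1 - r) *\<^sub>R w + r *\<^sub>R z0) ` K)"
    using cK by (intro compact_continuous_image continuous_intros)
  then have "measure lebesgue ((\<lambda>w. (1 - r) *\<^sub>R w + r *\<^sub>R z0) ` K) \<le> measure lebesgue (fiber K t x)"
    using sub compact_fiber[OF cK(1)]
    by (intro measure_mono_fmeasurable fmeasurableD lmeasurable_compact)
  then show ?thesis using that yz(2) sub meas by simp
qed


section \<open>The case of equality: fibers with interior are homothets\<close>

lemma AE_lborel_dense:
  fixes x :: "'a::euclidean_space"
  assumes "AE y in lborel. P y" and "\<delta> > 0"
  obtains y where "P y" "dist y x < \<delta>"
proof -
  obtain N where N: "{y \<in> space lborel. \<not> P y} \<subseteq> N" "emeasure lborel N = 0" "N \<in> sets (lborel :: 'a measure)"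
    using assms(1) by (rule AE_E)
  have "N \<in> null_sets lborel" using N(2,3) by (rule null_setsI)
  then have "negligible N"
    unfolding negligible_iff_null_sets by (rule null_sets_completionI)
  moreover have "\<not> negligible (ball x \<delta>)"
    using assms(2) by (intro open_not_negligible) auto
  ultimately have "\<not> ball x \<delta> \<subseteq> N" by (metis negligible_subset)
  then obtain y where "y \<in> ball x \<delta>" "y \<notin> N" by blast
  then show ?thesis using N(1) by (intro that[of y]) (auto simp: dist_commute)
qed

text \<open>A point of \<open>S\<close> outside the closed set \<open>L\<close> is a limit of
  interior points of the convex set \<open>S\<close>, so an open piece of \<open>S\<close> would
  miss \<open>L\<close> and add volume.\<close>

lemma subset_of_measure_le:
  fixes L S :: "'a::euclidean_space set"
  assumes L: "compact L" "interior L \<noteq> {}" and S: "compact S" "convex S"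
    and LS: "L \<subseteq> S" and le: "measure lebesgue S \<le> measure lebesgue L"
  shows "S \<subseteq> L"
proof (rule ccontr)
  assume "\<not> S \<subseteq> L"
  then obtain w where w: "w \<in> S" "w \<notin> L" by blast
  have "interior S \<noteq> {}" using L(2) LS interior_mono by blast
  then have "w \<in> closure (interior S)"
    using w(1) convex_closure_interior[OF S(2)] closure_subset by blast
  moreover have "open (- L)" "w \<in> - L" using L(1) w(2) compact_imp_closed by auto
  ultimately have "interior S \<inter> - L \<noteq> {}"
    by (meson disjoint_iff open_Int_closure_eq_empty)
  then have "\<not> negligible (interior S \<inter> - L)"
    using \<open>open (- L)\<close> by (intro open_not_negligible open_Int) auto
  moreover have "negligible (S - L)"
  proof -
    have meas: "S \<in> lmeasurable" "L \<in> lmeasurable" using S L by (auto intro: lmeasurable_compact)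
    have "measure lebesgue (S - L) = measure lebesgue S - measure lebesgue L"
      using meas LS by (intro measurable_measure_Diff) auto
    then have "measure lebesgue (S - L) = 0" using le measure_nonneg[of lebesgue "S - L"] by linarith
    then show ?thesis using meas by (simp add: negligible_iff_measure fmeasurable.Diff)
  qed
  ultimately show False
    using negligible_subset[of "S - L" "interior S \<inter> - L"] interior_subset by blast
qed

text \<open>This makes the volume of a fiber lower semicontinuous in its base point.\<close>

lemma fiber_shrink:
  fixes x x' :: "real ^ 'n ^ 'p"
  assumes K: "convex K" and t: "0 < t" and \<eta>: "0 < \<eta>" "\<eta> \<le> 1"
    and z0: "cball z0 \<delta> \<subseteq> fiber K t x" "\<delta> \<ge> 0" and x': "norm (x' - x) \<le> \<eta> * t * \<delta>"
  shows "(\<lambda>w. (1 - \<eta>) *\<^sub>R w + \<eta> *\<^sub>R z0) ` fiber K t x \<subseteq> fiber K t x'"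
proof (intro image_subsetI)
  fix w assume w: "w \<in> fiber K t x"
  have "z0 \<in> fiber K t x" using z0 by auto
  then have "(1 - \<eta>) *\<^sub>R w + \<eta> *\<^sub>R z0 \<in> K"
    using K w \<eta> by (intro convexD) (auto simp: fiber_def)
  moreover have "x' $ i + t *\<^sub>R ((1 - \<eta>) *\<^sub>R w + \<eta> *\<^sub>R z0) \<in> K" for i
  proof -
    \<comment> \<open>Rescaled so that \<open>x' $ i = x $ i + \<eta> t v\<close>: the displacement
      is absorbed by the term of weight \<open>\<eta>\<close>, where the ball around
      \<open>z0\<close> leaves room for \<open>v\<close>.\<close>
    define v where "v = (1 / (\<eta> * t)) *\<^sub>R (x' $ i - x $ i)"
    have "norm (x' $ i - x $ i) \<le> norm (x' - x)"
      using Finite_Cartesian_Product.norm_nth_le[of "x' - x" i] by simp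
    then have "norm v \<le> \<delta>"
      using x' \<eta> t by (simp add: v_def divide_le_eq mult_ac)
    then have "z0 + v \<in> fiber K t x" using z0 by (auto simp: dist_norm)
    then have 1: "x $ i + t *\<^sub>R (z0 + v) \<in> K" by (simp add: fiber_def set_power_def)
    have 2: "x $ i + t *\<^sub>R w \<in> K" using w by (simp add: fiber_def set_power_def)
    have "x' $ i = x $ i + (\<eta> * t) *\<^sub>R v" using \<eta> t by (simp add: v_def)
    then have "x' $ i + t *\<^sub>R ((1 - \<eta>) *\<^sub>R w + \<eta> *\<^sub>R z0) =
        (1 - \<eta>) *\<^sub>R (x $ i + t *\<^sub>R w) + \<eta> *\<^sub>R (x $ i + t *\<^sub>R (z0 + v))"
      by (simp add: algebra_simps)
    then show ?thesis using convexD[OF K 2 1, of "1 - \<eta>" \<eta>] \<eta> by simp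
  qed
  ultimately show "(1 - \<eta>) *\<^sub>R w + \<eta> *\<^sub>R z0 \<in> fiber K t x'"
    by (simp add: fiber_def set_power_def)
qed

text \<open>Good points \<open>y k\<close> converge to \<open>x\<close>. Their parameters accumulate
  at some \<open>r\<close>, the closed slab graph keeps \<open>x\<close> in the slab of
  \<open>r\<close>, and semicontinuity bounds the fiber volume by that of a homothet inside the
  fiber, which therefore fills it.\<close>

lemma fiber_homothet_of_AE:
  fixes K :: "(real ^ 'n) set" and x :: "real ^ 'n ^ 'p"
  assumes K: "convex_body K" "interior K \<noteq> {}" and t: "0 < t" "t < 1"
    and ae: "AE x :: real ^ 'n ^ 'p in lborel. measure lebesgue (fiber K t x) = 0 \<or>
      (\<exists>\<rho>\<in>{0..1}. x \<in> slab K t \<rho> \<and> measure lebesgue (fiber K t x) = (1 - \<rho>) ^ CARD('n) * measure lebesgue K)"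
    and int: "interior (fiber K t x) \<noteq> {}"
  shows "\<exists>w \<mu>. \<mu> > 0 \<and> fiber K t x = (\<lambda>z. w + \<mu> *\<^sub>R z) ` K"
proof -
  let ?n = "CARD('n)"
  define g where "g x = measure lebesgue (fiber K t (x :: real ^ 'n ^ 'p))" for x
  have cK: "compact K" "convex K" using K by (simp_all add: convex_body_def)
  have comp: "compact (fiber K t y)" for y :: "real ^ 'n ^ 'p" using cK(1) by (rule compact_fiber)
  have gpos: "g x > 0" unfolding g_def using comp int by (rule measure_pos_of_interior)
  obtain z0 where "z0 \<in> interior (fiber K t x)" using int by blast
  then obtain \<delta> where \<delta>: "\<delta> > 0" "cball z0 \<delta> \<subseteq> fiber K t x"
    by (auto simp: mem_interior_cball)
  \<comment> \<open>Starting at \<open>1/2\<close> keeps \<open>1 - \<eta> k\<close> positive, so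
    the fibers at the good points have positive volume and the zero alternative in \<open>ae\<close>
    is excluded.\<close>
  define \<eta> where "\<eta> k = inverse (real (Suc (Suc k)))" for k
  have \<eta>: "0 < \<eta> k" "\<eta> k < 1" for k by (auto simp: \<eta>_def field_simps)
  have \<eta>0: "\<eta> \<longlonglongrightarrow> 0"
    unfolding \<eta>_def using LIMSEQ_Suc[OF LIMSEQ_inverse_real_of_nat] by simp
  have "\<exists>y. (g y = 0 \<or> (\<exists>\<rho>\<in>{0..1}. y \<in> slab K t \<rho> \<and> g y = (1 - \<rho>) ^ ?n * measure lebesgue K))
      \<and> dist y x < \<eta> k * t * \<delta>" for k
  proof -
    have "\<eta> k * t * \<delta> > 0" using \<eta>[of k] t \<delta> by simp
    with ae obtain y where "measure lebesgue (fiber K t y) = 0 \<or>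
        (\<exists>\<rho>\<in>{0..1}. y \<in> slab K t \<rho> \<and> measure lebesgue (fiber K t y) = (1 - \<rho>) ^ ?n * measure lebesgue K)"
      and "dist y x < \<eta> k * t * \<delta>"
      by (rule AE_lborel_dense)
    then show ?thesis unfolding g_def by blast
  qed
  then obtain y where y: "\<And>k. g (y k) = 0 \<or> (\<exists>\<rho>\<in>{0..1}. y k \<in> slab K t \<rho> \<and> g (y k) = (1 - \<rho>) ^ ?n * measure lebesgue K)"
    "\<And>k. dist (y k) x < \<eta> k * t * \<delta>" by metis
  have lower: "(1 - \<eta> k) ^ ?n * g x \<le> g (y k)" for k
  proof -
    have sub: "(\<lambda>w. (1 - \<eta> k) *\<^sub>R w + \<eta> k *\<^sub>R z0) ` fiber K t x \<subseteq> fiber K t (y k)"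
      using \<eta>[of k] t \<delta> y(2)[of k] by (intro fiber_shrink[OF cK(2)]) (auto simp: dist_norm)
    have "(1 - \<eta> k) ^ ?n * g x = measure lebesgue ((\<lambda>w. (1 - \<eta> k) *\<^sub>R w + \<eta> k *\<^sub>R z0) ` fiber K t x)"
      using measure_lebesgue_affine[of "1 - \<eta> k" "\<eta> k *\<^sub>R z0" "fiber K t x"] \<eta>[of k]
      by (simp add: g_def add.commute)
    also have "\<dots> \<le> g (y k)"
      unfolding g_def using sub comp
      by (intro measure_mono_fmeasurable fmeasurableD lmeasurable_compact compact_continuous_image continuous_intros)
    finally show ?thesis .
  qed
  have "g (y k) > 0" for k
    using lower[of k] gpos \<eta>[of k] by (smt (verit) mult_pos_pos zero_less_power)
  then have "\<exists>\<rho>\<in>{0..1}. y k \<in> slab K t \<rho> \<and> g (y k) = (1 - \<rho>) ^ ?n * measure lebesgue K" for k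
    using y(1)[of k] by (metis less_irrefl)
  then obtain \<rho> where \<rho>: "\<And>k. \<rho> k \<in> {0..1}" "\<And>k. y k \<in> slab K t (\<rho> k)"
    "\<And>k. g (y k) = (1 - \<rho> k) ^ ?n * measure lebesgue K" by metis
  obtain r \<phi> where r: "r \<in> {0..1}" "strict_mono \<phi>" "(\<rho> \<circ> \<phi>) \<longlonglongrightarrow> r"
    using compact_Icc[of 0 "1::real"] \<rho>(1) unfolding compact_def by metis
  have y_lim: "y \<longlonglongrightarrow> x"
  proof (rule metric_LIMSEQ_I)
    fix e :: real assume "e > 0"
    have "(\<lambda>k. \<eta> k * t * \<delta>) \<longlonglongrightarrow> 0 * t * \<delta>" by (intro tendsto_intros \<eta>0)
    then have "eventually (\<lambda>k. \<eta> k * t * \<delta> < e) sequentially"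
      using \<open>e > 0\<close> by (auto dest: order_tendstoD(2))
    then show "\<exists>no. \<forall>n\<ge>no. dist (y n) x < e"
      using y(2) unfolding eventually_sequentially by (meson less_trans)
  qed
  have x_slab: "x \<in> slab K t r"
  proof -
    define \<Gamma> where "\<Gamma> = {(r, x :: real ^ 'n ^ 'p). r \<in> {0..1} \<and> x \<in> slab K t r}"
    have lim: "(\<lambda>k. (\<rho> (\<phi> k), y (\<phi> k))) \<longlonglongrightarrow> (r, x)"
      using r(3) LIMSEQ_subseq_LIMSEQ[OF y_lim r(2)] by (intro tendsto_Pair) (auto simp: o_def)
    have cl: "closed \<Gamma>"
      unfolding \<Gamma>_def by (rule compact_imp_closed[OF compact_slab_graph[OF cK(1)]])
    have "(\<rho> (\<phi> k), y (\<phi> k)) \<in> \<Gamma>" for k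
      using \<rho>(1,2)[of "\<phi> k"] by (simp add: \<Gamma>_def)
    from closed_sequentially[OF cl this lim] show ?thesis by (simp add: \<Gamma>_def)
  qed
  have gle: "g x \<le> (1 - r) ^ ?n * measure lebesgue K"
  proof -
    have "(\<lambda>k. (1 - \<eta> (\<phi> k)) ^ ?n * g x) \<longlonglongrightarrow> (1 - 0) ^ ?n * g x"
      using LIMSEQ_subseq_LIMSEQ[OF \<eta>0 r(2)] by (intro tendsto_intros) (simp add: o_def)
    moreover have "(\<lambda>k. (1 - \<rho> (\<phi> k)) ^ ?n * measure lebesgue K) \<longlonglongrightarrow> (1 - r) ^ ?n * measure lebesgue K"
      using r(3) by (intro tendsto_intros) (simp add: o_def)
    ultimately have "(1 - 0) ^ ?n * g x \<le> (1 - r) ^ ?n * measure lebesgue K"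
      by (rule LIMSEQ_le) (use lower \<rho>(3) in auto)
    then show ?thesis by simp
  qed
  have r1: "r < 1"
  proof (rule ccontr)
    assume "\<not> r < 1"
    then have "r = 1" using r(1) by simp
    then show False using gle gpos by (simp add: power_0_left)
  qed
  obtain z1 where z1: "(\<lambda>w. (1 - r) *\<^sub>R w + r *\<^sub>R z1) ` K \<subseteq> fiber K t x"
    "measure lebesgue ((\<lambda>w. (1 - r) *\<^sub>R w + r *\<^sub>R z1) ` K) = (1 - r) ^ ?n * measure lebesgue K"
    using fiber_contains_homothet[OF K(1) _ _ r(1) x_slab] t by auto
  define L where "L = (\<lambda>w. (1 - r) *\<^sub>R w + r *\<^sub>R z1) ` K"
  have cL: "compact L" unfolding L_def using cK by (intro compact_continuous_image continuous_intros)
  have iL: "interior L \<noteq> {}"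
  proof
    assume "interior L = {}"
    moreover have "convex L"
    proof -
      have "L = (\<lambda>x. r *\<^sub>R z1 + x) ` (\<lambda>w. (1 - r) *\<^sub>R w) ` K"
        by (simp add: L_def image_image add.commute)
      then show ?thesis using cK by (simp add: convex_translation convex_scaling)
    qed
    ultimately have "negligible L" using negligible_convex_interior by blast
    then have "measure lebesgue L = 0" by (simp add: negligible_imp_measure0)
    then show False using z1(2) r1 measure_pos_of_interior[OF cK(1) K(2)] by (simp add: L_def)
  qed
  have "fiber K t x \<subseteq> L"
  proof (rule subset_of_measure_le[OF cL iL comp convex_fiber[OF cK(2)]])
    show "L \<subseteq> fiber K t x" unfolding L_def by (rule z1(1))
    show "measure lebesgue (fiber K t x) \<le> measure lebesgue L"
      using gle z1(2) by (simp add: L_def g_def)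
  qed
  with z1(1) have "fiber K t x = L" unfolding L_def by (rule equalityI[rotated])
  also have "L = (\<lambda>z. r *\<^sub>R z1 + (1 - r) *\<^sub>R z) ` K"
    by (simp add: L_def add.commute)
  finally have "fiber K t x = (\<lambda>z. r *\<^sub>R z1 + (1 - r) *\<^sub>R z) ` K" .
  then show ?thesis using r1 by (intro exI[of _ "r *\<^sub>R z1"] exI[of _ "1 - r"]) simp
qed

lemma slab_weight_le_fiber:
  fixes K :: "(real ^ 'n) set" and x :: "real ^ 'n ^ 'p"
  assumes K: "convex_body K" and t: "0 \<le> t" "t \<le> 1"
  shows "emeasure lborel K * slab_weight K t x \<le> emeasure lborel (fiber K t x)"
proof -
  have cK: "compact K" using K by (simp add: convex_body_def)
  show ?thesis
    using slab_weight_bounds[OF K t, of x]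
  proof
    assume "\<exists>\<rho>\<in>{0..1}. x \<in> slab K t \<rho> \<and> slab_weight K t x \<le> ennreal ((1 - \<rho>) ^ CARD('n))"
    then obtain \<rho> where \<rho>: "\<rho> \<in> {0..1}" "x \<in> slab K t \<rho>" "slab_weight K t x \<le> ennreal ((1 - \<rho>) ^ CARD('n))"
      by blast
    have "emeasure lborel K * slab_weight K t x \<le> emeasure lborel K * ennreal ((1 - \<rho>) ^ CARD('n))"
      using \<rho>(3) by (intro mult_left_mono) auto
    also have "\<dots> = ennreal ((1 - \<rho>) ^ CARD('n) * measure lebesgue K)"
      using \<rho>(1) by (simp add: emeasure_compact_eq_measure[OF cK] ennreal_mult mult.commute)
    also have "\<dots> \<le> ennreal (measure lebesgue (fiber K t x))"
      using fiber_contains_homothet[OF K t \<rho>(1,2)] by (metis ennreal_leI)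
    also have "\<dots> = emeasure lborel (fiber K t x)"
      by (rule emeasure_compact_eq_measure[OF compact_fiber[OF cK], symmetric])
    finally show ?thesis .
  qed simp
qed

text \<open>If \<open>a \<bullet> x = b\<close> on \<open>K\<close>, every slab lies in the
  hyperplane \<open>axis i a \<bullet> x = (1 - t) * b\<close>. This settles bodies of volume
  0.\<close>

lemma negligible_slab:
  fixes K :: "(real ^ 'n) set"
  assumes "convex K" "interior K = {}"
  shows "negligible (slab K t r :: (real ^ 'n ^ 'p) set)"
proof -
  obtain a b where ab: "a \<noteq> 0" "K \<subseteq> {x. a \<bullet> x = b}"
    using empty_interior_subset_hyperplane[OF assms] by blast
  obtain i :: 'p where True by simp
  have "axis i a \<noteq> 0" using ab(1) by (simp add: axis_eq_0_iff)
  moreover have "slab K t r \<subseteq> {x :: real ^ 'n ^ 'p. axis i a \<bullet> x = (1 - t + t * r) * b - (t * r) * b}"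
  proof -
    have "a \<bullet> z = b" if "z \<in> K" for z using ab(2) that by auto
    then show ?thesis by (auto simp: slab_iff inner_diff_right inner_axis' set_power_def)
  qed
  ultimately show ?thesis using negligible_hyperplane negligible_subset by blast
qed

theorem theorem1p7:
  fixes K :: "(real ^ 'n) set"
  assumes "CARD('n) \<ge> 2" and "convex_body K"
  shows "(\<forall>t\<in>{0..1}.
          (\<Sum>j = 0..CARD('n). coeff_c CARD('n) CARD('p) j t
             * mixed_volume
                 (replicate j ((\<lambda>x. - diag x) ` K :: (real ^ 'n ^ 'p) set)
                  @ replicate (CARD('n) * CARD('p) - j) (set_power K)))
          \<le> measure lebesgue K ^ CARD('p::finite)) \<and>
         (aff_dim K = int CARD('n) \<and>
          (\<exists>t\<in>{0<..<1}.
          (\<Sum>j = 0..CARD('n). coeff_c CARD('n) CARD('p) j t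
             * mixed_volume
                 (replicate j ((\<lambda>x. - diag x) ` K :: (real ^ 'n ^ 'p) set)
                  @ replicate (CARD('n) * CARD('p) - j) (set_power K)))
          = measure lebesgue K ^ CARD('p))
            \<longrightarrow> (\<exists>d. d simplex K))"
proof -
  have K: "compact K" "convex K" "K \<noteq> {}" using assms(2) by (simp_all add: convex_body_def)
  define I where "I t = (\<Sum>j = 0..CARD('n). coeff_c CARD('n) CARD('p) j t
             * mixed_volume
                 (replicate j ((\<lambda>x. - diag x) ` K :: (real ^ 'n ^ 'p) set)
                  @ replicate (CARD('n) * CARD('p) - j) (set_power K)))" for t
  define V where "V = measure lebesgue K"
  have V: "emeasure lborel K = ennreal V" "V \<ge> 0"
    using emeasure_compact_eq_measure[OF K(1)] by (auto simp: V_def)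
  have int_fiber: "(\<integral>\<^sup>+x. emeasure lborel (fiber K t (x :: real ^ 'n ^ 'p)) \<partial>lborel) = ennreal (V * V ^ CARD('p))" for t
    using V by (simp add: nn_integral_emeasure_fiber[OF K(1)] ennreal_mult ennreal_power)
  have int_weight: "(\<integral>\<^sup>+x. emeasure lborel K * slab_weight K t (x :: real ^ 'n ^ 'p) \<partial>lborel) = ennreal (V * I t)"
    if t: "0 \<le> t" "t \<le> 1" for t
  proof -
    have "(\<integral>\<^sup>+x. emeasure lborel K * slab_weight K t (x :: real ^ 'n ^ 'p) \<partial>lborel) = ennreal V * ennreal (I t)"
      by (subst nn_integral_cmult[OF borel_measurable_slab_weight[OF assms(2) t]])
        (simp add: nn_integral_slab_weight[OF assms(2) t] I_def V)
    then show ?thesis using V by (simp add: ennreal_mult')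
  qed
  \<comment> \<open>Both integrals carry a factor \<open>V\<close> that has to be cancelled. For
    \<open>V = 0\<close> the sum is evaluated directly and is \<open>0\<close>.\<close>
  have ineq: "I t \<le> V ^ CARD('p)" if t: "0 \<le> t" "t \<le> 1" for t
  proof (cases "V > 0")
    case True
    have "ennreal (V * I t) \<le> ennreal (V * V ^ CARD('p))"
      unfolding int_fiber[of t, symmetric] int_weight[OF t, symmetric]
      by (intro nn_integral_mono slab_weight_le_fiber[OF assms(2) t])
    then have "V * I t \<le> V * V ^ CARD('p)" using V by (simp add: ennreal_le_iff)
    then show ?thesis using True by simp
  next
    case False
    then have "interior K = {}" using measure_pos_of_interior[OF K(1)] V_def by blast
    then have "negligible (slab K t r :: (real ^ 'n ^ 'p) set)" for r
      using K(2) by (rule negligible_slab[rotated])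
    then have "measure lebesgue (slab K t r :: (real ^ 'n ^ 'p) set) = 0" for r
      by (rule negligible_imp_measure0)
    then have "((\<lambda>r::real. 0) has_integral I t) {0..1}"
      using has_integral_mixed_volumes[OF assms(2) t, where 'p = 'p] by (simp add: I_def)
    then have "I t = 0" by (simp add: has_integral_0_eq)
    then show ?thesis using V by simp
  qed
  have simplex: "\<exists>d. d simplex K"
    if dim: "aff_dim K = int CARD('n)" and t: "0 < t" "t < 1" and eq: "I t = V ^ CARD('p)" for t
  proof -
    have int: "interior K \<noteq> {}"
      using dim K by (simp add: interior_rel_interior_gen rel_interior_eq_empty)
    then have "V > 0" unfolding V_def by (rule measure_pos_of_interior[OF K(1)])
    have t': "0 \<le> t" "t \<le> 1" using t by auto
    let ?W = "\<lambda>x :: real ^ 'n ^ 'p. emeasure lborel K * slab_weight K t x"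
    let ?G = "\<lambda>x :: real ^ 'n ^ 'p. emeasure lborel (fiber K t x)"
    have meas: "?W \<in> borel_measurable lborel" "?G \<in> borel_measurable lborel"
      by (intro borel_measurable_times_ennreal borel_measurable_const
          borel_measurable_slab_weight[OF assms(2) t'] borel_measurable_emeasure_fiber[OF K(1)])+
    \<comment> \<open>The pointwise inequality between \<open>?W\<close> and \<open>?G\<close> has
      equal finite integrals on both sides, so it is an equality almost everywhere and all estimates
      in between are sharp there.\<close>
    have "(\<integral>\<^sup>+x. ?G x - ?W x \<partial>lborel) = (\<integral>\<^sup>+x. ?G x \<partial>lborel) - (\<integral>\<^sup>+x. ?W x \<partial>lborel)"
      using meas slab_weight_le_fiber[OF assms(2) t'] by (intro nn_integral_diff) (auto simp: int_weight[OF t'])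
    also have "\<dots> = 0" by (simp add: int_fiber int_weight[OF t'] eq)
    finally have "AE x in lborel. ?G x - ?W x = 0"
      using meas by (subst (asm) nn_integral_0_iff_AE) auto
    then have ae: "AE x :: real ^ 'n ^ 'p in lborel. measure lebesgue (fiber K t x) = 0 \<or>
      (\<exists>\<rho>\<in>{0..1}. x \<in> slab K t \<rho> \<and> measure lebesgue (fiber K t x) = (1 - \<rho>) ^ CARD('n) * V)"
    proof (rule AE_mp, intro AE_I2 impI)
      fix x :: "real ^ 'n ^ 'p" assume "?G x - ?W x = 0"
      then have le: "ennreal (measure lebesgue (fiber K t x)) \<le> ennreal V * slab_weight K t x"
        by (simp add: diff_eq_0_iff_ennreal emeasure_compact_eq_measure[OF compact_fiber[OF K(1)]] V)
      show "measure lebesgue (fiber K t x) = 0 \<or>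
        (\<exists>\<rho>\<in>{0..1}. x \<in> slab K t \<rho> \<and> measure lebesgue (fiber K t x) = (1 - \<rho>) ^ CARD('n) * V)"
        using slab_weight_bounds[OF assms(2) t', of x]
      proof
        assume "slab_weight K t x = 0"
        then show ?thesis using le by (simp add: measure_le_0_iff)
      next
        assume "\<exists>\<rho>\<in>{0..1}. x \<in> slab K t \<rho> \<and> slab_weight K t x \<le> ennreal ((1 - \<rho>) ^ CARD('n))"
        then obtain \<rho> where \<rho>: "\<rho> \<in> {0..1}" "x \<in> slab K t \<rho>" "slab_weight K t x \<le> ennreal ((1 - \<rho>) ^ CARD('n))"
          by blast
        have "ennreal (measure lebesgue (fiber K t x)) \<le> ennreal V * ennreal ((1 - \<rho>) ^ CARD('n))"
          using le \<rho>(3) by (meson mult_left_mono order_trans zero_le)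
        also have "\<dots> = ennreal ((1 - \<rho>) ^ CARD('n) * V)"
          using V \<rho>(1) by (simp add: ennreal_mult mult.commute)
        finally have "measure lebesgue (fiber K t x) \<le> (1 - \<rho>) ^ CARD('n) * V"
          using V \<rho>(1) by (simp add: ennreal_le_iff)
        moreover have "(1 - \<rho>) ^ CARD('n) * V \<le> measure lebesgue (fiber K t x)"
          unfolding V_def using fiber_contains_homothet[OF assms(2) t' \<rho>(1,2)] by metis
        ultimately show ?thesis using \<rho> by auto
      qed
    qed
    show ?thesis
    proof (rule simplex_of_homothetic_intersections[OF K(1,2) int t])
      fix y :: "real ^ 'n"
      \<comment> \<open>On the diagonal all coordinate conditions coincide, so this fiber is
        \<open>K\<close> intersected with the single body \<open>(K - y) / t\<close>.\<close>
      have fib: "{z\<in>K. y + t *\<^sub>R z \<in> K} = fiber K t (diag y :: real ^ 'n ^ 'p)"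
        by (auto simp: fiber_def set_power_def)
      assume "interior {z\<in>K. y + t *\<^sub>R z \<in> K} \<noteq> {}"
      then show "\<exists>w \<mu>. \<mu> > 0 \<and> {z\<in>K. y + t *\<^sub>R z \<in> K} = (\<lambda>x. w + \<mu> *\<^sub>R x) ` K"
        unfolding fib using ae unfolding V_def by (intro fiber_homothet_of_AE[OF assms(2) int t])
    qed
  qed
  show ?thesis
    using ineq simplex unfolding I_def V_def by auto
qed

end
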